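(* Assume $X$ satisfies condition (P). For all $x\in W_c$ and $w\in W\setminus W_c$ with $x<w$, $$D_{x,w}=\sum(-1)^k\prod_{i=1}^{k}P_{x_{i-1},x_i},$$ where the sum runs over all chains $x=x_0<x_1<\cdots<x_k=w$ in $W$ with $1\le k\le\ell(x,w)$ and $x_i\notin W_c$ for all $i\ge1$.
   Context: Let $X$ be a Coxeter graph with Coxeter system $(W,S)$, length function $\ell$, Bruhat order $\le$, identity $e$; write $\varepsilon_w=(-1)^{\ell(w)}$ and $\ell(x,w)=\ell(w)-\ell(x)$. An element of $W$ is fully commutative if any two of its reduced expressions are related by a sequence of moves $ss'\leftrightarrow s's$ with $s,s'\in S$ commuting; $W_c$ denotes the set of fully commutative elements, $[x,w]_c=\{y\in W_c:x\le y\le w\}$ and $(x,w)_c=\{y\in W_c:x<y<w\}$. $\mathcal H$ is the Hecke algebra of $W$ over $\mathcal A=\mathbb Z[q^{1/2},q^{-1/2}]$ with basis $\{T_w\}_{w\in W}$ and multiplication $T_wT_s=T_{ws}$ if $\ell(ws)>\ell(w)$, $T_wT_s=qT_{ws}+(q-1)T_w$ if $\ell(ws)<\ell(w)$. $J$ is the two-sided ideal generated by the elements $\sum_{w\in\langle s,s'\rangle}T_w$ for all pairs of non-commuting $s,s'\in S$ such that $ss'$ has finite order; $TL(X)=\mathcal H/J$, $\sigma:\mathcal H\to TL(X)$ the projection, $t_w=\sigma(T_w)$. $\{t_w:w\in W_c\}$ is an $\mathcal A$-basis of $TL(X)$; for $w\in W$ the polynomials $D_{x,w}\in\mathbb Z[q]$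 ($x\in W_c$) are defined by $t_w=\sum_{x\in W_c,\,x\le w}D_{x,w}t_x$, with $D_{x,w}=0$ if $x\not\le w$ (so $D_{x,w}=\delta_{x,w}$ when $w\in W_c$). Let $\iota$ be the ring involution of $\mathcal H$ with $\iota(q^{1/2})=q^{-1/2}$, $\iota(T_w)=(T_{w^{-1}})^{-1}$; it preserves $J$ and so induces an involution of $TL(X)$. $R_{x,w}$ are the $R$-polynomials, defined by $(T_{w^{-1}})^{-1}=\varepsilon_wq^{-\ell(w)}\sum_{x\le w}\varepsilon_xR_{x,w}T_x$, and $P_{x,w}$ are the Kazhdan–Lusztig polynomials, so that $C'_w=q^{-\ell(w)/2}\sum_{x\le w}P_{x,w}T_x$ is $\iota$-invariant, $P_{w,w}=1$, $\deg P_{x,w}\le(\ell(x,w)-1)/2$ for $x<w$. For $w\in W_c$, the polynomials $a_{y,w}\in\mathbb Z[q]$ ($y\in W_c$) are defined by $\iota(t_w)=(t_{w^{-1}})^{-1}=q^{-\ell(w)}\sum_{y\in W_c,\,y\le w}a_{y,w}t_y$, $a_{y,w}=0$ if $y\not\le w$. Let $p\mapsto\overline p$ be the ring involution of $\mathbb Z[q^{1/2},q^{-1/2}]$ with $q^{1/2}\mapsto q^{-1/2}$. For $w\in W_c$, $\{L_{x,w}\}_{x\in W_c}$ is the unique family in $\mathbb Z[q^{-1/2}]$ with $L_{x,w}=0$ if $x\not\le w$, $L_{w,w}=1$, $L_{x,w}\in q^{-1/2}\mathbb Z[q^{-1/2}]$ if $x<w$, and $L_{x,w}=\sum_{y\in[x,w]_c}q^{(\ell(x)-\ell(y))/2}a_{x,y}\,\overline{L_{y,w}}$;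 set $c_w=\sum_{x\in W_c,\,x\le w}q^{-\ell(x)/2}L_{x,w}t_x$. Condition (P) on $X$: $\sigma(C'_w)=c_w$ for all $w\in W_c$ and $\sigma(C'_w)=0$ for all $w\in W\setminus W_c$. (For finite irreducible or affine $X$, this holds exactly when $X$ has no vertex adjacent to three or more vertices and $X\neq\widetilde F_4$; in particular types $A$, $B$, $F_4$, $H_3$, $H_4$, $I_2(m)$.) *)

theory Defs
  imports "HOL-Computational_Algebra.Formal_Laurent_Series"
begin

text \<open>A Coxeter graph X on the vertex set S (the type 'i) is encoded by its Coxeter matrix
  m :: 'i => 'i => nat, where m s t is the order of s t and the value 0 encodes infinity.\<close>

definition coxeter_matrix :: "('i \<Rightarrow> 'i \<Rightarrow> nat) \<Rightarrow> bool" where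
  "coxeter_matrix m \<longleftrightarrow> (\<forall>s. m s s = 1) \<and> (\<forall>s t. m s t = m t s) \<and> (\<forall>s t. s \<noteq> t \<longrightarrow> m s t \<noteq> 1)"

text \<open>W is the group presented by generators S and relations (s t)^(m s t) = 1 (m s t finite).
  Since every generator is an involution, W is the quotient of the free monoid of words over S
  by the congruence generated by relator = empty word.  Elements of W are congruence classes.\<close>

definition cox_step :: "('i \<Rightarrow> 'i \<Rightarrow> nat) \<Rightarrow> 'i list \<Rightarrow> 'i list \<Rightarrow> bool" where
  "cox_step m a b \<longleftrightarrow> (\<exists>u v s t. m s t \<noteq> 0 \<and> a = u @ concat (replicate (m s t) [s, t]) @ v \<and> b = u @ v)"

definition cox_eq :: "('i \<Rightarrow> 'i \<Rightarrow> nat) \<Rightarrow> 'i list \<Rightarrow> 'i list \<Rightarrow> bool" where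
  "cox_eq m = equivclp (cox_step m)"

definition welt :: "('i \<Rightarrow> 'i \<Rightarrow> nat) \<Rightarrow> 'i list \<Rightarrow> 'i list set" where
  "welt m u = {v. cox_eq m u v}"

definition Wgrp :: "('i \<Rightarrow> 'i \<Rightarrow> nat) \<Rightarrow> 'i list set set" where
  "Wgrp m = range (welt m)"

definition wrep :: "'i list set \<Rightarrow> 'i list" where
  "wrep w = (SOME u. u \<in> w)"

definition wmul :: "('i \<Rightarrow> 'i \<Rightarrow> nat) \<Rightarrow> 'i list set \<Rightarrow> 'i list set \<Rightarrow> 'i list set" where
  "wmul m x y = welt m (wrep x @ wrep y)"

definition wone :: "('i \<Rightarrow> 'i \<Rightarrow> nat) \<Rightarrow> 'i list set" where
  "wone m = welt m []"

definition winv :: "('i \<Rightarrow> 'i \<Rightarrow> nat) \<Rightarrow> 'i list set \<Rightarrow> 'i list set" where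
  "winv m x = welt m (rev (wrep x))"

definition gen :: "('i \<Rightarrow> 'i \<Rightarrow> nat) \<Rightarrow> 'i \<Rightarrow> 'i list set" where
  "gen m s = welt m [s]"

definition wlen :: "'i list set \<Rightarrow> nat" where
  "wlen w = (LEAST n. \<exists>u\<in>w. length u = n)"

definition reduced_words :: "'i list set \<Rightarrow> 'i list set" where
  "reduced_words w = {u \<in> w. length u = wlen w}"

definition reflections :: "('i \<Rightarrow> 'i \<Rightarrow> nat) \<Rightarrow> 'i list set set" where
  "reflections m = {welt m (u @ [s] @ rev u) | u s. True}"

definition bruhat_le :: "('i \<Rightarrow> 'i \<Rightarrow> nat) \<Rightarrow> 'i list set \<Rightarrow> 'i list set \<Rightarrow> bool" where
  "bruhat_le m x w \<longleftrightarrow> x \<in> Wgrp m \<and> w \<in> Wgrp m \<and>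
     (\<lambda>y z. y \<in> Wgrp m \<and> (\<exists>t\<in>reflections m. z = wmul m y t \<and> wlen y < wlen z))\<^sup>*\<^sup>* x w"

definition bruhat_lt :: "('i \<Rightarrow> 'i \<Rightarrow> nat) \<Rightarrow> 'i list set \<Rightarrow> 'i list set \<Rightarrow> bool" where
  "bruhat_lt m x w \<longleftrightarrow> bruhat_le m x w \<and> x \<noteq> w"

definition comm_move :: "('i \<Rightarrow> 'i \<Rightarrow> nat) \<Rightarrow> 'i list \<Rightarrow> 'i list \<Rightarrow> bool" where
  "comm_move m a b \<longleftrightarrow> (\<exists>u v s t. m s t = 2 \<and> a = u @ [s, t] @ v \<and> b = u @ [t, s] @ v)"

definition Wc :: "('i \<Rightarrow> 'i \<Rightarrow> nat) \<Rightarrow> 'i list set set" where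
  "Wc m = {w \<in> Wgrp m. \<forall>a\<in>reduced_words w. \<forall>b\<in>reduced_words w. (comm_move m)\<^sup>*\<^sup>* a b}"

text \<open>Scalars: Laurent polynomials in v = q^(1/2), realised inside int fls with v = fls_X.
  An element of the Hecke algebra is the coefficient function w |-> coefficient of T_w.\<close>

definition lbar :: "int fls \<Rightarrow> int fls" where
  "lbar f = Abs_fls (\<lambda>n. fls_nth f (- n))"

definition hecke_space :: "('i \<Rightarrow> 'i \<Rightarrow> nat) \<Rightarrow> ('i list set \<Rightarrow> int fls) set" where
  "hecke_space m = {h. finite {w. h w \<noteq> 0} \<and> (\<forall>w. h w \<noteq> 0 \<longrightarrow> w \<in> Wgrp m)}"

definition hT :: "'i list set \<Rightarrow> 'i list set \<Rightarrow> int fls" where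
  "hT w = (\<lambda>x. if x = w then 1 else 0)"

text \<open>Right multiplication by T_s, from T_w T_s = T_(ws) if l(ws) > l(w),
  T_w T_s = q T_(ws) + (q-1) T_w otherwise (q = v^2).\<close>
definition hTs :: "('i \<Rightarrow> 'i \<Rightarrow> nat) \<Rightarrow> ('i list set \<Rightarrow> int fls) \<Rightarrow> 'i \<Rightarrow> 'i list set \<Rightarrow> int fls" where
  "hTs m h s = (\<lambda>y. if y \<in> Wgrp m then
      (let ys = wmul m y (gen m s) in
        if wlen ys < wlen y then h ys + (fls_X ^ 2 - 1) * h y else fls_X ^ 2 * h ys)
     else 0)"

definition hTw :: "('i \<Rightarrow> 'i \<Rightarrow> nat) \<Rightarrow> ('i list set \<Rightarrow> int fls) \<Rightarrow> 'i list set \<Rightarrow> 'i list set \<Rightarrow> int fls" where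
  "hTw m h w = foldl (hTs m) h (SOME u. u \<in> reduced_words w)"

definition hmul :: "('i \<Rightarrow> 'i \<Rightarrow> nat) \<Rightarrow> ('i list set \<Rightarrow> int fls) \<Rightarrow> ('i list set \<Rightarrow> int fls) \<Rightarrow> 'i list set \<Rightarrow> int fls" where
  "hmul m h g = (\<lambda>y. \<Sum>w\<in>{w. g w \<noteq> 0}. g w * hTw m h w y)"

definition hinv :: "('i \<Rightarrow> 'i \<Rightarrow> nat) \<Rightarrow> ('i list set \<Rightarrow> int fls) \<Rightarrow> 'i list set \<Rightarrow> int fls" where
  "hinv m h = (THE g. g \<in> hecke_space m \<and> hmul m h g = hT (wone m) \<and> hmul m g h = hT (wone m))"

definition iota :: "('i \<Rightarrow> 'i \<Rightarrow> nat) \<Rightarrow> ('i list set \<Rightarrow> int fls) \<Rightarrow> 'i list set \<Rightarrow> int fls" where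
  "iota m h = (\<lambda>y. \<Sum>w\<in>{w. h w \<noteq> 0}. lbar (h w) * hinv m (hT (winv m w)) y)"

definition dihedral :: "('i \<Rightarrow> 'i \<Rightarrow> nat) \<Rightarrow> 'i \<Rightarrow> 'i \<Rightarrow> 'i list set set" where
  "dihedral m s t = {welt m u | u. set u \<subseteq> {s, t}}"

definition J_gen :: "('i \<Rightarrow> 'i \<Rightarrow> nat) \<Rightarrow> 'i \<Rightarrow> 'i \<Rightarrow> 'i list set \<Rightarrow> int fls" where
  "J_gen m s t = (\<lambda>y. if y \<in> dihedral m s t then 1 else 0)"

text \<open>Two-sided ideal generated by the sums over the subgroups generated by s, t where
  s, t do not commute and s t has finite order (i.e. 3 <= m s t).\<close>
inductive_set hJ :: "('i \<Rightarrow> 'i \<Rightarrow> nat) \<Rightarrow> ('i list set \<Rightarrow> int fls) set" for m where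
  J_gen: "3 \<le> m s t \<Longrightarrow> J_gen m s t \<in> hJ m"
| J_zero: "(\<lambda>_. 0) \<in> hJ m"
| J_add: "a \<in> hJ m \<Longrightarrow> b \<in> hJ m \<Longrightarrow> (\<lambda>y. a y + b y) \<in> hJ m"
| J_lmul: "a \<in> hJ m \<Longrightarrow> h \<in> hecke_space m \<Longrightarrow> hmul m h a \<in> hJ m"
| J_rmul: "a \<in> hJ m \<Longrightarrow> h \<in> hecke_space m \<Longrightarrow> hmul m a h \<in> hJ m"

text \<open>D_(x,w): t_w = sum over fully commutative x <= w of D_(x,w) t_x in TL(X), i.e.
  T_w - sum D_(x,w) T_x lies in J (the sum of d(x) T_x has coefficient function d).\<close>
definition Dcoef :: "('i \<Rightarrow> 'i \<Rightarrow> nat) \<Rightarrow> 'i list set \<Rightarrow> 'i list set \<Rightarrow> int fls" where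
  "Dcoef m x w = (THE d. (\<forall>y. d y \<noteq> 0 \<longrightarrow> y \<in> Wc m \<and> bruhat_le m y w) \<and>
                          (\<lambda>y. hT w y - d y) \<in> hJ m) x"

text \<open>Kazhdan-Lusztig polynomials (as elements of Z[q], q = v^2).\<close>
definition kl_family :: "('i \<Rightarrow> 'i \<Rightarrow> nat) \<Rightarrow> 'i list set \<Rightarrow> ('i list set \<Rightarrow> int fls) \<Rightarrow> bool" where
  "kl_family m w P \<longleftrightarrow> P w = 1 \<and> (\<forall>x. P x \<noteq> 0 \<longrightarrow> bruhat_le m x w) \<and>
     (\<forall>x. bruhat_lt m x w \<longrightarrow> (\<forall>n. fls_nth (P x) n \<noteq> 0 \<longrightarrow> 0 \<le> n \<and> even n \<and> n \<le> int (wlen w) - int (wlen x) - 1)) \<and>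
     iota m (\<lambda>x. fls_X_intpow (- int (wlen w)) * P x) = (\<lambda>x. fls_X_intpow (- int (wlen w)) * P x)"

definition kl :: "('i \<Rightarrow> 'i \<Rightarrow> nat) \<Rightarrow> 'i list set \<Rightarrow> 'i list set \<Rightarrow> int fls" where
  "kl m x w = (THE P. kl_family m w P) x"

definition Cprime :: "('i \<Rightarrow> 'i \<Rightarrow> nat) \<Rightarrow> 'i list set \<Rightarrow> 'i list set \<Rightarrow> int fls" where
  "Cprime m w = (\<lambda>x. fls_X_intpow (- int (wlen w)) * kl m x w)"

text \<open>a_(y,w) for w fully commutative: iota(t_w) = q^(-l(w)) sum a_(y,w) t_y.\<close>
definition acoef :: "('i \<Rightarrow> 'i \<Rightarrow> nat) \<Rightarrow> 'i list set \<Rightarrow> 'i list set \<Rightarrow> int fls" where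
  "acoef m y w = (THE a. (\<forall>z. a z \<noteq> 0 \<longrightarrow> z \<in> Wc m \<and> bruhat_le m z w) \<and>
                         (\<lambda>z. iota m (hT w) z - fls_X_intpow (- 2 * int (wlen w)) * a z) \<in> hJ m) y"

definition L_family :: "('i \<Rightarrow> 'i \<Rightarrow> nat) \<Rightarrow> 'i list set \<Rightarrow> ('i list set \<Rightarrow> int fls) \<Rightarrow> bool" where
  "L_family m w L \<longleftrightarrow> (\<forall>x. L x \<noteq> 0 \<longrightarrow> x \<in> Wc m \<and> bruhat_le m x w) \<and> L w = 1 \<and>
     (\<forall>x n. fls_nth (L x) n \<noteq> 0 \<longrightarrow> n \<le> 0) \<and>
     (\<forall>x. bruhat_lt m x w \<longrightarrow> (\<forall>n. fls_nth (L x) n \<noteq> 0 \<longrightarrow> n \<le> -1)) \<and>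
     (\<forall>x\<in>Wc m. L x = (\<Sum>y\<in>{y \<in> Wc m. bruhat_le m x y \<and> bruhat_le m y w}.
          fls_X_intpow (int (wlen x) - int (wlen y)) * acoef m x y * lbar (L y)))"

definition Lcoef :: "('i \<Rightarrow> 'i \<Rightarrow> nat) \<Rightarrow> 'i list set \<Rightarrow> 'i list set \<Rightarrow> int fls" where
  "Lcoef m x w = (THE L. L_family m w L) x"

text \<open>c_w = sum q^(-l(x)/2) L_(x,w) t_x, as a coefficient function on T-basis representatives.\<close>
definition cw :: "('i \<Rightarrow> 'i \<Rightarrow> nat) \<Rightarrow> 'i list set \<Rightarrow> 'i list set \<Rightarrow> int fls" where
  "cw m w = (\<lambda>x. if x \<in> Wc m \<and> bruhat_le m x w then fls_X_intpow (- int (wlen x)) * Lcoef m x w else 0)"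

text \<open>Condition (P): sigma(C'_w) = c_w for w in W_c, sigma(C'_w) = 0 otherwise.\<close>
definition condition_P :: "('i \<Rightarrow> 'i \<Rightarrow> nat) \<Rightarrow> bool" where
  "condition_P m \<longleftrightarrow>
     (\<forall>w\<in>Wc m. (\<lambda>y. Cprime m w y - cw m w y) \<in> hJ m) \<and>
     (\<forall>w\<in>Wgrp m - Wc m. Cprime m w \<in> hJ m)"

text \<open>Chains x = x_0 < x_1 < ... < x_k = w, encoded by the list [x_1, ..., x_k].\<close>
definition nfc_chains :: "('i \<Rightarrow> 'i \<Rightarrow> nat) \<Rightarrow> 'i list set \<Rightarrow> 'i list set \<Rightarrow> 'i list set list set" where
  "nfc_chains m x w = {cs. 1 \<le> length cs \<and> length cs \<le> wlen w - wlen x \<and> last cs = w \<and>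
      (\<forall>i<length cs. bruhat_lt m ((x # cs) ! i) ((x # cs) ! Suc i)) \<and>
      (\<forall>y\<in>set cs. y \<notin> Wc m)}"

end

(*
Condition (P) puts C'_w, hence also sum_x P_{x,w} T_x, into J for every w outside W_c. Solving for T_w
and substituting recursively for all non-fully-commutative T_z gives T_w = sum_x (chain sum) T_x modulo J
with x in W_c, and D_{x,w} is this coefficient because the t_x, x in W_c, are linearly independent.

Linear independence holds for every Coxeter graph and is proved by rewriting. In terms of
b_s = q^(-1/2) (T_s + 1) the relations are b_s b_s = (q^(1/2) + q^(-1/2)) b_s, commutations, and Chebyshev
relations expressing an alternating word of length m(s,t) by shorter ones; Levi's lemma for the trace
monoid shows that this system is confluent modulo commutations. Its normal form coefficients are
functionals on the free algebra that respect the relations; T_s acts on such functionals, J acts by zero, and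
T_w has leading term b_w. The same action at q = 1 shows that s t has order exactly m(s,t) in W.

The Kazhdan-Lusztig polynomials, given by a definite description, are shown to exist and to be unique by
the usual recursion C'_{ws} = C'_w C'_s - sum mu(z,w) C'_z.
*)
theory Submission
  imports Defs
begin

section \<open>Commutation classes of words\<close>

text \<open>Confluence has to be checked for overlaps inside traces: up to commutation the letters
  of one redex may stand among those of the other. Levi's lemma cuts two factorisations of one trace
  into a three by three array, and since a redex is alone in its commutation class, its own cuts are
  cuts of words. TL(X) is never formed as a quotient. The Hecke algebra acts from the right on
  functionals that respect the relations, with \<open>T_s = v b_s - 1\<close>. That J acts by zero
  comes from a formal identity valid for every k: the sum of \<open>T_u\<close> over the interval
  below an alternating word of length k equals v^k times the k-th Chebyshev element. At k = m(s,t)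
  one side is the generator of J and the other is the relation. The orders of the products s t are
  needed early: alternating words of length up to m(s,t) must be reduced before Matsumoto's theorem
  makes \<open>T_w\<close> independent of the reduced word, and pairwise distinct before the
  generator of J becomes a sum over words. The presentation of W gives only upper bounds for these
  orders, hence the detour through q = 1.\<close>

fun alt :: "'a \<Rightarrow> 'a \<Rightarrow> nat \<Rightarrow> 'a list" where
  "alt s t 0 = []"
| "alt s t (Suc k) = s # alt t s k"

lemma length_alt [simp]: "length (alt s t k) = k"
  by (induction k arbitrary: s t) auto

lemma set_alt_subset: "set (alt s t k) \<subseteq> {s, t}"
  by (induction k arbitrary: s t) fastforce+

lemma set_alt: "2 \<le> k \<Longrightarrow> set (alt s t k) = {s, t}"
  using set_alt_subset[of s t k] by (auto simp: numeral_2_eq_2 Suc_le_eq dest!: less_imp_Suc_add)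

lemma alt_append: "alt s t (j + k) = alt s t j @ (if even j then alt s t k else alt t s k)"
  by (induction j arbitrary: s t) auto

lemma alt_snoc: "alt s t (Suc k) = alt s t k @ [if even k then s else t]"
  using alt_append[of s t k 1] by auto

lemma rev_alt: "rev (alt s t k) = (if even k then alt t s k else alt s t k)"
proof (induction k arbitrary: s t)
  case (Suc k)
  have "rev (alt s t (Suc k)) = rev (alt t s k) @ [s]" by simp
  then show ?case by (simp add: Suc alt_snoc del: alt.simps)
qed simp

lemma alt_append_eq:
  assumes "a @ b = alt s t k"
  shows "a = alt s t (length a)"
    and "b = (if even (length a) then alt s t (length b) else alt t s (length b))"
proof -
  have k: "k = length a + length b" using arg_cong[OF assms, of length] by simp
  show "a = alt s t (length a)"
    and "b = (if even (length a) then alt s t (length b) else alt t s (length b))"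
    using assms unfolding k alt_append by auto
qed

lemma alt_inject: "2 \<le> k \<Longrightarrow> alt s t k = alt s' t' k \<longleftrightarrow> s = s' \<and> t = t'"
  by (auto simp: numeral_2_eq_2 Suc_le_eq dest!: less_imp_Suc_add)

lemma alt_concat: "concat (replicate n [s, t]) = alt s t (2 * n)"
  by (induction n) auto

locale coxeter =
  fixes m :: "'i \<Rightarrow> 'i \<Rightarrow> nat"
  assumes cm: "coxeter_matrix m"
begin

lemma m_self [simp]: "m s s = 1" and m_sym: "m s t = m t s" and m_ne1: "s \<noteq> t \<Longrightarrow> m s t \<noteq> 1"
  using cm by (auto simp: coxeter_matrix_def)

lemma m_ne_cases: "s \<noteq> t \<Longrightarrow> m s t = 0 \<or> m s t = 2 \<or> 3 \<le> m s t"
  using m_ne1[of s t] by linarith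

definition ceq :: "'i list \<Rightarrow> 'i list \<Rightarrow> bool"  (infix "\<simeq>" 50) where
  "ceq = (comm_move m)\<^sup>*\<^sup>*"

definition par :: "'i list \<Rightarrow> 'i list \<Rightarrow> bool" where
  "par a b \<longleftrightarrow> (\<forall>x\<in>set a. \<forall>y\<in>set b. m x y = 2)"

lemma par_sym: "par a b \<Longrightarrow> par b a"
  unfolding par_def by (metis m_sym)

lemma par_simps [simp]: "par [] a" "par a []"
  "par (a @ b) c \<longleftrightarrow> par a c \<and> par b c" "par a (b @ c) \<longleftrightarrow> par a b \<and> par a c"
  "par (x # y # a) c \<longleftrightarrow> par [x] c \<and> par (y # a) c"
  by (auto simp: par_def)

lemma par_mono: "par a b \<Longrightarrow> set a' \<subseteq> set a \<Longrightarrow> set b' \<subseteq> set b \<Longrightarrow> par a' b'"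
  by (auto simp: par_def)

lemma ceq_refl [simp]: "u \<simeq> u" by (simp add: ceq_def)

lemma ceq_trans [trans]: "u \<simeq> v \<Longrightarrow> v \<simeq> w \<Longrightarrow> u \<simeq> w"
  by (simp add: ceq_def)

lemma comm_move_sym: "comm_move m a b \<Longrightarrow> comm_move m b a"
  unfolding comm_move_def by (metis m_sym)

lemma ceq_sym: "u \<simeq> v \<Longrightarrow> v \<simeq> u"
  unfolding ceq_def
  by (induction rule: rtranclp_induct) (auto intro: comm_move_sym converse_rtranclp_into_rtranclp)

lemma comm_move_ctxt: "comm_move m a b \<Longrightarrow> comm_move m (x @ a @ y) (x @ b @ y)"
  unfolding comm_move_def by (metis append.assoc)

lemma ceq_ctxt: "a \<simeq> b \<Longrightarrow> x @ a @ y \<simeq> x @ b @ y"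
  unfolding ceq_def
  by (induction rule: rtranclp_induct) (auto intro: comm_move_ctxt rtranclp.rtrancl_into_rtrancl)

lemma ceq_append: "a \<simeq> b \<Longrightarrow> c \<simeq> d \<Longrightarrow> a @ c \<simeq> b @ d"
  using ceq_ctxt[of a b "[]" c] ceq_ctxt[of c d b "[]"] by (auto intro: ceq_trans)

lemma ceq_mset: "a \<simeq> b \<Longrightarrow> length a = length b \<and> set a = set b"
  unfolding ceq_def
proof (induction rule: rtranclp_induct)
  case (step y z)
  have "length y = length z" "set y = set z"
    using step(2) unfolding comm_move_def by force+
  then show ?case using step.IH by simp
qed simp

lemma ceq_par: "a \<simeq> a' \<Longrightarrow> b \<simeq> b' \<Longrightarrow> par a b = par a' b'"
  using ceq_mset by (simp add: par_def)

lemma par_swap1: "par [x] b \<Longrightarrow> x # b \<simeq> b @ [x]"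
proof (induction b)
  case (Cons y b)
  have "comm_move m (x # y # b) (y # x # b)"
    using Cons.prems unfolding comm_move_def
    by (intro exI[of _ "[]"] exI[of _ b] exI[of _ x] exI[of _ y]) (auto simp: par_def)
  hence "x # y # b \<simeq> y # x # b" by (simp add: ceq_def)
  also have "y # x # b \<simeq> y # b @ [x]"
    using Cons ceq_ctxt[of "x # b" "b @ [x]" "[y]" "[]"] by (simp add: par_def)
  finally show ?case by simp
qed simp

lemma par_swap: "par a b \<Longrightarrow> a @ b \<simeq> b @ a"
proof (induction a)
  case (Cons x a)
  have "x # a @ b \<simeq> x # b @ a" using Cons ceq_ctxt[of "a @ b" "b @ a" "[x]" "[]"] by (simp add: par_def)
  also have "x # b @ a \<simeq> b @ x # a" using Cons.prems ceq_ctxt[OF par_swap1, of x b "[]" a] by (simp add: par_def)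
  finally show ?case by simp
qed simp

lemma sw: "par a b \<Longrightarrow> x @ a @ b @ y \<simeq> x @ b @ a @ y"
  using ceq_ctxt[OF par_swap, of a b x y] by simp

text \<open>The first letter can be followed through the swaps. It only passes letters that commute
  with it, so the letters standing before it always commute with it, and deleting it leaves
  equivalent words.\<close>

lemma ceq_Cons_elim:
  assumes "x # u \<simeq> v"
  shows "\<exists>v1 v2. v = v1 @ x # v2 \<and> par [x] v1 \<and> u \<simeq> v1 @ v2"
  using assms unfolding ceq_def
proof (induction rule: rtranclp_induct)
  case base
  show ?case by (rule exI[of _ "[]"]) auto
next
  case (step y z)
  then obtain v1 v2 where y: "y = v1 @ x # v2" and px: "par [x] v1" and u: "u \<simeq> v1 @ v2"
    by (auto simp: ceq_def)
  obtain p s t q where st: "m s t = 2" and y': "y = p @ [s, t] @ q" and z: "z = p @ [t, s] @ q"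
    using step(2) by (auto simp: comm_move_def)
  have mv: "a @ [s, t] @ b \<simeq> a @ [t, s] @ b" for a b
    unfolding ceq_def comm_move_def using st by (intro r_into_rtranclp) blast
  have "v1 @ x # v2 = p @ [s, t] @ q" using y y' by simp
  \<comment> \<open>The swap lies before the tracked letter, moves it to the left, moves it to the
    right, or lies behind it.\<close>
  then consider
      (a) w where "v1 = p @ [s, t] @ w" "q = w @ x # v2"
    | (b) "v1 = p @ [s]" "x = t" "v2 = q"
    | (c) "v1 = p" "x = s" "v2 = t # q"
    | (d) w where "p = v1 @ x # w" "v2 = w @ [s, t] @ q"
    by (auto simp: append_eq_append_conv2 append_eq_Cons_conv Cons_eq_append_conv)
  then show ?case
  proof cases
    case a
    have "u \<simeq> (p @ [t, s] @ w) @ v2" using u a mv[of p "w @ v2"] by (auto intro: ceq_trans)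
    moreover have "par [x] (p @ [t, s] @ w)" using px a by (auto simp: par_def)
    ultimately show ?thesis using z a by (intro exI[of _ "p @ [t, s] @ w"] exI[of _ v2]) (auto simp: ceq_def)
  next
    case b
    then show ?thesis using z px u by (intro exI[of _ p] exI[of _ "s # v2"]) (auto simp: par_def ceq_def)
  next
    case c
    then show ?thesis using z px u st by (intro exI[of _ "p @ [t]"] exI[of _ q]) (auto simp: par_def ceq_def)
  next
    case d
    have "u \<simeq> v1 @ w @ [t, s] @ q" using u d mv[of "v1 @ w" q] by (auto intro: ceq_trans)
    then show ?thesis using z d px by (intro exI[of _ v1] exI[of _ "w @ [t, s] @ q"]) (auto simp: ceq_def)
  qed
qed

text \<open>Levi's lemma for traces. The parts \<open>t2\<close> and \<open>t3\<close> occur in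
  opposite orders in the two factorisations, so they must commute. The induction hands the first
  letter of \<open>a\<close> to whichever of \<open>c\<close> and \<open>d\<close> contains
  it.\<close>

lemma levi:
  assumes "a @ b \<simeq> c @ d"
  shows "\<exists>t1 t2 t3 t4. a \<simeq> t1 @ t2 \<and> b \<simeq> t3 @ t4 \<and> c \<simeq> t1 @ t3 \<and> d \<simeq> t2 @ t4 \<and> par t2 t3"
  using assms
proof (induction a arbitrary: c d)
  case Nil
  then show ?case by (intro exI[of _ "[]"] exI[of _ c] exI[of _ d]) auto
next
  case (Cons x a)
  obtain v1 v2 where v: "c @ d = v1 @ x # v2" and px: "par [x] v1" and u: "a @ b \<simeq> v1 @ v2"
    using ceq_Cons_elim[of x "a @ b" "c @ d"] Cons.prems by auto
  from v consider (c) c2 where "c = v1 @ x # c2" "v2 = c2 @ d" | (d) d1 where "v1 = c @ d1" "d = d1 @ x # v2"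
    by (auto simp: append_eq_append_conv2 append_eq_Cons_conv Cons_eq_append_conv)
  then show ?case
  proof cases
    case c
    obtain t1 t2 t3 t4 where t: "a \<simeq> t1 @ t2" "b \<simeq> t3 @ t4" "v1 @ c2 \<simeq> t1 @ t3" "d \<simeq> t2 @ t4" "par t2 t3"
      using Cons.IH[of "v1 @ c2" d] u c by auto
    have "c \<simeq> x # v1 @ c2" using sw[of v1 "[x]" "[]" c2] px c by (auto intro: ceq_sym par_sym)
    also have "x # v1 @ c2 \<simeq> x # t1 @ t3" using ceq_ctxt[OF t(3), of "[x]" "[]"] by simp
    finally have "c \<simeq> x # t1 @ t3" .
    moreover have "x # a \<simeq> x # t1 @ t2" using ceq_ctxt[OF t(1), of "[x]" "[]"] by simp
    ultimately show ?thesis using t by (intro exI[of _ "x # t1"] exI[of _ t2] exI[of _ t3] exI[of _ t4]) auto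
  next
    case d
    obtain t1 t2 t3 t4 where t: "a \<simeq> t1 @ t2" "b \<simeq> t3 @ t4" "c \<simeq> t1 @ t3" "d1 @ v2 \<simeq> t2 @ t4" "par t2 t3"
      using Cons.IH[of c "d1 @ v2"] u d by auto
    have pc: "par [x] c" "par [x] d1" using px d by auto
    have pt: "par [x] t1" "par [x] t3" using pc(1) ceq_par[OF ceq_refl t(3), of "[x]"] by auto
    have "d \<simeq> x # d1 @ v2" using sw[of d1 "[x]" "[]" v2] pc d by (auto intro: ceq_sym par_sym)
    also have "x # d1 @ v2 \<simeq> x # t2 @ t4" using ceq_ctxt[OF t(4), of "[x]" "[]"] by simp
    finally have "d \<simeq> x # t2 @ t4" .
    moreover have "x # a \<simeq> t1 @ x # t2"
      using ceq_ctxt[OF t(1), of "[x]" "[]"] sw[of "[x]" t1 "[]" t2] pt by (auto intro: ceq_trans)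
    moreover have "par (x # t2) t3" using t(5) pt by (simp add: par_def)
    ultimately show ?thesis using t by (intro exI[of _ t1] exI[of _ "x # t2"] exI[of _ t3] exI[of _ t4]) simp
  qed
qed

text \<open>Here \<open>t\<close> with indices i, j collects the letters in the i-th factor on the
  left and the j-th factor on the right. Two entries commute whenever reading by rows and reading by
  columns order them differently.\<close>

lemma levi3:
  assumes "p @ R @ q \<simeq> p' @ R' @ q'"
  obtains t11 t12 t13 t21 t22 t23 t31 t32 t33 where
    "p \<simeq> t11 @ t12 @ t13" "R \<simeq> t21 @ t22 @ t23" "q \<simeq> t31 @ t32 @ t33"
    "p' \<simeq> t11 @ t21 @ t31" "R' \<simeq> t12 @ t22 @ t32" "q' \<simeq> t13 @ t23 @ t33"
    "par t12 t21" "par t12 t31" "par t13 t21" "par t13 t22" "par t13 t31" "par t13 t32"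
    "par t22 t31" "par t23 t31" "par t23 t32"
proof -
  obtain t11 P Q Z where 1: "p \<simeq> t11 @ P" "R @ q \<simeq> Q @ Z" "p' \<simeq> t11 @ Q" "R' @ q' \<simeq> P @ Z" "par P Q"
    using levi[OF assms] by blast
  obtain t21 R2 t31 Z1 where 2: "R \<simeq> t21 @ R2" "q \<simeq> t31 @ Z1" "Q \<simeq> t21 @ t31" "Z \<simeq> R2 @ Z1" "par R2 t31"
    using levi[OF 1(2)] by blast
  obtain t12 R3 t13 Z2 where 3: "R' \<simeq> t12 @ R3" "q' \<simeq> t13 @ Z2" "P \<simeq> t12 @ t13" "Z \<simeq> R3 @ Z2" "par R3 t13"
    using levi[OF 1(4)] by blast
  have "R2 @ Z1 \<simeq> R3 @ Z2" using 2(4) 3(4) ceq_sym ceq_trans by blast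
  then obtain t22 t23 t32 t33 where 4: "R2 \<simeq> t22 @ t23" "Z1 \<simeq> t32 @ t33" "R3 \<simeq> t22 @ t32" "Z2 \<simeq> t23 @ t33" "par t23 t32"
    using levi by blast
  have A: "p \<simeq> t11 @ t12 @ t13" "p' \<simeq> t11 @ t21 @ t31"
    using 1(1,3) ceq_append[OF ceq_refl 3(3)] ceq_append[OF ceq_refl 2(3)] ceq_trans by blast+
  have B: "R \<simeq> t21 @ t22 @ t23" "R' \<simeq> t12 @ t22 @ t32"
    using 2(1) 3(1) ceq_append[OF ceq_refl 4(1)] ceq_append[OF ceq_refl 4(3)] ceq_trans by blast+
  have C: "q \<simeq> t31 @ t32 @ t33" "q' \<simeq> t13 @ t23 @ t33"
    using 2(2) 3(2) ceq_append[OF ceq_refl 4(2)] ceq_append[OF ceq_refl 4(4)] ceq_trans by blast+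
  have D: "par (t12 @ t13) (t21 @ t31)" using 1(5) ceq_par[OF 3(3) 2(3)] by simp
  have E: "par (t22 @ t23) t31" "par (t22 @ t32) t13"
    using 2(5) 3(5) ceq_par[OF 4(1) ceq_refl, of t31] ceq_par[OF 4(3) ceq_refl, of t13] by auto
  show thesis using A B C D E 4(5) that[of t11 t12 t13 t21 t22 t23 t31 t32 t33]
    by (auto simp: par_sym)
qed

end

section \<open>Confluence of the Temperley--Lieb relations modulo commutation\<close>

text \<open>\<open>dc k j\<close> is the coefficient of the alternating word of length \<open>j\<close> in the \<open>k\<close>-th Chebyshev-like
  element \<open>D\<^sub>k\<^sub>+\<^sub>2 = D\<^sub>k\<^sub>+\<^sub>1 b - D\<^sub>k\<close>, \<open>D\<^sub>0 = 0\<close>, of a dihedral subgroup, which is \<open>C'\<close> of the alternating product of length \<open>k\<close>.\<close>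

fun dc :: "nat \<Rightarrow> nat \<Rightarrow> 'a::comm_ring_1" where
  "dc 0 j = 0"
| "dc (Suc 0) j = (if j = 1 then 1 else 0)"
| "dc (Suc (Suc k)) j = (if j = 0 then 0 else dc (Suc k) (j - 1)) - dc k j"

lemma dc_nz: "dc k j \<noteq> (0::'a::comm_ring_1) \<Longrightarrow> 1 \<le> j \<and> j \<le> k \<and> (even j \<longleftrightarrow> even k)"
proof (induction k j rule: dc.induct)
  case (3 k j)
  have "(j \<noteq> 0 \<and> dc (Suc k) (j - 1) \<noteq> (0::'a)) \<or> dc k j \<noteq> (0::'a)" using 3(3) by (auto split: if_splits)
  then show ?case
  proof
    assume h: "j \<noteq> 0 \<and> dc (Suc k) (j - 1) \<noteq> (0::'a)"
    then show ?thesis using 3(1) by auto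
  next
    assume h: "dc k j \<noteq> (0::'a)"
    then show ?thesis using 3(2) by auto
  qed
qed (auto split: if_splits)

lemma dc_top: "dc (Suc k) (Suc k) = (1::'a::comm_ring_1)"
proof (induction k)
  case (Suc k)
  have "dc k (Suc (Suc k)) = (0::'a)" using dc_nz[of k "Suc (Suc k)"] by auto
  then show ?case using Suc by simp
qed simp

context coxeter begin

text \<open>The case \<open>s = t\<close> covers the quadratic relation: \<open>alt s s 2 = [s, s]\<close>.\<close>

definition isr :: "'i \<Rightarrow> 'i \<Rightarrow> bool" where "isr s t \<longleftrightarrow> s = t \<or> 3 \<le> m s t"

definition lng :: "'i \<Rightarrow> 'i \<Rightarrow> nat" where "lng s t = (if s = t then 2 else m s t)"

abbreviation rdx :: "'i \<Rightarrow> 'i \<Rightarrow> 'i list" where "rdx s t \<equiv> alt s t (lng s t)"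

lemma lng_ge2: "isr s t \<Longrightarrow> 2 \<le> lng s t"
  by (auto simp: isr_def lng_def)

lemma set_rdx: "isr s t \<Longrightarrow> set (rdx s t) = {s, t}"
  using lng_ge2 set_alt by metis

lemma adj_alt:
  assumes "u @ a # b # v = alt s t k" shows "(a = s \<and> b = t) \<or> (a = t \<and> b = s)"
  using alt_append_eq(2)[of u "a # b # v" s t k] assms by (auto split: if_splits)

text \<open>Neighbouring letters of a redex are \<open>s\<close> and \<open>t\<close>, which never
  have \<open>m s t = 2\<close>, so no swap applies.\<close>

lemma rdx_single: assumes "isr s t" "rdx s t \<simeq> v" shows "v = rdx s t"
proof -
  have "\<not> comm_move m (rdx s t) b" for b
  proof
    assume "comm_move m (rdx s t) b"
    then obtain x a c y where 1: "m a c = 2" "x @ a # c # y = rdx s t" by (auto simp: comm_move_def)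
    then have "(a = s \<and> c = t) \<or> (a = t \<and> c = s)" using adj_alt by metis
    then show False using 1(1) assms(1) m_sym[of s t] m_self[of s] by (auto simp: isr_def)
  qed
  then show ?thesis using assms(2) unfolding ceq_def by (metis converse_rtranclpE)
qed

text \<open>A cut of at least three alternating letters leaves a piece with two neighbouring ones. A
  commutation with that piece then extends, by \<open>par_full\<close>, to every word in
  \<open>s\<close> and \<open>t\<close>, hence to all terms that may replace the redex.\<close>

lemma rdx_full:
  assumes "isr s t" "a @ b = rdx s t" shows "set a = {s, t} \<or> set b = {s, t}"
proof -
  have k: "lng s t = length a + length b" using arg_cong[OF assms(2), of length] by simp
  note e = alt_append_eq[OF assms(2)]
  show ?thesis
  proof (cases "s = t")
    case True
    then have "length a + length b = 2" using k by (simp add: lng_def)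
    then have "0 < length a \<or> 0 < length b" by linarith
    moreover have "set a \<subseteq> {s}" "set b \<subseteq> {s}"
      using True set_rdx[OF assms(1)] assms(2) by (metis Un_upper1 Un_upper2 insert_absorb2 set_append)+
    ultimately show ?thesis using True by (metis insert_absorb2 length_greater_0_conv set_empty subset_singleton_iff)
  next
    case False
    then have "3 \<le> length a + length b" using k assms(1) by (simp add: lng_def isr_def)
    then have "2 \<le> length a \<or> 2 \<le> length b" by linarith
    then show ?thesis
    proof
      assume "2 \<le> length a"
      then show ?thesis using e(1) set_alt by metis
    next
      assume "2 \<le> length b"
      then show ?thesis using e(2) set_alt by (metis insert_commute)
    qed
  qed
qed

text \<open>The array of \<open>levi3\<close> with rows \<open>p\<close>, \<open>R\<close>,
  \<open>q\<close> and columns \<open>p'\<close>, \<open>R'\<close>, \<open>q'\<close>;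
  \<open>t22\<close> is the common part of the two redexes. The redexes are cut up to equality,
  which \<open>rdx_single\<close> permits.\<close>

definition pieces where
  "pieces p R q p' R' q' t11 t12 t13 t21 t22 t23 t31 t32 t33 \<longleftrightarrow>
    p \<simeq> t11 @ t12 @ t13 \<and> R = t21 @ t22 @ t23 \<and> q \<simeq> t31 @ t32 @ t33 \<and>
    p' \<simeq> t11 @ t21 @ t31 \<and> R' = t12 @ t22 @ t32 \<and> q' \<simeq> t13 @ t23 @ t33 \<and>
    par t12 t21 \<and> par t12 t31 \<and> par t13 t21 \<and> par t13 t22 \<and> par t13 t31 \<and> par t13 t32 \<and>
    par t22 t31 \<and> par t23 t31 \<and> par t23 t32"

lemma pieces_swap:
  "pieces p R q p' R' q' t11 t12 t13 t21 t22 t23 t31 t32 t33 \<Longrightarrow>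
   pieces p' R' q' p R q t11 t21 t31 t12 t22 t32 t13 t23 t33"
  by (auto simp: pieces_def intro: par_sym)

lemma par_full: "par x y \<Longrightarrow> set r \<subseteq> set y \<Longrightarrow> par x r" "par y x \<Longrightarrow> set r \<subseteq> set y \<Longrightarrow> par r x"
  by (auto simp: par_def)

lemma pieces_p:
  assumes "pieces p R q p' R' q' t11 t12 t13 t21 t22 t23 t31 t32 t33"
  shows "p @ r @ q \<simeq> t11 @ t12 @ t13 @ r @ t31 @ t32 @ t33"
  using assms ceq_append[of p "t11 @ t12 @ t13" "r @ q" "r @ t31 @ t32 @ t33"]
    ceq_append[of r r q "t31 @ t32 @ t33"] by (auto simp: pieces_def)

lemmas pieces_p' = pieces_p[OF pieces_swap]

end

section \<open>Rewriting rules and the joining of two redexes\<close>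

locale tl = coxeter m for m :: "'i \<Rightarrow> 'i \<Rightarrow> nat" + fixes dl :: "'a::comm_ring_1"
begin

text \<open>These are the right-hand sides of the rules: \<open>b_s b_s = dl b_s\<close>, and for
  distinct letters the vanishing of the Chebyshev element of index \<open>m s t\<close>, solved for
  its top term of coefficient 1.\<close>

definition cf :: "'i \<Rightarrow> 'i \<Rightarrow> nat \<Rightarrow> 'a" where
  "cf s t j = (if s = t then (if j = 1 then dl else 0) else if j < m s t then - dc (m s t) j else 0)"

lemma cf_nz: "cf s t j \<noteq> 0 \<Longrightarrow> 1 \<le> j \<and> j < lng s t \<and> (s \<noteq> t \<longrightarrow> (even j \<longleftrightarrow> even (lng s t)))"
  using dc_nz[of "m s t" j, where 'a = 'a] by (auto simp: cf_def lng_def split: if_splits)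

lemma cf_sym: "cf s t j = cf t s j"
  by (auto simp: cf_def m_sym)

definition redsum :: "('i list \<Rightarrow> 'a) \<Rightarrow> 'i list \<Rightarrow> 'i \<Rightarrow> 'i \<Rightarrow> 'i list \<Rightarrow> 'a" where
  "redsum G p s t q = (\<Sum>j<lng s t. cf s t j * G (p @ alt s t j @ q))"

context
  fixes G :: "'i list \<Rightarrow> 'a" and n :: nat
  assumes G_ceq: "\<And>u u'. length u < n \<Longrightarrow> u \<simeq> u' \<Longrightarrow> G u = G u'"
    and G_red: "\<And>p s t q. isr s t \<Longrightarrow> length (p @ rdx s t @ q) < n \<Longrightarrow> G (p @ rdx s t @ q) = redsum G p s t q"
begin

text \<open>If each redex survives the replacement of the other, both reductions expand to the same
  double sum. The context lets \<open>G\<close> obey the rules only below length \<open>n\<close>,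
  which is exactly what an induction on length provides for a normal form coefficient.\<close>

lemma join2:
  assumes r: "isr s t" "isr s' t'" and n: "length (p @ rdx s t @ q) = n" "length (p' @ rdx s' t' @ q') = n"
    and A: "\<And>j. cf s t j \<noteq> 0 \<Longrightarrow> p @ alt s t j @ q \<simeq> X j @ rdx s' t' @ Z j"
    and B: "\<And>k. cf s' t' k \<noteq> 0 \<Longrightarrow> p' @ alt s' t' k @ q' \<simeq> X' k @ rdx s t @ Z' k"
    and C: "\<And>j k. cf s t j \<noteq> 0 \<Longrightarrow> cf s' t' k \<noteq> 0 \<Longrightarrow> X j @ alt s' t' k @ Z j \<simeq> X' k @ alt s t j @ Z' k"
  shows "redsum G p s t q = redsum G p' s' t' q'"
proof -
  have 1: "cf s t j * G (p @ alt s t j @ q) = (\<Sum>k<lng s' t'. cf s' t' k * (cf s t j * G (X j @ alt s' t' k @ Z j)))"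
    if j: "j < lng s t" for j
  proof (cases "cf s t j = 0")
    case False
    have l: "length (p @ alt s t j @ q) < n" using n j by simp
    have "G (p @ alt s t j @ q) = redsum G (X j) s' t' (Z j)"
      using G_ceq[OF l A[OF False]] G_red[OF r(2), of "X j" "Z j"] l ceq_mset[OF A[OF False]] by simp
    then show ?thesis by (simp add: redsum_def sum_distrib_left mult.left_commute)
  qed simp
  have 2: "cf s' t' k * G (p' @ alt s' t' k @ q') = (\<Sum>j<lng s t. cf s' t' k * (cf s t j * G (X' k @ alt s t j @ Z' k)))"
    if k: "k < lng s' t'" for k
  proof (cases "cf s' t' k = 0")
    case False
    have l: "length (p' @ alt s' t' k @ q') < n" using n k by simp
    have "G (p' @ alt s' t' k @ q') = redsum G (X' k) s t (Z' k)"
      using G_ceq[OF l B[OF False]] G_red[OF r(1), of "X' k" "Z' k"] l ceq_mset[OF B[OF False]] by simp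
    then show ?thesis by (simp add: redsum_def sum_distrib_left)
  qed simp
  have 3: "cf s' t' k * (cf s t j * G (X j @ alt s' t' k @ Z j)) = cf s' t' k * (cf s t j * G (X' k @ alt s t j @ Z' k))" for j k
  proof (cases "cf s t j = 0 \<or> cf s' t' k = 0")
    case False
    have "length (p @ alt s t j @ q) < n" using n cf_nz[of s t j] False by simp
    then have "length (X j @ rdx s' t' @ Z j) < n" using ceq_mset[OF A[of j]] False by metis
    then have "length (X j @ alt s' t' k @ Z j) < n" using cf_nz[of s' t' k] False by simp
    then show ?thesis using G_ceq C False by metis
  qed auto
  have "redsum G p s t q = (\<Sum>j<lng s t. \<Sum>k<lng s' t'. cf s' t' k * (cf s t j * G (X j @ alt s' t' k @ Z j)))"
    unfolding redsum_def using 1 by simp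
  also have "\<dots> = (\<Sum>k<lng s' t'. \<Sum>j<lng s t. cf s' t' k * (cf s t j * G (X' k @ alt s t j @ Z' k)))"
    unfolding 3 by (rule sum.swap)
  also have "\<dots> = redsum G p' s' t' q'" unfolding redsum_def using 2 by simp
  finally show ?thesis .
qed

lemma join_disjoint:
  assumes r: "isr s t" "isr s' t'" and n: "length (p @ rdx s t @ q) = n" "length (p' @ rdx s' t' @ q') = n"
    and A: "\<And>r. set r \<subseteq> {s, t} \<Longrightarrow> p @ r @ q \<simeq> x @ r @ y @ rdx s' t' @ z"
    and B: "\<And>r. set r \<subseteq> {s', t'} \<Longrightarrow> p' @ r @ q' \<simeq> x @ rdx s t @ y @ r @ z"
  shows "redsum G p s t q = redsum G p' s' t' q'"
  by (rule join2[OF r n, of "\<lambda>j. x @ alt s t j @ y" "\<lambda>_. z" "\<lambda>_. x" "\<lambda>k. y @ alt s' t' k @ z"])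
    (use A[OF set_alt_subset] B[OF set_alt_subset] in simp_all)

context
  fixes p q p' q' t11 t12 t13 t21 t22 t23 t31 t32 t33 s t s' t'
  assumes r: "isr s t" "isr s' t'" and n: "length (p @ rdx s t @ q) = n" "length (p' @ rdx s' t' @ q') = n"
    and pc: "pieces p (rdx s t) q p' (rdx s' t') q' t11 t12 t13 t21 t22 t23 t31 t32 t33"
begin

lemma pars: "par t12 t21" "par t12 t31" "par t13 t21" "par t13 t22" "par t13 t31" "par t13 t32"
    "par t22 t31" "par t23 t31" "par t23 t32" "par t21 t12" "par t31 t12" "par t21 t13" "par t22 t13" "par t31 t13"
    "par t32 t13" "par t31 t22" "par t31 t23" "par t32 t23"
  and RR: "rdx s t = t21 @ t22 @ t23" "rdx s' t' = t12 @ t22 @ t32"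
  using pc par_sym by (auto simp: pieces_def)

lemma sets: "set (t21 @ t22 @ t23) = {s, t}" "set (t12 @ t22 @ t32) = {s', t'}"
  using set_rdx[OF r(1)] set_rdx[OF r(2)] unfolding RR by simp_all

text \<open>As \<open>t21\<close> and \<open>t12\<close> carry all letters of their redexes and
  commute with each other, the two redexes commute letter by letter. Both can then be assembled, the
  one in \<open>s'\<close>, \<open>t'\<close> in front.\<close>

lemma join_a:
  assumes e: "t22 = []" and f: "set t21 = {s, t}" "set t12 = {s', t'}"
  shows "redsum G p s t q = redsum G p' s' t' q'"
proof (rule join_disjoint[OF r(2,1) n(2,1), symmetric])
  fix w assume w: "set w \<subseteq> {s, t}"
  have 1: "par t13 t32" "par w t32" "par t31 t32"
    using pars w sets f par_mono[OF pars(10), of w t32] par_mono[OF pars(11), of t31 t32] by auto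
  show "p @ w @ q \<simeq> t11 @ rdx s' t' @ t13 @ w @ (t31 @ t33)"
    using ceq_trans[OF pieces_p[OF pc, of w] sw[of "t13 @ w @ t31" t32 "t11 @ t12" t33, simplified]] 1 e RR by simp
next
  fix w assume w: "set w \<subseteq> {s', t'}"
  have 1: "par t21 w" "par t21 t13" "par t31 w" "par t31 t13" "par t31 t23"
    using pars w f par_mono[OF pars(10), of t21 w] par_mono[OF pars(11), of t31 w] by auto
  have 2: "p' @ w @ q' \<simeq> t11 @ (w @ t13) @ (t21 @ t31) @ t23 @ t33"
    using ceq_trans[OF pieces_p'[OF pc, of w] sw[of "t21 @ t31" "w @ t13" t11 "t23 @ t33", simplified]] 1 by simp
  show "p' @ w @ q' \<simeq> t11 @ w @ t13 @ rdx s t @ (t31 @ t33)"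
    using ceq_trans[OF 2, of "t11 @ w @ t13 @ t21 @ t23 @ t31 @ t33"] sw[of t31 t23 "t11 @ w @ t13 @ t21" t33] 1 e RR
    by simp
qed

text \<open>Whatever commutes with \<open>t32\<close> commutes with both letters of the second redex
  and so with \<open>t12\<close>. Hence \<open>t12\<close> slides to the right onto
  \<open>t32\<close>, past the first redex or any word replacing it.\<close>

lemma join_b:
  assumes e: "t22 = []" and f: "set t21 = {s, t} \<or> set t23 = {s, t}" "set t32 = {s', t'}"
  shows "redsum G p s t q = redsum G p' s' t' q'"
proof (rule join_disjoint[OF r n])
  fix w assume w: "set w \<subseteq> {s, t}"
  have "par t12 w" using f(1)
  proof
    assume "set t21 = {s, t}" then show ?thesis using pars w par_full by metis
  next
    assume "set t23 = {s, t}"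
    moreover have "set t12 \<subseteq> set t32" using f(2) sets(2) by auto
    ultimately show ?thesis using w par_mono[OF pars(18), of t12 w] by simp
  qed
  moreover have "par t12 t13" "par t12 t31" using pars f(2) sets by (auto intro: par_full)
  ultimately show "p @ w @ q \<simeq> (t11 @ t13) @ w @ t31 @ rdx s' t' @ t33"
    using ceq_trans[OF pieces_p[OF pc, of w] sw[of t12 "t13 @ w @ t31" t11 "t32 @ t33", simplified]] e RR by simp
next
  fix w assume w: "set w \<subseteq> {s', t'}"
  have 1: "par w t13" "par w t23" using pars w f(2) by (auto intro: par_full)
  have 2: "p' @ w @ q' \<simeq> t11 @ t21 @ (t13 @ t23) @ (t31 @ w) @ t33"
    using ceq_trans[OF pieces_p'[OF pc, of w] sw[of "t31 @ w" "t13 @ t23" "t11 @ t21" "t33", simplified]] 1 pars by simp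
  show "p' @ w @ q' \<simeq> (t11 @ t13) @ rdx s t @ t31 @ w @ t33"
    using ceq_trans[OF 2, of "t11 @ t13 @ t21 @ t23 @ t31 @ w @ t33"] sw[of t21 t13 t11 "t23 @ t31 @ w @ t33"] pars e RR
    by simp
qed

text \<open>A redex inside another one uses the same two letters, hence has the same length, so the
  redexes coincide and the reductions agree term by term.\<close>

lemma join_nested:
  assumes e: "t12 = []" "t32 = []"
  shows "redsum G p s t q = redsum G p' s' t' q'"
proof -
  have R: "rdx s t = t21 @ rdx s' t' @ t23" using RR e by simp
  have k2: "2 \<le> lng s' t'" using lng_ge2 r(2) .
  then obtain w where w: "rdx s' t' = s' # t' # w"
    by (auto simp: numeral_2_eq_2 Suc_le_eq dest!: less_imp_Suc_add)
  have st: "(s' = s \<and> t' = t) \<or> (s' = t \<and> t' = s)"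
    using adj_alt[of t21 s' t' "w @ t23" s t "lng s t"] R w by simp
  then have "lng s t = lng s' t'" by (auto simp: lng_def m_sym)
  then have em: "t21 = []" "t23 = []" using arg_cong[OF R, of length] by auto
  then have "rdx s t = rdx s' t'" using R by simp
  then have ss: "s = s'" "t = t'" using st by (metis R alt_inject em append_Nil append_Nil2 k2 \<open>lng s t = lng s' t'\<close>)+
  have 22: "t22 = rdx s t" using RR em by simp
  have "G (p @ alt s t j @ q) = G (p' @ alt s t j @ q')" if j: "j < lng s t" for j
  proof -
    let ?w = "alt s t j"
    have "par t31 ?w" "par ?w t13" using pars 22 set_rdx[OF r(1)] set_alt_subset[of s t j] by (auto intro: par_full)
    then have 1: "par (t13 @ ?w) t31" "par t13 ?w" using pars par_sym by auto
    have "p @ ?w @ q \<simeq> t11 @ t13 @ ?w @ t31 @ t33" using pieces_p[OF pc, of ?w] e by simp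
    also have "t11 @ t13 @ ?w @ t31 @ t33 \<simeq> t11 @ t31 @ t13 @ ?w @ t33"
      using sw[OF 1(1), of t11 t33] by simp
    also have "t11 @ t31 @ t13 @ ?w @ t33 \<simeq> t11 @ t31 @ ?w @ t13 @ t33"
      using sw[OF 1(2), of "t11 @ t31" t33] by simp
    also have "t11 @ t31 @ ?w @ t13 @ t33 \<simeq> p' @ ?w @ q'" using ceq_sym[OF pieces_p'[OF pc, of ?w]] em by simp
    finally show ?thesis using G_ceq n j by simp
  qed
  then show ?thesis unfolding redsum_def ss[symmetric] by simp
qed

text \<open>A suffix of the first redex is a prefix of the second. If one letter is shared, the
  lower terms of either rule keep it, so the other redex is still present and \<open>join2\<close>
  applies. If at least two are shared, the redexes use the same pair of letters and the two
  reductions agree term by term.\<close>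

lemma join_overlap:
  assumes e: "t12 = []" "t23 = []" and ne: "t21 \<noteq> []" "t22 \<noteq> []"
  shows "redsum G p s t q = redsum G p' s' t' q'"
proof (cases "length t22 = 1")
  case True
  then obtain c where c: "t22 = [c]" by (metis One_nat_def length_0_conv length_Suc_conv)
  have R: "rdx s t = t21 @ [c]" and R': "rdx s' t' = c # t32" using RR c e by simp_all
  have cs': "c = s'" using R' lng_ge2[OF r(2)] by (cases "lng s' t'") auto
  have k: "lng s t = Suc (length t21)" using arg_cong[OF R, of length] by simp
  \<comment> \<open>For distinct letters a nonzero coefficient forces \<open>j\<close> to have the
    parity of the redex, so the lower term ends in the same letter.\<close>
  have snoc: "alt s t j = alt s t (j - 1) @ [c]" if "cf s t j \<noteq> 0" for j
  proof -
    have j: "1 \<le> j" "j < lng s t" "s = t \<or> (even j \<longleftrightarrow> even (lng s t))" using cf_nz[OF that] by auto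
    have "c = (if even (length t21) then s else t)" using R k alt_snoc[of s t "length t21"] by auto
    then have "[if even (j - 1) then s else t] = [c]" using j k by auto
    then show ?thesis using alt_snoc[of s t "j - 1"] j(1) by auto
  qed
  have cons: "alt s' t' k = c # alt t' s' (k - 1)" if "cf s' t' k \<noteq> 0" for k
    using cf_nz[OF that] cs' by (cases k) auto
  have 31: "par [c] t31" using pars c by simp
  show ?thesis
  proof (rule join2[OF r n, of "\<lambda>j. t11 @ t13 @ alt s t (j - 1) @ t31" "\<lambda>_. t33"
        "\<lambda>k. t11 @ t13" "\<lambda>k. t31 @ alt t' s' (k - 1) @ t33"])
    fix j assume "cf s t j \<noteq> 0"
    note a = snoc[OF this]
    show "p @ alt s t j @ q \<simeq> (t11 @ t13 @ alt s t (j - 1) @ t31) @ rdx s' t' @ t33"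
      using ceq_trans[OF pieces_p[OF pc, of "alt s t j"], of "(t11 @ t13 @ alt s t (j - 1) @ t31) @ rdx s' t' @ t33"]
        sw[OF 31, of "t11 @ t13 @ alt s t (j - 1)" "t32 @ t33"] a e R' by simp
  next
    fix k assume nz: "cf s' t' k \<noteq> 0"
    note a = cons[OF nz]
    have "set (alt s' t' k) \<subseteq> set (c # t32)" using set_alt_subset[of s' t' k] set_rdx[OF r(2)] R' by simp
    moreover have "par t13 (c # t32)" using pars c par_def by auto
    ultimately have 1: "par (alt s' t' k) t13" using par_sym par_full by blast
    have "p' @ alt s' t' k @ q' \<simeq> t11 @ (t21 @ t31 @ alt s' t' k) @ t13 @ t33"
      using pieces_p'[OF pc, of "alt s' t' k"] e by simp
    also have "t11 @ (t21 @ t31 @ alt s' t' k) @ t13 @ t33 \<simeq> t11 @ t13 @ (t21 @ t31 @ alt s' t' k) @ t33"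
      by (rule sw) (use 1 pars in simp)
    also have "t11 @ t13 @ (t21 @ t31 @ alt s' t' k) @ t33 = (t11 @ t13 @ t21) @ t31 @ [c] @ alt t' s' (k - 1) @ t33"
      using a by simp
    also have "(t11 @ t13 @ t21) @ t31 @ [c] @ alt t' s' (k - 1) @ t33 \<simeq> (t11 @ t13 @ t21) @ [c] @ t31 @ alt t' s' (k - 1) @ t33"
      by (rule sw) (use 31 par_sym in simp)
    finally show "p' @ alt s' t' k @ q' \<simeq> (t11 @ t13) @ rdx s t @ t31 @ alt t' s' (k - 1) @ t33"
      using R by simp
  next
    fix j k assume nz: "cf s t j \<noteq> 0" "cf s' t' k \<noteq> 0"
    show "(t11 @ t13 @ alt s t (j - 1) @ t31) @ alt s' t' k @ t33
       \<simeq> (t11 @ t13) @ alt s t j @ t31 @ alt t' s' (k - 1) @ t33"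
      using sw[OF par_sym[OF 31], of "t11 @ t13 @ alt s t (j - 1)" "alt t' s' (k - 1) @ t33"] snoc[OF nz(1)] cons[OF nz(2)]
      by simp
  qed
next
  case False
  have l2: "2 \<le> length t22" using False ne(2) by (cases t22) (auto simp: Suc_le_eq)
  have R: "t21 @ t22 = rdx s t" and R': "t22 @ t32 = rdx s' t'" using RR e by simp_all
  have 22: "t22 = (if even (length t21) then alt s t (length t22) else alt t s (length t22))"
    using alt_append_eq(2)[OF R] .
  have e22: "t22 = alt s' t' (length t22)" using alt_append_eq(1)[OF R'] .
  have st: "(s', t') = (if even (length t21) then (s, t) else (t, s))"
    using 22 e22 alt_inject[OF l2] by (metis (full_types))
  have lng: "lng s' t' = lng s t" and cfe: "cf s' t' = cf s t" using st cf_sym by (auto simp: lng_def m_sym fun_eq_iff split: if_splits)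
  have k: "lng s t = length t21 + length t22" using arg_cong[OF R, of length] by simp
  have k': "lng s t = length t22 + length t32" using arg_cong[OF R', of length] lng by simp
  have l: "length t32 = length t21" using k k' by simp
  have sne: "s \<noteq> t" using k l2 ne(1) by (cases t21) (auto simp: lng_def)
  have f22: "set t22 = {s, t}" using 22 set_alt[OF l2] by (metis insert_commute)
  have "s' = s \<and> t' = t \<or> s' = t \<and> t' = s" using st by (auto split: if_splits)
  then have f32: "set t32 \<subseteq> {s, t}" using sets(2) by auto
  have p31: "par t31 w" if "set w \<subseteq> {s, t}" for w using pars that f22 by (auto intro: par_full)
  have p13: "par w t13" if "set w \<subseteq> {s, t}" for w using pars that f22 by (auto intro: par_full)
  have t32: "t32 = (if even (length t22) then alt s' t' (length t32) else alt t' s' (length t32))"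
    using alt_append_eq(2)[OF R'] .
  have t21: "t21 = alt s t (length t21)" using alt_append_eq(1)[OF R] .
  \<comment> \<open>Both sides are the alternating word of length \<open>j + length t21\<close>;
    that the letters fit together again rests on the parity of \<open>j\<close>.\<close>
  have same: "alt s t j @ t32 = t21 @ alt s' t' j" if nz: "cf s t j \<noteq> 0" for j
  proof -
    have ev: "even j \<longleftrightarrow> even (lng s t)" using cf_nz[OF nz] sne by simp
    have "t32 = (if even j then alt s t (length t21) else alt t s (length t21))"
      using t32 l k ev st by (auto split: if_splits)
    then have "alt s t j @ t32 = alt s t (j + length t21)" by (simp add: alt_append)
    also have "\<dots> = t21 @ alt s' t' j"
      using alt_append[of s t "length t21" j] t21 st by (auto simp: add.commute split: if_splits)
    finally show ?thesis .
  qed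
  have "cf s t j * G (p @ alt s t j @ q) = cf s t j * G (p' @ alt s' t' j @ q')" if j: "j < lng s t" for j
  proof (cases "cf s t j = 0")
    case False
    let ?w = "alt s t j" and ?v = "alt s' t' j"
    have v: "set ?v \<subseteq> {s, t}" using set_alt_subset[of s' t' j] st by (auto split: if_splits)
    have "p @ ?w @ q \<simeq> t11 @ t13 @ ?w @ t31 @ t32 @ t33" using pieces_p[OF pc, of ?w] e by simp
    also have "t11 @ t13 @ ?w @ t31 @ t32 @ t33 \<simeq> t11 @ t13 @ ?w @ t32 @ t31 @ t33"
      using sw[OF p31[OF f32], of "t11 @ t13 @ ?w" t33] by simp
    also have "t11 @ t13 @ ?w @ t32 @ t31 @ t33 = t11 @ t13 @ t21 @ ?v @ t31 @ t33"
      using same[OF False] by simp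
    also have "t11 @ t13 @ t21 @ ?v @ t31 @ t33 \<simeq> t11 @ t13 @ t21 @ t31 @ ?v @ t33"
      using sw[OF par_sym[OF p31[OF v]], of "t11 @ t13 @ t21" t33] by simp
    also have "t11 @ t13 @ t21 @ t31 @ ?v @ t33 \<simeq> t11 @ t21 @ t31 @ ?v @ t13 @ t33"
      using sw[of t13 "t21 @ t31 @ ?v" t11 t33] pars par_sym[OF p13[OF v]] by simp
    also have "t11 @ t21 @ t31 @ ?v @ t13 @ t33 \<simeq> p' @ ?v @ q'"
      using ceq_sym[OF pieces_p'[OF pc, of ?v]] e by simp
    finally show ?thesis using G_ceq n j by simp
  qed simp
  then show ?thesis unfolding redsum_def lng cfe by simp
qed

text \<open>The only overlap in which both redexes extend beyond the common part on the same side: \<open>a b c a b\<close> with \<open>a\<close>, \<open>b\<close> commuting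
  and both \<open>m a c\<close> and \<open>m b c\<close> equal to 3.\<close>

lemma tri_left:
  assumes ne: "t12 \<noteq> []" "t21 \<noteq> []" "t22 \<noteq> []"
  shows "\<exists>a b c. t12 = [b] \<and> t21 = [a] \<and> t22 = [c] \<and> t23 = [a] \<and> t32 = [b]"
proof -
  obtain a u21 where a: "t21 = u21 @ [a]" using ne by (metis append_butlast_last_id)
  obtain b u12 where b: "t12 = u12 @ [b]" using ne by (metis append_butlast_last_id)
  obtain c u22 where c: "t22 = c # u22" using ne by (cases t22) auto
  have ac: "(a = s \<and> c = t) \<or> (a = t \<and> c = s)"
    using adj_alt[of u21 a c "u22 @ t23" s t "lng s t"] RR a c by simp
  have bc: "(b = s' \<and> c = t') \<or> (b = t' \<and> c = s')"
    using adj_alt[of u12 b c "u22 @ t32" s' t' "lng s' t'"] RR b c by simp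
  have ab: "m b a = 2" using pars(1) a b by (simp add: par_def)
  have mac: "a = c \<or> 3 \<le> m a c" using ac r(1) m_sym[of s t] by (auto simp: isr_def)
  have mbc: "b = c \<or> 3 \<le> m b c" using bc r(2) m_sym[of s' t'] by (auto simp: isr_def)
  have d: "a \<noteq> b" using ab by auto
  have ac': "a \<noteq> c" using mbc ab d by auto
  have mac': "3 \<le> m a c" using mac ac' by simp
  have bc': "b \<noteq> c"
  proof
    assume "b = c"
    then have "m a c = 2" using ab m_sym[of a c] by simp
    then show False using mac' by simp
  qed
  have mbc': "3 \<le> m b c" using mbc bc' by simp
  have S: "set (t21 @ t22 @ t23) = {a, c}" "set (t12 @ t22 @ t32) = {b, c}" using sets ac bc by auto
  have no: "\<not> par [c] [a]" "\<not> par [c] [b]" using mac' mbc' m_sym[of c] by (auto simp: par_def)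
  have s21: "set t21 \<subseteq> {a}"
  proof -
    have "c \<notin> set t21" using pars(1) b no(2) m_sym by (auto simp: par_def)
    then show ?thesis using S(1) by auto
  qed
  have s12: "set t12 \<subseteq> {b}"
  proof -
    have "c \<notin> set t12" using pars(1) a no(1) m_sym by (auto simp: par_def)
    then show ?thesis using S(2) by auto
  qed
  have s22: "set t22 \<subseteq> {c}" using S d by auto
  have lac: "3 \<le> lng s t" "s \<noteq> t" using ac ac' r(1) by (auto simp: lng_def isr_def)
  have lbc: "3 \<le> lng s' t'" "s' \<noteq> t'" using bc bc' r(2) by (auto simp: lng_def isr_def)
  have one: "x = [e]" if "set x \<subseteq> {e}" "x \<noteq> []" "u @ x @ v = alt i j k" "i \<noteq> j" for x e u v i j k
  proof (cases x)
    case (Cons y z)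
    show ?thesis
    proof (cases z)
      case (Cons y' z')
      then show ?thesis using adj_alt[of u y y' "z' @ v" i j k] that \<open>x = y # z\<close> by auto
    qed (use that Cons in auto)
  qed (use that in auto)
  have 21: "t21 = [a]" using one[OF s21 ne(2), of "[]" "t22 @ t23"] RR(1)[symmetric] lac by (simp del: alt.simps)
  have 12: "t12 = [b]" using one[OF s12 ne(1), of "[]" "t22 @ t32"] RR(2)[symmetric] lbc by (simp del: alt.simps)
  have 22: "t22 = [c]" using one[OF s22 ne(3), of t21 "t23"] RR(1)[symmetric] lac by (simp del: alt.simps)
  have n23: "t23 \<noteq> []" "t32 \<noteq> []"
    using arg_cong[OF RR(1), of length] arg_cong[OF RR(2), of length] 21 12 22 lac lbc by auto
  obtain a' u23 where a': "t23 = a' # u23" using n23 by (cases t23) auto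
  obtain b' u32 where b': "t32 = b' # u32" using n23 by (cases t32) auto
  have aa: "a' = a" using adj_alt[of "[a]" c a' u23 s t "lng s t"] RR 21 22 a' ac ac' by auto
  have bb: "b' = b" using adj_alt[of "[b]" c b' u32 s' t' "lng s' t'"] RR 12 22 b' bc bc' by auto
  have "c \<notin> set t23" using pars(9) b' bb no(2) m_sym by (auto simp: par_def)
  then have s23: "set t23 \<subseteq> {a}" using S(1) by auto
  have "c \<notin> set t32" using pars(9) a' aa no(1) m_sym by (auto simp: par_def)
  then have s32: "set t32 \<subseteq> {b}" using S(2) by auto
  have "t23 = [a]" using one[OF s23 n23(1), of "t21 @ t22" "[]"] RR(1)[symmetric] lac by (simp del: alt.simps)
  moreover have "t32 = [b]" using one[OF s32 n23(2), of "t12 @ t22" "[]"] RR(2)[symmetric] lbc by (simp del: alt.simps)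
  ultimately show ?thesis using 21 12 22 by blast
qed

text \<open>The rules here are \<open>a c a\<close> to \<open>a\<close> and \<open>b c b\<close> to
  \<open>b\<close>. After the first the two outer \<open>b\<close> meet, after the second the two
  outer \<open>a\<close>, and the doubled letter collapses: both ways end in \<open>dl\<close> times
  the word with one \<open>a\<close> and one \<open>b\<close>.\<close>

lemma join_tri:
  assumes e: "t12 = [b]" "t21 = [a]" "t22 = [c]" "t23 = [a]" "t32 = [b]"
  shows "redsum G p s t q = redsum G p' s' t' q'"
proof -
  have l: "lng s t = 3" "lng s' t' = 3"
    using arg_cong[OF RR(1), of length] arg_cong[OF RR(2), of length] e by auto
  have ss: "s = a" "s' = b" using RR e l by (auto simp: eval_nat_numeral)
  have ne: "s \<noteq> t" "s' \<noteq> t'" using l by (auto simp: lng_def split: if_splits)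
  have c0: "cf s t 0 = 0" "cf s t 2 = 0" "cf s t 1 = 1" "cf s' t' 0 = 0" "cf s' t' 2 = 0" "cf s' t' 1 = 1"
    using l ne by (auto simp: cf_def lng_def eval_nat_numeral)
  have lt3: "{..<3::nat} = {0, 1, 2}" by auto
  have n5: "length p + length q + 3 = n" "length p' + length q' + 3 = n" using n l by auto
  have red1: "redsum G p s t q = G (p @ [a] @ q)" "redsum G p' s' t' q' = G (p' @ [b] @ q')"
    unfolding redsum_def l lt3 using c0 ss by auto
  have dbl: "G (x @ [d] @ [d] @ y) = dl * G (x @ [d] @ y)" if "length x + length y + 2 < n" for x y d
    using G_red[of d d x y] that unfolding redsum_def
    by (simp add: isr_def lng_def cf_def eval_nat_numeral lessThan_Suc)
  have P: "par [b] (t13 @ [a] @ t31)" "par [a] (t31 @ [b] @ t13)" "par (t31 @ [b]) (t13 @ [a])"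
    using pars unfolding e par_def by auto
  have 1: "p @ [a] @ q \<simeq> (t11 @ t13 @ [a] @ t31) @ [b] @ [b] @ t33"
    using ceq_trans[OF pieces_p[OF pc, of "[a]"], of "(t11 @ t13 @ [a] @ t31) @ [b] @ [b] @ t33"]
      sw[OF P(1), of t11 "[b] @ t33"] e by simp
  have 2: "p' @ [b] @ q' \<simeq> (t11 @ t31 @ [b] @ t13) @ [a] @ [a] @ t33"
    using ceq_trans[OF pieces_p'[OF pc, of "[b]"], of "(t11 @ t31 @ [b] @ t13) @ [a] @ [a] @ t33"]
      sw[OF P(2), of t11 "[a] @ t33"] e by simp
  have 3: "(t11 @ t31 @ [b] @ t13) @ [a] @ t33 \<simeq> (t11 @ t13 @ [a] @ t31) @ [b] @ t33"
    using sw[OF P(3), of t11 t33] by simp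
  have "redsum G p s t q = dl * G ((t11 @ t13 @ [a] @ t31) @ [b] @ t33)"
    unfolding red1 using G_ceq[OF _ 1] n5 dbl[of "t11 @ t13 @ [a] @ t31" t33 b] ceq_mset[OF 1] by simp
  also have "\<dots> = dl * G ((t11 @ t31 @ [b] @ t13) @ [a] @ t33)"
    using G_ceq[OF _ 3] n5 ceq_mset[OF 2] by simp
  also have "\<dots> = redsum G p' s' t' q'"
    unfolding red1 using G_ceq[OF _ 2] n5 dbl[of "t11 @ t31 @ [b] @ t13" t33 a] ceq_mset[OF 2] by simp
  finally show ?thesis .
qed

end

lemma join_disj:
  assumes r: "isr s t" "isr s' t'" and n: "length (p @ rdx s t @ q) = n" "length (p' @ rdx s' t' @ q') = n"
    and pc: "pieces p (rdx s t) q p' (rdx s' t') q' t11 t12 t13 t21 [] t23 t31 t32 t33"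
  shows "redsum G p s t q = redsum G p' s' t' q'"
proof -
  note R = RR[OF r n pc, simplified]
  have "set t21 = {s, t} \<or> set t23 = {s, t}" using rdx_full[OF r(1)] R(1) by metis
  moreover have "set t12 = {s', t'} \<or> set t32 = {s', t'}" using rdx_full[OF r(2)] R(2) by metis
  ultimately consider "set t21 = {s, t}" "set t12 = {s', t'}"
    | "set t21 = {s, t} \<or> set t23 = {s, t}" "set t32 = {s', t'}" | "set t23 = {s, t}" "set t12 = {s', t'}"
    by blast
  then show ?thesis
  proof cases
    case 1 then show ?thesis using join_a[OF r n pc] by simp
  next
    case 2 then show ?thesis using join_b[OF r n pc] by simp
  next
    case 3 then show ?thesis using join_b[OF r(2,1) n(2,1) pieces_swap[OF pc]] by simp
  qed
qed

text \<open>With a nonempty common part, either two opposite pieces \<open>t12\<close>,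
  \<open>t21\<close> or \<open>t23\<close>, \<open>t32\<close> are both present, which is the
  exceptional overlap, or enough pieces are empty for the redexes to be nested or to overlap as
  suffix and prefix.\<close>

lemma join_pieces:
  assumes r: "isr s t" "isr s' t'" and n: "length (p @ rdx s t @ q) = n" "length (p' @ rdx s' t' @ q') = n"
    and pc: "pieces p (rdx s t) q p' (rdx s' t') q' t11 t12 t13 t21 t22 t23 t31 t32 t33"
  shows "redsum G p s t q = redsum G p' s' t' q'"
proof (cases "t22 = []")
  case True
  then show ?thesis using join_disj[OF r n] pc by blast
next
  case ne: False
  note pc' = pieces_swap[OF pc]
  note R = RR[OF r n pc]
  show ?thesis
  proof (cases "t12 \<noteq> [] \<and> t21 \<noteq> [] \<or> t23 \<noteq> [] \<and> t32 \<noteq> []")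
    case True
    have "\<exists>a b c. t12 = [b] \<and> t21 = [a] \<and> t22 = [c] \<and> t23 = [a] \<and> t32 = [b]" using True
    proof
      assume "t12 \<noteq> [] \<and> t21 \<noteq> []" then show ?thesis using tri_left[OF r n pc] ne by blast
    next
      assume h: "t23 \<noteq> [] \<and> t32 \<noteq> []"
      \<comment> \<open>Reversing all words exchanges the two ends, so \<open>tri_left\<close> also
        covers this case; the reverse of a redex of even length has its two letters
        exchanged.\<close>
      have ev: "rev (rdx i j) = rdx (if even (lng i j) then j else i) (if even (lng i j) then i else j)" for i j
        by (simp add: rev_alt lng_def m_sym)
      have cr: "rev u \<simeq> rev v" if "u \<simeq> v" for u v
        using that unfolding ceq_def
      proof (induction rule: rtranclp_induct)
        case (step y z)
        have "comm_move m (rev y) (rev z)"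
          using step(2) unfolding comm_move_def by (metis (no_types, lifting) append.assoc m_sym rev.simps(1,2) rev_append append_Nil append_Cons)
        then show ?case using step.IH by auto
      qed simp
      have ir: "isr (if even (lng i j) then j else i) (if even (lng i j) then i else j)" if "isr i j" for i j
        using that by (auto simp: isr_def m_sym)
      have pr: "par (rev x) (rev y) = par x y" for x y by (simp add: par_def)
      have "pieces (rev q) (rev (rdx s t)) (rev p) (rev q') (rev (rdx s' t')) (rev p')
         (rev t33) (rev t32) (rev t31) (rev t23) (rev t22) (rev t21) (rev t13) (rev t12) (rev t11)"
        using pc cr[of p "t11 @ t12 @ t13"] cr[of q "t31 @ t32 @ t33"] cr[of p' "t11 @ t21 @ t31"] cr[of q' "t13 @ t23 @ t33"]
        unfolding pieces_def pr by (auto intro: par_sym)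
      note pr' = this[unfolded ev]
      have ls: "lng (if even (lng i j) then j else i) (if even (lng i j) then i else j) = lng i j" for i j
        by (simp add: lng_def m_sym)
      have pr'': "pieces (rev q) (rdx (if even (lng s t) then t else s) (if even (lng s t) then s else t)) (rev p) (rev q')
          (rdx (if even (lng s' t') then t' else s') (if even (lng s' t') then s' else t')) (rev p')
         (rev t33) (rev t32) (rev t31) (rev t23) (rev t22) (rev t21) (rev t13) (rev t12) (rev t11)"
        using pr' unfolding ls .
      have "\<exists>a b c. rev t32 = [b] \<and> rev t23 = [a] \<and> rev t22 = [c] \<and> rev t21 = [a] \<and> rev t12 = [b]"
        by (rule tri_left[OF ir[OF r(1)] ir[OF r(2)] _ _ pr'']) (use n h ne in \<open>simp_all add: ls\<close>)
      then show ?thesis by auto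
    qed
    then show ?thesis using join_tri[OF r n pc] by blast
  next
    case False
    then consider "t12 = []" "t32 = []" | "t21 = []" "t23 = []" | "t12 = []" "t23 = []" "t21 \<noteq> []"
      | "t21 = []" "t32 = []" "t12 \<noteq> []" by blast
    then show ?thesis
    proof cases
      case 1 then show ?thesis using join_nested[OF r n pc] by simp
    next
      case 2 then show ?thesis using join_nested[OF r(2,1) n(2,1) pc'] by simp
    next
      case 3 then show ?thesis using join_overlap[OF r n pc] ne by simp
    next
      case 4 then show ?thesis using join_overlap[OF r(2,1) n(2,1) pc'] ne by simp
    qed
  qed
qed

lemma join:
  assumes r: "isr s t" "isr s' t'" and n: "length (p @ rdx s t @ q) = n"
    and eq: "p @ rdx s t @ q \<simeq> p' @ rdx s' t' @ q'"
  shows "redsum G p s t q = redsum G p' s' t' q'"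
proof -
  have n': "length (p' @ rdx s' t' @ q') = n" using n ceq_mset[OF eq] by simp
  obtain t11 t12 t13 t21 t22 t23 t31 t32 t33 where
    "p \<simeq> t11 @ t12 @ t13" "rdx s t \<simeq> t21 @ t22 @ t23" "q \<simeq> t31 @ t32 @ t33"
    "p' \<simeq> t11 @ t21 @ t31" "rdx s' t' \<simeq> t12 @ t22 @ t32" "q' \<simeq> t13 @ t23 @ t33"
    "par t12 t21" "par t12 t31" "par t13 t21" "par t13 t22" "par t13 t31" "par t13 t32"
    "par t22 t31" "par t23 t31" "par t23 t32" using levi3[OF eq] by blast
  then have "pieces p (rdx s t) q p' (rdx s' t') q' t11 t12 t13 t21 t22 t23 t31 t32 t33"
    using rdx_single[OF r(1), of "t21 @ t22 @ t23"] rdx_single[OF r(2), of "t12 @ t22 @ t32"] unfolding pieces_def by simp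
  then show ?thesis using join_pieces[OF r n n'] by blast
qed

end

section \<open>Normal form coefficients\<close>

definition okp :: "'i list \<Rightarrow> 'i list \<times> 'i \<times> 'i \<times> 'i list \<Rightarrow> bool" where
  "okp u = (\<lambda>(p, s, t, q). isr s t \<and> u \<simeq> p @ rdx s t @ q)"

definition pick :: "'i list \<Rightarrow> 'i list \<times> 'i \<times> 'i \<times> 'i list" where
  "pick u = (SOME x. okp u x)"

definition pword :: "'i list \<times> 'i \<times> 'i \<times> 'i list \<Rightarrow> nat \<Rightarrow> 'i list" where
  "pword = (\<lambda>(p, s, t, q) j. p @ alt s t j @ q)"

definition pcf :: "'i list \<times> 'i \<times> 'i \<times> 'i list \<Rightarrow> nat \<Rightarrow> 'a" where
  "pcf = (\<lambda>(p, s, t, q) j. cf s t j)"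

definition plng :: "'i list \<times> 'i \<times> 'i \<times> 'i list \<Rightarrow> nat" where
  "plng = (\<lambda>(p, s, t, q). lng s t)"

lemma pword_less: "okp u x \<Longrightarrow> j < plng x \<Longrightarrow> length (pword x j) < length u"
  using ceq_mset by (fastforce simp: okp_def pword_def plng_def)

text \<open>The coefficient of the commutation class of an irreducible word \<open>c\<close> in the
  normal form of \<open>u\<close>, computed by reducing at one arbitrarily chosen redex of an
  equivalent word.\<close>

function N :: "'i list \<Rightarrow> 'i list \<Rightarrow> 'a" where
  "N c u = (if \<exists>x. okp u x then \<Sum>j<plng (pick u). pcf (pick u) j * N c (pword (pick u) j)
            else if u \<simeq> c then 1 else 0)"
  by auto
termination
  by (relation "measure (\<lambda>(c, u). length u)")
    (auto intro: pword_less someI simp: pick_def)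

declare N.simps [simp del]

text \<open>Newman's argument: the claim for shorter words is the hypothesis of \<open>join\<close>,
  which compares the chosen redex with any other redex of any equivalent word. Both halves go into
  that hypothesis and are therefore proved together.\<close>

lemma N_red_ceq:
  "(\<forall>p s t q. isr s t \<longrightarrow> u \<simeq> p @ rdx s t @ q \<longrightarrow> N c u = redsum (N c) p s t q) \<and> (\<forall>u'. u \<simeq> u' \<longrightarrow> N c u = N c u')"
proof (induction "length u" arbitrary: u rule: less_induct)
  case less
  have *: "N c v = redsum (N c) p s t q"
    if r: "isr s t" and v: "v \<simeq> p @ rdx s t @ q" and uv: "u \<simeq> v" for v p s t q
  proof -
    have ex: "okp v (p, s, t, q)" using r v by (simp add: okp_def)
    obtain p' s' t' q' where pk: "pick v = (p', s', t', q')" by (cases "pick v") auto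
    have "okp v (pick v)" using ex unfolding pick_def by (rule someI)
    then have r': "isr s' t'" and v': "v \<simeq> p' @ rdx s' t' @ q'" unfolding pk by (auto simp: okp_def)
    have "N c v = redsum (N c) p' s' t' q'"
      using ex by (subst N.simps) (auto simp: pk redsum_def plng_def pcf_def pword_def)
    also have "\<dots> = redsum (N c) p s t q"
    proof (rule join[of "length u"])
      show "p' @ rdx s' t' @ q' \<simeq> p @ rdx s t @ q" using v v' ceq_sym ceq_trans by blast
      show "length (p' @ rdx s' t' @ q') = length u" using ceq_mset[OF v'] ceq_mset[OF uv] by simp
    qed (use less r r' in auto)
    finally show ?thesis .
  qed
  show ?case
  proof (intro conjI allI impI)
    fix u' assume uu: "u \<simeq> u'"
    show "N c u = N c u'"
    proof (cases "\<exists>p s t q. isr s t \<and> u \<simeq> p @ rdx s t @ q")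
      case True
      then obtain p s t q where h: "isr s t" "u \<simeq> p @ rdx s t @ q" by blast
      have "u' \<simeq> p @ rdx s t @ q" using uu h(2) ceq_sym ceq_trans by blast
      then show ?thesis using *[OF h(1) h(2)] *[OF h(1) _ uu] by simp
    next
      case False
      then have "\<nexists>x. okp u x" "\<nexists>x. okp u' x" using ceq_trans[OF uu] by (fastforce simp: okp_def)+
      moreover have "u \<simeq> c \<longleftrightarrow> u' \<simeq> c" using uu ceq_sym ceq_trans by blast
      ultimately show ?thesis by (simp add: N.simps)
    qed
  qed (use * in auto)
qed

definition irr :: "'i list \<Rightarrow> bool" where
  "irr u \<longleftrightarrow> (\<forall>p s t q. isr s t \<longrightarrow> \<not> u \<simeq> p @ rdx s t @ q)"

lemma N_irr: "irr u \<Longrightarrow> N c u = (if u \<simeq> c then 1 else 0)"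
  by (subst N.simps) (auto simp: irr_def okp_def)

lemma N_short: "length u < length c \<Longrightarrow> N c u = 0"
proof (induction "length u" arbitrary: u rule: less_induct)
  case less
  show ?case
  proof (cases "irr u")
    case True
    then show ?thesis using N_irr[OF True] less(2) ceq_mset by fastforce
  next
    case False
    then obtain p s t q where h: "isr s t" "u \<simeq> p @ rdx s t @ q" by (auto simp: irr_def)
    have "N c (p @ alt s t j @ q) = 0" if "j < lng s t" for j
      using less that ceq_mset[OF h(2)] by auto
    then show ?thesis using N_red_ceq[of u c] h by (simp add: redsum_def)
  qed
qed

text \<open>The functionals on words, i.e. on the free algebra generated by the \<open>b_s\<close>, that vanish on the
  relations of the generalised Temperley--Lieb algebra with loop parameter \<open>dl\<close>.\<close>

definition tlfun :: "('i list \<Rightarrow> 'a) \<Rightarrow> bool" where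
  "tlfun G \<longleftrightarrow> (\<forall>p s t q. m s t = 2 \<longrightarrow> G (p @ [s, t] @ q) = G (p @ [t, s] @ q)) \<and>
     (\<forall>p s t q. isr s t \<longrightarrow> G (p @ rdx s t @ q) = redsum G p s t q)"

lemma tlfun_N: "tlfun (N c)"
  unfolding tlfun_def
proof (intro conjI allI impI)
  fix p s t q assume "m s t = 2"
  then have "comm_move m (p @ [s, t] @ q) (p @ [t, s] @ q)" by (auto simp: comm_move_def)
  then have "p @ [s, t] @ q \<simeq> p @ [t, s] @ q" by (simp add: ceq_def)
  then show "N c (p @ [s, t] @ q) = N c (p @ [t, s] @ q)" using N_red_ceq by blast
qed (use N_red_ceq in auto)

end

section \<open>The action of the Hecke generators on Temperley--Lieb functionals\<close>

locale tlv = tl m dl for m :: "'i \<Rightarrow> 'i \<Rightarrow> nat" and dl :: "'a::comm_ring_1" +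
  fixes v v' :: 'a
  assumes vv: "v * v' = 1" and dl: "dl = v + v'"
begin

text \<open>Prepending \<open>s\<close> to the argument is left multiplication by
  \<open>b_s = v' (T_s + 1)\<close>, so this is \<open>f\<close> evaluated at \<open>T_s q\<close>.
  Acting on arguments from the left makes it a right action on functionals.\<close>

definition tau :: "('i list \<Rightarrow> 'a) \<Rightarrow> 'i \<Rightarrow> 'i list \<Rightarrow> 'a" where
  "tau f s = (\<lambda>q. v * f (s # q) - f q)"

lemma tlfunI:
  assumes "\<And>p s t q. m s t = 2 \<Longrightarrow> G (p @ [s, t] @ q) = G (p @ [t, s] @ q)"
    and "\<And>p s t q. isr s t \<Longrightarrow> G (p @ rdx s t @ q) = redsum G p s t q"
  shows "tlfun G"
  using assms unfolding tlfun_def by blast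

lemma tlfunD:
  assumes "tlfun G"
  shows "m s t = 2 \<Longrightarrow> G (p @ [s, t] @ q) = G (p @ [t, s] @ q)"
    and "isr s t \<Longrightarrow> G (p @ rdx s t @ q) = redsum G p s t q"
  using assms unfolding tlfun_def by blast+

lemma tlfun_comb: "tlfun f \<Longrightarrow> tlfun g \<Longrightarrow> tlfun (\<lambda>q. a * f q + b * g q)"
proof (rule tlfunI)
  assume fg: "tlfun f" "tlfun g"
  fix p s t q
  show "m s t = 2 \<Longrightarrow> a * f (p @ [s, t] @ q) + b * g (p @ [s, t] @ q) = a * f (p @ [t, s] @ q) + b * g (p @ [t, s] @ q)"
    using tlfunD(1)[OF fg(1), of s t p q] tlfunD(1)[OF fg(2), of s t p q] by simp
  show "isr s t \<Longrightarrow> a * f (p @ rdx s t @ q) + b * g (p @ rdx s t @ q) = redsum (\<lambda>q. a * f q + b * g q) p s t q"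
    unfolding tlfunD(2)[OF fg(1)] tlfunD(2)[OF fg(2)]
    by (simp add: redsum_def sum.distrib sum_distrib_left algebra_simps)
qed

lemma tlfun_zero: "tlfun (\<lambda>_. 0)"
  by (simp add: tlfun_def redsum_def)

lemma tlfun_add: "tlfun f \<Longrightarrow> tlfun g \<Longrightarrow> tlfun (\<lambda>q. f q + g q)"
  using tlfun_comb[of f g 1 1] by simp

lemma tlfun_Cons: assumes "tlfun f" shows "tlfun (\<lambda>q. f (s # q))"
  using tlfunD(1)[OF assms, of _ _ "s # p" for p] tlfunD(2)[OF assms, of _ _ "s # p" for p]
  by (intro tlfunI) (auto simp: redsum_def)

lemma tlfun_tau: "tlfun f \<Longrightarrow> tlfun (tau f s)"
  using tlfun_comb[OF tlfun_Cons[of f s], of f v "-1"] by (simp add: tau_def)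

lemma tlfun_foldl: "tlfun f \<Longrightarrow> tlfun (foldl tau f u)"
  by (induction u arbitrary: f) (auto intro: tlfun_tau)

lemma tau_add: "tau (\<lambda>q. f q + g q) s = (\<lambda>q. tau f s q + tau g s q)"
  by (simp add: tau_def algebra_simps)

lemma tau_scale: "tau (\<lambda>q. c * f q) s = (\<lambda>q. c * tau f s q)"
  by (simp add: tau_def algebra_simps)

lemma tlfun_double: "tlfun f \<Longrightarrow> f (s # s # q) = dl * f (s # q)"
proof -
  assume "tlfun f"
  then have "f ([] @ rdx s s @ q) = redsum f [] s s q" by (rule tlfunD(2)) (simp add: isr_def)
  then show ?thesis
    by (simp add: redsum_def lng_def cf_def eval_nat_numeral lessThan_Suc)
qed

lemma tau_quad:
  assumes "tlfun f" shows "tau (tau f s) s = (\<lambda>q. v\<^sup>2 * f q + (v\<^sup>2 - 1) * tau f s q)"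
proof
  fix q
  have "v * (v * f (s # s # q)) = v * v * v * f (s # q) + v * (v * v') * f (s # q)"
    unfolding tlfun_double[OF assms] dl by (simp add: algebra_simps)
  then show "tau (tau f s) s q = v\<^sup>2 * f q + (v\<^sup>2 - 1) * tau f s q"
    by (simp add: tau_def vv algebra_simps power2_eq_square)
qed

section \<open>Dihedral sums as Chebyshev elements\<close>

context
  fixes f :: "'i list \<Rightarrow> 'a" and s t :: 'i
  assumes f: "tlfun f"
begin

abbreviation "rA j \<equiv> foldl tau f (alt s t j)"
abbreviation "rB j \<equiv> foldl tau f (alt t s j)"
abbreviation "xl j \<equiv> (if even j then s else t)"

text \<open>\<open>csum k\<close> sums the action of \<open>T_u\<close> over all \<open>u\<close> below the alternating word of length \<open>k\<close>.\<close>

fun csum :: "nat \<Rightarrow> 'i list \<Rightarrow> 'a" where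
  "csum 0 = (\<lambda>_. 0)"
| "csum (Suc 0) = (\<lambda>q. rA 0 q + rA 1 q)"
| "csum (Suc (Suc k)) = (\<lambda>q. csum (Suc k) q + rA (Suc (Suc k)) q + rB (Suc k) q)"

definition cheb :: "nat \<Rightarrow> 'i list \<Rightarrow> 'a" where
  "cheb k q = (\<Sum>j\<le>k. dc k j * f (alt s t j @ q))"

lemma rA_Suc: "rA (Suc j) = tau (rA j) (xl j)"
  using alt_snoc[of s t j] by (simp del: alt.simps)

lemma rB_Suc: "rB (Suc j) = tau (rB j) (xl (Suc j))"
  using alt_snoc[of t s j] by (simp del: alt.simps)

lemma tlfun_S: "tlfun (csum k)"
  by (induction k rule: csum.induct)
    (auto intro!: tlfun_zero tlfun_add tlfun_foldl tlfun_tau f)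

lemma tau_one_plus:
  assumes "tlfun g" shows "tau (\<lambda>q. g q + tau g x q) x = (\<lambda>q. v\<^sup>2 * (g q + tau g x q))"
  using tau_quad[OF assms] by (simp add: tau_add algebra_simps)

text \<open>The sum over the interval below an alternating word is an eigenvector of its last letter
  with eigenvalue q. Applying \<open>1 + T_x\<close> for the other letter \<open>x\<close> gives the
  next sum plus q times the previous one. Both follow from the quadratic relation alone, for every
  length.\<close>

lemma csum_step:
  "tau (csum (Suc k)) (xl k) = (\<lambda>q. v\<^sup>2 * csum (Suc k) q) \<and>
   (\<forall>q. csum (Suc k) q + tau (csum (Suc k)) (xl (Suc k)) q = csum (Suc (Suc k)) q + v\<^sup>2 * csum k q)"
proof (induction k rule: less_induct)
  case (less k)
  show ?case
  proof (cases k)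
    case 0
    have 1: "csum (Suc 0) = (\<lambda>q. f q + tau f s q)" by (simp)
    show ?thesis unfolding 0 1 using tau_one_plus[OF f, of s] by (simp add: tau_add)
  next
    case (Suc j)
    have IH: "tau (csum (Suc j)) (xl j) = (\<lambda>q. v\<^sup>2 * csum (Suc j) q)"
      "\<And>q. csum (Suc j) q + tau (csum (Suc j)) (xl (Suc j)) q = csum (Suc (Suc j)) q + v\<^sup>2 * csum j q"
      using less[of j] Suc by auto
    have x: "xl (Suc (Suc j)) = xl j" by simp
    have Sj: "tau (csum j) (xl (Suc j)) = (\<lambda>q. v\<^sup>2 * csum j q)"
    proof (cases j)
      case 0 then show ?thesis by (simp add: tau_def)
    next
      case (Suc i)
      then show ?thesis using less[of i] \<open>k = Suc j\<close> by auto
    qed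
    have e: "csum (Suc (Suc j)) = (\<lambda>q. 1 * (csum (Suc j) q + tau (csum (Suc j)) (xl (Suc j)) q) + (- (v\<^sup>2)) * csum j q)"
      using IH(2) by (auto simp: algebra_simps)
    have "tau (csum (Suc (Suc j))) (xl (Suc j)) =
       (\<lambda>q. 1 * tau (\<lambda>q. csum (Suc j) q + tau (csum (Suc j)) (xl (Suc j)) q) (xl (Suc j)) q + (- (v\<^sup>2)) * tau (csum j) (xl (Suc j)) q)"
      unfolding e by (simp only: tau_add tau_scale)
    also have "\<dots> = (\<lambda>q. v\<^sup>2 * csum (Suc (Suc j)) q)"
      unfolding tau_one_plus[OF tlfun_S] Sj e by (simp add: algebra_simps)
    finally have 1: "tau (csum (Suc (Suc j))) (xl (Suc j)) = (\<lambda>q. v\<^sup>2 * csum (Suc (Suc j)) q)" .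
    have 2: "csum (Suc (Suc j)) q + tau (csum (Suc (Suc j))) (xl (Suc (Suc j))) q = csum (Suc (Suc (Suc j))) q + v\<^sup>2 * csum (Suc j) q" for q
    proof -
      have "tau (csum (Suc (Suc j))) (xl j) =
        (\<lambda>q. tau (csum (Suc j)) (xl j) q + tau (rA (Suc (Suc j))) (xl j) q + tau (rB (Suc j)) (xl j) q)"
        by (simp only: csum.simps tau_add)
      also have "\<dots> = (\<lambda>q. v\<^sup>2 * csum (Suc j) q + rA (Suc (Suc (Suc j))) q + rB (Suc (Suc j)) q)"
        unfolding IH(1) rA_Suc[of "Suc (Suc j)"] rB_Suc[of "Suc j"] x ..
      finally show ?thesis unfolding x by (simp only: csum.simps) simp
    qed
    show ?thesis using 1 2 unfolding Suc by blast
  qed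
qed

lemma cheb_rec: "cheb (Suc (Suc k)) q = cheb (Suc k) (xl (Suc k) # q) - cheb k q"
proof -
  have 1: "dc (Suc k) j * f (alt s t (Suc j) @ q) = dc (Suc k) j * f (alt s t j @ xl (Suc k) # q)" for j
  proof (cases "dc (Suc k) j = (0::'a)")
    case False
    then have "xl (Suc k) = xl j" using dc_nz[OF False] by auto
    then show ?thesis using alt_snoc[of s t j] by (simp del: alt.simps)
  qed simp
  have z: "dc k (Suc k) = (0::'a)" "dc k (Suc (Suc k)) = (0::'a)"
    using dc_nz[of k "Suc k", where 'a = 'a] dc_nz[of k "Suc (Suc k)", where 'a = 'a] by auto
  have "cheb (Suc (Suc k)) q = (\<Sum>j\<le>Suc (Suc k). (if j = 0 then 0 else dc (Suc k) (j - 1)) * f (alt s t j @ q))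
      - (\<Sum>j\<le>Suc (Suc k). dc k j * f (alt s t j @ q))"
    unfolding cheb_def by (simp only: dc.simps left_diff_distrib sum_subtractf)
  also have "(\<Sum>j\<le>Suc (Suc k). dc k j * f (alt s t j @ q)) = cheb k q"
    unfolding cheb_def using z by simp
  also have "(\<Sum>j\<le>Suc (Suc k). (if j = 0 then 0 else dc (Suc k) (j - 1)) * f (alt s t j @ q))
     = (\<Sum>j\<le>Suc k. dc (Suc k) j * f (alt s t (Suc j) @ q))"
    by (subst sum.atMost_Suc_shift) (simp del: alt.simps sum.atMost_Suc)
  also have "\<dots> = cheb (Suc k) (xl (Suc k) # q)"
    unfolding cheb_def 1 ..
  finally show ?thesis .
qed

text \<open>Since \<open>1 + T_x\<close> is \<open>v b_x\<close>, the sums divided by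
  \<open>v ^ k\<close> satisfy the recursion that defines the Chebyshev elements.\<close>

lemma csum_eq_cheb: "csum k = (\<lambda>q. v ^ k * cheb k q)"
proof (induction k rule: less_induct)
  case (less n)
  consider "n = 0" | "n = 1" | k where "n = Suc (Suc k)" by (metis One_nat_def not0_implies_Suc)
  then show ?case
  proof cases
    case (3 k)
    have a: "csum (Suc k) = (\<lambda>q. v ^ Suc k * cheb (Suc k) q)" and b: "csum k = (\<lambda>q. v ^ k * cheb k q)"
      using less[of "Suc k"] less[of k] 3 by simp_all
    show ?thesis unfolding 3
    proof
      fix q
      have "csum (Suc (Suc k)) q = csum (Suc k) q + tau (csum (Suc k)) (xl (Suc k)) q - v\<^sup>2 * csum k q"
        using csum_step[of k] by (simp del: csum.simps)
      also have "\<dots> = v * csum (Suc k) (xl (Suc k) # q) - v\<^sup>2 * csum k q"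
        by (simp add: tau_def)
      also have "\<dots> = v ^ Suc (Suc k) * cheb (Suc (Suc k)) q"
        unfolding a b cheb_rec by (simp add: algebra_simps power2_eq_square)
      finally show "csum (Suc (Suc k)) q = v ^ Suc (Suc k) * cheb (Suc (Suc k)) q" .
    qed
  qed (simp_all add: cheb_def tau_def)
qed

lemma csum_sum: "csum (Suc k) q = (\<Sum>j\<le>Suc k. rA j q) + (\<Sum>j=1..k. rB j q)"
proof (induction k)
  case (Suc k)
  have "csum (Suc (Suc k)) q = csum (Suc k) q + rA (Suc (Suc k)) q + rB (Suc k) q" by (simp only: csum.simps)
  then show ?case unfolding Suc by (simp add: algebra_simps del: foldl_Cons alt.simps csum.simps)
qed simp

lemma cheb_zero: assumes "3 \<le> m s t" shows "cheb (m s t) q = 0"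
proof -
  have ne: "s \<noteq> t" using assms by auto
  obtain k where k: "m s t = Suc k" using assms by (cases "m s t") auto
  have "f ([] @ rdx s t @ q) = redsum f [] s t q" using f assms unfolding tlfun_def isr_def by blast
  then have "f (alt s t (Suc k) @ q) = - (\<Sum>j<Suc k. dc (Suc k) j * f (alt s t j @ q))"
    using ne k by (simp add: redsum_def lng_def cf_def sum_negf)
  then show ?thesis unfolding k cheb_def by (simp add: lessThan_Suc_atMost dc_top del: dc.simps alt.simps)
qed

lemma csum_zero: "3 \<le> m s t \<Longrightarrow> csum (m s t) q = 0"
  using csum_eq_cheb cheb_zero by simp

end

text \<open>At length \<open>m s t\<close> the sum runs over the whole dihedral subgroup, so this is
  the vanishing of the generator of J; the matching Chebyshev element is the relation imposed on
  \<open>f\<close>.\<close>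

lemma alt_sum_zero:
  assumes "tlfun f" "3 \<le> m s t"
  shows "(\<Sum>j\<le>m s t. foldl tau f (alt s t j) q) + (\<Sum>j=1..<m s t. foldl tau f (alt t s j) q) = 0"
proof -
  obtain k where k: "m s t = Suc k" using assms by (cases "m s t") auto
  show ?thesis using csum_zero[OF assms, of q] csum_sum[OF assms(1), of s t k q]
    unfolding k atLeastLessThanSuc_atLeastAtMost by metis
qed

text \<open>For \<open>m s t\<close> at least 3, the sums starting with \<open>s\<close> and with
  \<open>t\<close> both vanish, and they differ only in their longest term.\<close>

lemma tau_braid:
  assumes "tlfun f" "m s t \<noteq> 0"
  shows "foldl tau f (alt s t (m s t)) = foldl tau f (alt t s (m s t))"
proof (cases "s = t")
  case False
  then consider "m s t = 2" | "3 \<le> m s t" using m_ne_cases[OF False] assms(2) by fastforce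
  then show ?thesis
  proof cases
    case 1
    have "f ([] @ [s, t] @ q) = f ([] @ [t, s] @ q)" for q using assms(1) 1 unfolding tlfun_def by blast
    then show ?thesis unfolding 1 by (auto simp: eval_nat_numeral tau_def algebra_simps)
  next
    case 2
    obtain k where k: "m s t = Suc k" "1 \<le> k" using 2 by (cases "m s t") auto
    show ?thesis
    proof
      fix q
      have e: "(\<Sum>j\<le>Suc k. g j) = g (Suc k) + g 0 + (\<Sum>j=1..k. g j)" for g :: "nat \<Rightarrow> 'a"
        by (simp add: atMost_atLeast0 sum.atLeast_Suc_atMost)
      define a where "a j = foldl tau f (alt s t j) q" for j
      define b where "b j = foldl tau f (alt t s j) q" for j
      have "(\<Sum>j\<le>Suc k. a j) + (\<Sum>j=1..k. b j) = 0" "(\<Sum>j\<le>Suc k. b j) + (\<Sum>j=1..k. a j) = 0"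
        using alt_sum_zero[OF assms(1) 2, of q] alt_sum_zero[OF assms(1), of t s q] 2 
        unfolding m_sym[of t s] k a_def b_def atLeastLessThanSuc_atLeastAtMost by blast+
      then have "a (Suc k) + (a 0 + (\<Sum>j=1..k. a j) + (\<Sum>j=1..k. b j)) = b (Suc k) + (b 0 + (\<Sum>j=1..k. a j) + (\<Sum>j=1..k. b j))"
        unfolding e by (simp add: algebra_simps)
      moreover have "a 0 = b 0" by (simp add: a_def b_def)
      ultimately show "foldl tau f (alt s t (m s t)) q = foldl tau f (alt t s (m s t)) q"
        unfolding k a_def b_def by (metis add_right_cancel)
    qed
  qed
qed simp

end

section \<open>Coxeter groups and the exchange condition\<close>

context coxeter begin

abbreviation weq (infix "\<approx>" 50) where "u \<approx> v \<equiv> cox_eq m u v"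

lemma weq_refl [simp]: "u \<approx> u" and weq_sym: "u \<approx> v \<Longrightarrow> v \<approx> u"
  and weq_trans [trans]: "u \<approx> v \<Longrightarrow> v \<approx> w \<Longrightarrow> u \<approx> w"
  unfolding cox_eq_def by (auto intro: equivclp_sym equivclp_trans)

lemma weq_iffR: "a \<approx> b \<Longrightarrow> r \<approx> a \<longleftrightarrow> r \<approx> b" and weq_iffL: "a \<approx> b \<Longrightarrow> a \<approx> r \<longleftrightarrow> b \<approx> r"
  using weq_sym weq_trans by meson+

lemma cox_step_ctxt: "cox_step m a b \<Longrightarrow> cox_step m (x @ a @ y) (x @ b @ y)"
  unfolding cox_step_def by (metis append.assoc)

lemma weq_ctxt: "a \<approx> b \<Longrightarrow> x @ a @ y \<approx> x @ b @ y"
  unfolding cox_eq_def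
proof (induction rule: equivclp_induct)
  case (step y' z)
  then show ?case using cox_step_ctxt by (meson equivclp_into_equivclp)
qed simp

lemma weq_append: "a \<approx> b \<Longrightarrow> c \<approx> d \<Longrightarrow> a @ c \<approx> b @ d"
  using weq_ctxt[of a b "[]" c] weq_ctxt[of c d b "[]"] by (auto intro: weq_trans)

lemma welt_eq_iff: "welt m u = welt m v \<longleftrightarrow> u \<approx> v"
proof
  assume "welt m u = welt m v"
  moreover have "v \<in> welt m v" by (simp add: welt_def)
  ultimately have "v \<in> welt m u" by simp
  then show "u \<approx> v" by (simp add: welt_def)
next
  assume "u \<approx> v"
  then have "u \<approx> w \<longleftrightarrow> v \<approx> w" for w by (rule weq_iffL)
  then show "welt m u = welt m v" by (simp add: welt_def)
qed

lemma weq_relator: "m s t \<noteq> 0 \<Longrightarrow> alt s t (2 * m s t) \<approx> []"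
  unfolding cox_eq_def
  by (rule r_into_equivclp) (auto simp: cox_step_def alt_concat[symmetric] intro!: exI[of _ "[]"])

lemma weq_ss: "[s, s] \<approx> []"
  using weq_relator[of s s] by (simp add: numeral_2_eq_2)

lemma weq_rev: "u @ rev u \<approx> []"
proof (induction u)
  case (Cons s u)
  have "s # u @ rev u @ [s] \<approx> [s] @ [] @ [s]" using weq_ctxt[OF Cons, of "[s]" "[s]"] by simp
  then show ?case using weq_ss weq_trans by fastforce
qed simp

lemma weq_rev': "rev u @ u \<approx> []"
  using weq_rev[of "rev u"] by simp

lemma weq_insert: "a @ b \<approx> a @ u @ rev u @ b" "a @ b \<approx> a @ rev u @ u @ b"
  using weq_ctxt[OF weq_rev, of a u b] weq_ctxt[OF weq_rev', of a u b] weq_sym by auto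

lemma weq_cancelL: "x @ a \<approx> x @ b \<longleftrightarrow> a \<approx> b"
proof
  assume "x @ a \<approx> x @ b"
  then have "rev x @ x @ a \<approx> rev x @ x @ b" using weq_append[OF weq_refl] by blast
  then show "a \<approx> b" using weq_insert(2)[of "[]" a x] weq_insert(2)[of "[]" b x] weq_sym weq_trans
    by (metis append_Nil)
qed (simp add: weq_append)

lemma weq_cancelR: "a @ x \<approx> b @ x \<longleftrightarrow> a \<approx> b"
proof
  assume "a @ x \<approx> b @ x"
  then have "(a @ x) @ rev x \<approx> (b @ x) @ rev x" using weq_append[OF _ weq_refl] by blast
  then show "a \<approx> b" using weq_insert(1)[of a "[]" x] weq_insert(1)[of b "[]" x] weq_sym weq_trans
    by (metis append_Nil2 append.assoc)
qed (simp add: weq_append)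

lemma weq_moveR: "a @ [s] \<approx> b \<longleftrightarrow> a \<approx> b @ [s]"
proof -
  have "a \<approx> a @ [s] @ [s]" using weq_insert(1)[of a "[]" "[s]"] by simp
  then have "a \<approx> b @ [s] \<longleftrightarrow> (a @ [s]) @ [s] \<approx> b @ [s]" using weq_sym weq_trans by (metis append.assoc)
  then show ?thesis using weq_cancelR by blast
qed

lemma weq_rev_cong: assumes "u \<approx> v" shows "rev u \<approx> rev v"
proof -
  have "rev u @ u \<approx> rev u @ v" using assms by (simp add: weq_cancelL)
  then have "[] \<approx> rev u @ v" using weq_rev' weq_sym weq_trans by blast
  then have "rev v @ v \<approx> rev u @ v" using weq_rev' weq_trans by blast
  then show ?thesis using weq_cancelR weq_sym by blast
qed

lemma weq_braid: assumes "m s t \<noteq> 0" shows "alt s t (m s t) \<approx> alt t s (m s t)"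
proof -
  let ?n = "m s t"
  have "alt s t (2 * ?n) = alt s t ?n @ rev (alt t s ?n)"
    using alt_append[of s t ?n ?n] by (simp add: rev_alt mult_2)
  then have "alt s t ?n @ rev (alt t s ?n) \<approx> alt t s ?n @ rev (alt t s ?n)"
    using weq_relator[OF assms] weq_rev weq_sym weq_trans by metis
  then show ?thesis using weq_cancelR by blast
qed

lemma weq_parity: "u \<approx> v \<Longrightarrow> even (length u) = even (length v)"
  unfolding cox_eq_def
proof (induction rule: equivclp_induct)
  case (step y z)
  have "even (length a) = even (length b)" if "cox_step m a b" for a b
    using that by (auto simp: cox_step_def alt_concat)
  then show ?case using step by blast
qed simp

section \<open>Length and reduced words\<close>

abbreviation ln :: "'i list \<Rightarrow> nat" where "ln u \<equiv> wlen (welt m u)"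

lemma ln_le: "u \<approx> v \<Longrightarrow> ln u \<le> length v"
  unfolding wlen_def by (rule Least_le) (auto simp: welt_def)

lemma ln_ex: "\<exists>v. u \<approx> v \<and> length v = ln u"
proof -
  have "\<exists>n. \<exists>v\<in>welt m u. length v = n" by (auto simp: welt_def intro: weq_refl)
  from LeastI_ex[OF this] show ?thesis by (auto simp: wlen_def welt_def)
qed

lemma ln_cong: "u \<approx> v \<Longrightarrow> ln u = ln v"
  by (rule arg_cong[of _ _ wlen]) (simp add: welt_eq_iff)

lemma ln_parity: "even (ln u) = even (length u)"
  using ln_ex[of u] weq_parity by metis

definition red :: "'i list \<Rightarrow> bool" where "red u \<longleftrightarrow> ln u = length u"

lemma red_ex: "\<exists>v. u \<approx> v \<and> red v"
  unfolding red_def using ln_ex ln_cong by metis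

lemma ln_append: "ln (u @ v) \<le> ln u + ln v"
proof -
  obtain u' v' where "u \<approx> u'" "length u' = ln u" "v \<approx> v'" "length v' = ln v" using ln_ex by metis
  then show ?thesis using ln_le[OF weq_append, of u u' v v'] by simp
qed

lemma ln_rev: "ln (rev u) = ln u"
proof -
  have "ln (rev u) \<le> ln u" for u
    using ln_ex[of u] ln_le[OF weq_rev_cong, of u] by (metis length_rev)
  from this[of u] this[of "rev u"] show ?thesis by simp
qed

lemma red_append: assumes "red (u @ v)" shows "red u" "red v"
  using assms ln_append[of u v] ln_le[of u u] ln_le[of v v] by (auto simp: red_def)

lemma ln_Nil [simp]: "ln [] = 0" using ln_le[of "[]" "[]"] by simp

lemma ln_single: "ln [s] = 1"
  using ln_le[of "[s]" "[s]"] ln_parity[of "[s]"] by (cases "ln [s]") auto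

lemma ln_snoc: "ln (u @ [s]) = Suc (ln u) \<or> Suc (ln (u @ [s])) = ln u"
proof -
  have "ln u = ln (u @ [s] @ [s])" using weq_insert(1)[of u "[]" "[s]"] ln_cong by simp
  then have "ln u \<le> ln (u @ [s]) + 1" using ln_append[of "u @ [s]" "[s]"] ln_single by simp
  moreover have "ln (u @ [s]) \<le> ln u + 1" using ln_append[of u "[s]"] ln_single by simp
  moreover have "even (ln (u @ [s])) \<noteq> even (ln u)" using ln_parity by simp
  ultimately show ?thesis by (cases "ln (u @ [s]) = ln u") auto
qed

lemma ln_Cons: "ln (s # u) = Suc (ln u) \<or> Suc (ln (s # u)) = ln u"
  using ln_snoc[of "rev u" s] ln_rev[of u] ln_rev[of "s # u"] by simp

section \<open>Reflections and the strong exchange condition\<close>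

definition isrefl :: "'i list \<Rightarrow> bool" where
  "isrefl r \<longleftrightarrow> (\<exists>x s. r \<approx> x @ [s] @ rev x)"

text \<open>Number of occurrences of the reflection \<open>r\<close> among the reflections attached to the letters of a word;
  only its parity depends on the group element alone.\<close>

fun cnt :: "'i list \<Rightarrow> 'i list \<Rightarrow> nat" where
  "cnt [] r = 0"
| "cnt (s # u) r = cnt u r + (if u @ r @ rev u \<approx> [s] then 1 else 0)"

lemma conj_cong: "r \<approx> r' \<Longrightarrow> u @ r @ rev u \<approx> u @ r' @ rev u"
  by (rule weq_ctxt)

lemma cnt_cong: "r \<approx> r' \<Longrightarrow> cnt u r = cnt u r'"
  by (induction u) (simp_all add: weq_iffL[OF conj_cong])

lemma cnt_append: "cnt (u @ v) r = cnt v r + cnt u (v @ r @ rev v)"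
  by (induction u) auto

lemma sum_shift: "(\<Sum>j<n + (k::nat). g j :: nat) = (\<Sum>j<n. g j) + (\<Sum>j<k. g (n + j))"
  by (induction k) auto

lemma alt_odd_conj:
  assumes e: "even k"
  shows "rev (alt s t k) @ t # alt s t k = alt t s (2 * k + 1)"
    and "rev (alt t s (Suc k)) @ s # alt t s (Suc k) = alt t s (2 * Suc k + 1)"
proof -
  have "alt t s (k + Suc k) = alt t s k @ t # alt s t k" using alt_append[of t s k "Suc k"] e by simp
  then show "rev (alt s t k) @ t # alt s t k = alt t s (2 * k + 1)" using e by (simp add: rev_alt mult_2 del: alt.simps)
  have "alt t s (Suc k + Suc (Suc k)) = alt t s (Suc k) @ s # alt t s (Suc k)"
    using alt_append[of t s "Suc k" "Suc (Suc k)"] e by simp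
  then show "rev (alt t s (Suc k)) @ s # alt t s (Suc k) = alt t s (2 * Suc k + 1)"
    using e by (simp add: rev_alt mult_2 del: alt.simps)
qed

lemma conj_iff: "u @ r @ rev u \<approx> [s] \<longleftrightarrow> r \<approx> rev u @ [s] @ u"
proof -
  have "(rev u @ (u @ r @ rev u)) @ u \<approx> (rev u @ [s]) @ u \<longleftrightarrow> rev u @ (u @ r @ rev u) \<approx> rev u @ [s]"
    by (rule weq_cancelR)
  also have "\<dots> \<longleftrightarrow> u @ r @ rev u \<approx> [s]" by (rule weq_cancelL)
  finally have "u @ r @ rev u \<approx> [s] \<longleftrightarrow> rev u @ (u @ r @ rev u) @ u \<approx> rev u @ [s] @ u" by simp
  moreover have "rev u @ (u @ r @ rev u) @ u \<approx> r"
  proof -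
    have "r \<approx> rev u @ u @ r" using weq_insert(2)[of "[]" r u] by simp
    also have "rev u @ u @ r \<approx> (rev u @ u @ r) @ rev u @ u" using weq_insert(2)[of "rev u @ u @ r" "[]" u] by simp
    finally show ?thesis using weq_sym by simp
  qed
  ultimately show ?thesis using weq_sym weq_trans by blast
qed

text \<open>The case distinction makes all these words end in \<open>t\<close>, so that they grow at
  the front, as the recursion of \<open>cnt\<close> does.\<close>

lemma cnt_alt:
  "cnt (if even k then alt s t k else alt t s k) r = (\<Sum>j<k. if r \<approx> alt t s (2 * j + 1) then 1 else 0)"
proof (induction k)
  case (Suc k)
  show ?case
  proof (cases "even k")
    case True
    have "alt s t k @ r @ rev (alt s t k) \<approx> [t] \<longleftrightarrow> r \<approx> alt t s (2 * k + 1)"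
      unfolding conj_iff using alt_odd_conj(1)[OF True, of s t] by simp
    then show ?thesis using Suc True by (simp del: alt.simps add: alt.simps(2)[of t s k])
  next
    case False
    then obtain l where l: "k = Suc l" "even l" by (cases k) auto
    have "alt t s k @ r @ rev (alt t s k) \<approx> [s] \<longleftrightarrow> r \<approx> alt t s (2 * k + 1)"
      unfolding conj_iff using alt_odd_conj(2)[OF l(2), of t s] l by (simp del: alt.simps)
    then show ?thesis using Suc False by (simp del: alt.simps add: alt.simps(2)[of s t k])
  qed
qed simp

text \<open>The reflections attached to the letters of the relator are
  \<open>alt t s (2 * j + 1)\<close>. They repeat with period \<open>m s t\<close>, and the relator
  runs through two periods.\<close>

lemma cnt_relator: assumes "m s t \<noteq> 0" shows "even (cnt (alt s t (2 * m s t)) r)"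
proof -
  let ?n = "m s t"
  let ?g = "\<lambda>j. if r \<approx> alt t s (2 * j + 1) then 1 else (0::nat)"
  have per: "alt t s (2 * (?n + j) + 1) \<approx> alt t s (2 * j + 1)" for j
  proof -
    have "alt t s (2 * (?n + j) + 1) = alt t s (2 * j + 1) @ alt s t (2 * ?n)"
      using alt_append[of t s "2 * j + 1" "2 * ?n"] by (simp add: algebra_simps)
    then show ?thesis using weq_append[OF weq_refl weq_relator[OF assms], of "alt t s (2 * j + 1)"] by simp
  qed
  have "?g (?n + j) = ?g j" for j using weq_iffR[OF per[of j], of r] by simp
  then have "(\<Sum>j<?n + ?n. ?g j) = 2 * (\<Sum>j<?n. ?g j)" unfolding sum_shift by simp
  moreover have "cnt (alt s t (2 * ?n)) r = (\<Sum>j<?n + ?n. ?g j)" using cnt_alt[of "2 * ?n" s t r] by (simp add: mult_2)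
  ultimately show ?thesis by simp
qed

lemma cnt_parity: "u \<approx> v \<Longrightarrow> even (cnt u r) = even (cnt v r)"
  unfolding cox_eq_def
proof (induction rule: equivclp_induct)
  case (step y z)
  have "even (cnt a r) = even (cnt b r)" if ab: "cox_step m a b" for a b
  proof -
    obtain x w s t where st: "m s t \<noteq> 0" "a = x @ alt s t (2 * m s t) @ w" "b = x @ w"
      using ab by (auto simp: cox_step_def alt_concat)
    let ?R = "alt s t (2 * m s t)"
    let ?r = "w @ r @ rev w"
    have "?R @ ?r @ rev ?R \<approx> ?r"
      using weq_append[OF weq_relator[OF st(1)] weq_append[OF weq_refl weq_rev_cong[OF weq_relator[OF st(1)]]], of ?r] by simp
    then have "cnt x (?R @ ?r @ rev ?R) = cnt x ?r" by (rule cnt_cong)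
    then have "cnt a r = cnt b r + cnt ?R ?r" using st by (simp add: cnt_append)
    then show ?thesis using cnt_relator[OF st(1)] by simp
  qed
  then show ?case using step by blast
qed simp

lemma isrefl_single: "isrefl [s]"
  unfolding isrefl_def by (rule exI[of _ "[]"], rule exI[of _ s]) simp

lemma isrefl_conj: "isrefl r \<Longrightarrow> isrefl (y @ r @ rev y)"
proof -
  assume "isrefl r"
  then obtain x s where "r \<approx> x @ [s] @ rev x" by (auto simp: isrefl_def)
  then have "y @ r @ rev y \<approx> (y @ x) @ [s] @ rev (y @ x)" using conj_cong by fastforce
  then show ?thesis unfolding isrefl_def by blast
qed

lemma isrefl_sq: assumes "isrefl r" shows "r @ r \<approx> []" "r \<approx> rev r"
proof -
  obtain x s where r: "r \<approx> x @ [s] @ rev x" using assms by (auto simp: isrefl_def)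
  have "rev r \<approx> x @ [s] @ rev x" using weq_rev_cong[OF r] by simp
  then show 1: "r \<approx> rev r" using r weq_sym weq_trans by blast
  show "r @ r \<approx> []" using weq_append[OF weq_refl 1, of r] weq_rev weq_trans by blast
qed

text \<open>In the word \<open>x @ [s] @ rev x\<close> the middle letter contributes one occurrence;
  the others together are those in \<open>x @ rev x\<close>, which represents the identity and so
  contributes an even number.\<close>

lemma cnt_self: assumes "isrefl r" shows "odd (cnt r r)"
proof -
  obtain x s where r: "r \<approx> x @ [s] @ rev x" using assms by (auto simp: isrefl_def)
  have c: "rev x @ r @ x \<approx> [s]"
    using conj_iff[of "rev x" r s] r by simp
  then have c2: "[s] @ (rev x @ r @ x) @ [s] \<approx> [s]"
    using weq_ctxt[OF c, of "[s]" "[s]"] weq_insert(1)[of "[s]" "[]" "[s]"] weq_sym weq_trans by (metis append_Nil2 rev.simps append_Nil)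
  have "even (cnt r r) = even (cnt (x @ [s] @ rev x) r)" by (rule cnt_parity[OF r])
  also have "cnt (x @ [s] @ rev x) r = cnt (rev x) r + 1 + cnt x [s]"
    using c cnt_cong[OF c2, of x] by (simp add: cnt_append)
  also have "cnt (rev x) r + cnt x [s] = cnt (x @ rev x) r"
    using cnt_cong[OF c, of x] by (simp add: cnt_append)
  then have "cnt (rev x) r + 1 + cnt x [s] = cnt (x @ rev x) r + 1" by simp
  then have "even (cnt (rev x) r + 1 + cnt x [s]) = odd (cnt (x @ rev x) r)" by simp
  finally show ?thesis using cnt_parity[OF weq_rev[of x], of r] by simp
qed

lemma cnt_delete: "cnt u r > 0 \<Longrightarrow> \<exists>a s b. u = a @ [s] @ b \<and> u @ r \<approx> a @ b"
proof (induction u)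
  case (Cons s u)
  show ?case
  proof (cases "u @ r @ rev u \<approx> [s]")
    case True
    have "u @ r \<approx> u @ r @ rev u @ u" using weq_insert(2)[of "u @ r" "[]" u] by simp
    also have "u @ r @ rev u @ u \<approx> [s] @ u" using weq_append[OF True weq_refl, of u] by simp
    finally have "[s] @ u @ r \<approx> [s] @ [s] @ u" by (rule weq_append[OF weq_refl])
    also have "[s] @ [s] @ u \<approx> u" using weq_insert(1)[of "[]" u "[s]"] weq_sym by simp
    finally show ?thesis by (intro exI[of _ "[]"] exI[of _ s] exI[of _ u]) simp
  next
    case False
    then obtain a c b where "u = a @ [c] @ b" "u @ r \<approx> a @ b" using Cons by auto
    then show ?thesis using weq_cancelL[of "[s]" "u @ r" "a @ b"]
      by (intro exI[of _ "s # a"] exI[of _ c] exI[of _ b]) auto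
  qed
qed simp

lemma cnt_odd_less: assumes "odd (cnt u r)" shows "ln (u @ r) < ln u"
proof -
  obtain v where v: "u \<approx> v" "length v = ln u" using ln_ex by blast
  have "odd (cnt v r)" using assms cnt_parity[OF v(1)] by simp
  then obtain a s b where "v = a @ [s] @ b" "v @ r \<approx> a @ b" using cnt_delete[OF odd_pos, of v r] by blast
  then show ?thesis using ln_le[of "u @ r" "a @ b"] weq_append[OF v(1) weq_refl, of r] v weq_trans by fastforce
qed

text \<open>For the converse, an even count for \<open>u\<close> gives an odd count for
  \<open>u @ r\<close> by the cocycle rule \<open>cnt_append\<close> and \<open>cnt_self\<close>.
  Then \<open>u @ r @ r\<close>, which is \<open>u\<close>, would be shorter than
  \<open>u @ r\<close>.\<close>

lemma cnt_odd_iff: assumes "isrefl r" shows "odd (cnt u r) \<longleftrightarrow> ln (u @ r) < ln u"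
proof
  assume l: "ln (u @ r) < ln u"
  show "odd (cnt u r)"
  proof (rule ccontr)
    assume e: "\<not> odd (cnt u r)"
    have "r @ r @ rev r \<approx> r" using weq_insert(1)[of r "[]" r] weq_sym by simp
    then have "cnt (u @ r) r = cnt r r + cnt u r" using cnt_cong by (simp add: cnt_append)
    then have "odd (cnt (u @ r) r)" using e cnt_self[OF assms] by simp
    then have "ln (u @ r @ r) < ln (u @ r)" using cnt_odd_less[of "u @ r" r] by simp
    moreover have "ln (u @ r @ r) = ln u" using ln_cong[OF weq_append[OF weq_refl isrefl_sq(1)[OF assms], of u]] by simp
    ultimately show False using l by simp
  qed
qed (rule cnt_odd_less)

lemma strong_exchange:
  assumes "isrefl r" "ln (u @ r) < ln u"
  shows "\<exists>a s b. u = a @ [s] @ b \<and> u @ r \<approx> a @ b"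
  using cnt_delete[OF odd_pos, of u r] cnt_odd_iff[OF assms(1), of u] assms(2) by blast

lemmas exchange = strong_exchange[OF isrefl_single]

text \<open>The last letter of a shortest non-reduced prefix is absorbed by the exchange condition.
  The control of the letters keeps the result inside a dihedral subgroup.\<close>

lemma deletion:
  assumes "\<not> red u" shows "\<exists>v. u \<approx> v \<and> set v \<subseteq> set u \<and> length v + 2 = length u"
  using assms
proof (induction u rule: rev_induct)
  case Nil
  then show ?case by (simp add: red_def)
next
  case (snoc d u)
  show ?case
  proof (cases "red u")
    case True
    then have "ln (u @ [d]) < ln u" using snoc.prems ln_snoc[of u d] by (auto simp: red_def)
    then obtain a c b where "u = a @ [c] @ b" "u @ [d] \<approx> a @ b" using exchange by blast
    then show ?thesis by (intro exI[of _ "a @ b"]) auto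
  next
    case False
    then obtain v where "u \<approx> v" "set v \<subseteq> set u" "length v + 2 = length u" using snoc.IH by blast
    then show ?thesis by (intro exI[of _ "v @ [d]"]) (auto simp: weq_append)
  qed
qed

end

section \<open>Dihedral subgroups, Matsumoto's theorem and the Bruhat order\<close>

context tlv begin

text \<open>In each factor \<open>v b_s - 1\<close> the summand -1 evaluates \<open>f\<close> at a
  word too short to count, so only the product of the \<open>b_s\<close> survives.\<close>

lemma foldl_tau_leading:
  assumes "\<And>w. length w < L \<Longrightarrow> f w = 0" and "length u + length q \<le> L"
  shows "foldl tau f u q = v ^ length u * f (u @ q)"
  using assms
proof (induction u arbitrary: f L)
  case (Cons s u)
  have 0: "tau f s w = 0" if "length w < L - 1" for w
    using that Cons.prems(1) by (simp add: tau_def)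
  have "foldl tau (tau f s) u q = v ^ length u * tau f s (u @ q)"
    by (rule Cons.IH[OF 0]) (use Cons.prems in auto)
  also have "tau f s (u @ q) = v * f (s # u @ q)"
    using Cons.prems by (simp add: tau_def)
  finally show ?case by (simp add: mult.assoc power_commutes)
qed simp

text \<open>Evaluation at the empty word pairs the functionals \<open>N c\<close> with the
  \<open>T_u\<close> triangularly with respect to length, with powers of \<open>v\<close> on the
  diagonal.\<close>

lemma foldl_tau_N:
  assumes "irr u" "length u \<le> length c"
  shows "foldl tau (N c) u [] = (if u \<simeq> c then v ^ length u else 0)"
  using foldl_tau_leading[of "length c" "N c" u "[]"] N_short assms N_irr[OF assms(1), of c] by auto

end

section \<open>Alternating words in W\<close>

context coxeter begin

text \<open>Two neighbouring letters of a redex in the word would be \<open>s\<close> and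
  \<open>t\<close>, so the redex would have length \<open>m s t\<close> and not fit.\<close>

lemma alt_irr:
  assumes "s \<noteq> t" "m s t = 0 \<or> k < m s t"
  shows "alt s t k \<simeq> u \<Longrightarrow> isr a b \<Longrightarrow> p @ rdx a b @ q \<noteq> u"
    and "alt s t k \<simeq> u \<Longrightarrow> u = alt s t k"
proof -
  show single: "u = alt s t k" if au: "alt s t k \<simeq> u" for u
  proof -
    have "\<not> comm_move m (alt s t k) w" for w
    proof
      assume "comm_move m (alt s t k) w"
      then obtain x a c y where 1: "m a c = 2" "x @ a # c # y = alt s t k" by (auto simp: comm_move_def)
      then have ac: "(a = s \<and> c = t) \<or> (a = t \<and> c = s)" using adj_alt by metis
      then have "m s t = 2" using 1 m_sym[of s t] by auto
      moreover have "length x + Suc (Suc (length y)) = k" using arg_cong[OF 1(2), of length] by simp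
      ultimately show False using assms(2) by linarith
    qed
    then show ?thesis using au unfolding ceq_def by (metis converse_rtranclpE)
  qed
  assume th: "alt s t k \<simeq> u" "isr a b"
  show "p @ rdx a b @ q \<noteq> u"
  proof
    assume "p @ rdx a b @ q = u"
    then have e: "p @ rdx a b @ q = alt s t k" using single th(1) by simp
    obtain w where w: "rdx a b = a # b # w"
      using lng_ge2[OF th(2)] by (auto simp: numeral_2_eq_2 Suc_le_eq dest!: less_imp_Suc_add)
    then have "(a = s \<and> b = t) \<or> (a = t \<and> b = s)" using adj_alt[of p a b "w @ q"] e by simp
    then have "lng a b = m s t" "3 \<le> m s t" using th(2) assms(1) m_sym[of s t] by (auto simp: lng_def isr_def)
    then show False using assms(2) arg_cong[OF e, of length] by simp
  qed
qed

text \<open>The Temperley--Lieb functionals with parameters \<open>v = 1\<close>, \<open>dl = 2\<close> form a representation of the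
  Coxeter group that separates these words.\<close>

lemma alt_distinct:
  assumes st: "s \<noteq> t" "m s t = 0 \<or> k < m s t" and xy: "{x, y} = {s, t}" "m s t = 0 \<or> j < m s t"
    and e: "alt s t k \<approx> alt x y j"
  shows "alt s t k = alt x y j"
proof -
  interpret I: tlv m "2::int" 1 1 by unfold_locales auto
  have xy': "x \<noteq> y" "m x y = 0 \<or> j < m x y" using xy st(1) m_sym[of s t] by (auto simp: doubleton_eq_iff)
  \<comment> \<open>At \<open>v = 1\<close> the quadratic relation says that the generators act as
    involutions.\<close>
  have inv: "I.tau (I.tau f s) s = f" if "I.tlfun f" for f s
    using I.tau_quad[OF that] by simp
  have fwd: "foldl I.tau (foldl I.tau f u) (rev u) = f" if "I.tlfun f" for f u
    using that
  proof (induction u arbitrary: f)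
    case (Cons a u)
    then show ?case using Cons.IH[OF I.tlfun_tau[OF Cons.prems]] inv[OF Cons.prems] by simp
  qed simp
  have rel: "foldl I.tau f (alt a b (2 * m a b)) = f" if f: "I.tlfun f" and m0: "m a b \<noteq> 0" for f a b
  proof -
    let ?n = "m a b"
    have "alt a b (2 * ?n) = alt a b ?n @ rev (alt b a ?n)"
      using alt_append[of a b ?n ?n] by (simp add: rev_alt mult_2)
    then show ?thesis using I.tau_braid[OF f m0] fwd[OF f] by simp
  qed
  have inva: "foldl I.tau f u = foldl I.tau f w" if f: "I.tlfun f" and uw: "u \<approx> w" for f u w
    using uw unfolding cox_eq_def
  proof (induction rule: equivclp_induct)
    case (step y z)
    have "foldl I.tau f a = foldl I.tau f b" if ab: "cox_step m a b" for a b
    proof -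
      obtain x w s t where "m s t \<noteq> 0" "a = x @ alt s t (2 * m s t) @ w" "b = x @ w"
        using ab by (auto simp: cox_step_def alt_concat)
      then show ?thesis using rel[OF I.tlfun_foldl[OF f]] by simp
    qed
    then show ?case using step by metis
  qed simp
  have ir: "I.irr (alt s t k)" "I.irr (alt x y j)"
    unfolding I.irr_def using alt_irr(1)[OF st] alt_irr(1)[OF xy'] by blast+
  show ?thesis
  \<comment> \<open>The functional of the longer word is used, because \<open>foldl_tau_N\<close>
    covers only words no longer than the one defining the functional.\<close>
  proof (cases "j \<le> k")
    case True
    have "foldl I.tau (I.N (alt s t k)) (alt s t k) [] = foldl I.tau (I.N (alt s t k)) (alt x y j) []"
      using inva[OF I.tlfun_N e] by simp
    then have "alt x y j \<simeq> alt s t k"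
      using I.foldl_tau_N[OF ir(1), of "alt s t k"] I.foldl_tau_N[OF ir(2), of "alt s t k"] True
      by (simp split: if_splits)
    then show ?thesis using alt_irr(2)[OF xy', of "alt s t k"] ceq_sym by simp
  next
    case False
    have "foldl I.tau (I.N (alt x y j)) (alt s t k) [] = foldl I.tau (I.N (alt x y j)) (alt x y j) []"
      using inva[OF I.tlfun_N e] by simp
    then have "alt s t k \<simeq> alt x y j"
      using I.foldl_tau_N[OF ir(1), of "alt x y j"] I.foldl_tau_N[OF ir(2), of "alt x y j"] False
      by (simp split: if_splits)
    then show ?thesis using alt_irr(2)[OF st, of "alt x y j"] ceq_sym by simp
  qed
qed

lemma alt_reduce:
  assumes "set u \<subseteq> {s, t}"
  shows "\<exists>j x y. {x, y} = {s, t} \<and> u \<approx> alt x y j \<and> j \<le> length u"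
  using assms
proof (induction u)
  case Nil
  then show ?case by (intro exI[of _ 0] exI[of _ s] exI[of _ t]) auto
next
  case (Cons a u)
  then obtain j x y where h: "{x, y} = {s, t}" "u \<approx> alt x y j" "j \<le> length u" by auto
  have yx: "{y, x} = {s, t}" using h(1) by (metis insert_commute)
  have au: "a # u \<approx> a # alt x y j" using weq_append[OF weq_refl h(2), of "[a]"] by simp
  have "a \<in> {x, y}" using Cons.prems h by auto
  then consider "j = 0" | i where "a = x" "j = Suc i" | "a = y" by (cases j) auto
  then show ?case
  proof cases
    case 1
    obtain b where "{a, b} = {s, t}" using \<open>a \<in> {x, y}\<close> h(1) by (metis insert_commute insertE singletonD)
    then show ?thesis using au 1 by (intro exI[of _ 1] exI[of _ a] exI[of _ b]) auto
  next
    case 2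
    have "a # alt x y j \<approx> alt y x i"
      using weq_append[OF weq_ss weq_refl, of x "alt y x i"] 2 by simp
    then have "a # u \<approx> alt y x i" using au weq_trans by blast
    then show ?thesis using h(3) yx 2 by (intro exI[of _ i] exI[of _ y] exI[of _ x]) simp
  next
    case 3
    then show ?thesis using h(3) yx au by (intro exI[of _ "Suc j"] exI[of _ y] exI[of _ x]) simp
  qed
qed

text \<open>Below \<open>m s t\<close>, deletion and \<open>alt_reduce\<close> would give a shorter
  alternating word for the same element, against \<open>alt_distinct\<close>. At length
  \<open>m s t\<close> the last letter is first moved to the other side, so that only words shorter
  than \<open>m s t\<close> are compared.\<close>

lemma alt_red:
  assumes "s \<noteq> t" "m s t = 0 \<or> k \<le> m s t" shows "red (alt s t k)"
proof (rule ccontr)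
  have small: "red (alt s t k)" if st: "s \<noteq> t" "m s t = 0 \<or> k < m s t" for s t k
  proof (rule ccontr)
    assume "\<not> red (alt s t k)"
    then obtain w where w: "alt s t k \<approx> w" "set w \<subseteq> set (alt s t k)" "length w + 2 = k"
      using deletion[of "alt s t k"] by auto
    then obtain j x y where h: "{x, y} = {s, t}" "w \<approx> alt x y j" "j \<le> length w"
      using alt_reduce[OF order_trans[OF w(2) set_alt_subset]] by blast
    have "alt s t k = alt x y j"
    proof (rule alt_distinct[OF st h(1)])
      show "m s t = 0 \<or> j < m s t" using st(2) h(3) w(3) by linarith
      show "alt s t k \<approx> alt x y j" using w(1) h(2) by (rule weq_trans)
    qed
    then have "k = j" using length_alt by metis
    then show False using h(3) w(3) by simp
  qed
  assume n: "\<not> red (alt s t k)"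
  then have k: "k = m s t" "m s t \<noteq> 0" using small[OF assms(1), of k] assms(2) by fastforce+
  then obtain l where l: "k = Suc l" by (metis not0_implies_Suc)
  obtain w where w: "alt s t k \<approx> w" "set w \<subseteq> set (alt s t k)" "length w + 2 = k" using deletion[OF n] by auto
  then obtain j x y where h: "{x, y} = {s, t}" "w \<approx> alt x y j" "j \<le> length w"
    using alt_reduce[OF order_trans[OF w(2) set_alt_subset]] by blast
  define z where "z = (if even l then s else t)"
  have "alt s t l @ [z] \<approx> alt x y j" using w(1) h(2) weq_trans l alt_snoc[of s t l] by (auto simp: z_def simp del: alt.simps)
  then have e: "alt s t l \<approx> alt x y j @ [z]" using weq_moveR by blast
  have zxy: "z \<in> {x, y}" using h(1) by (auto simp: z_def)
  have xy: "x \<noteq> y" using h(1) assms(1) by auto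
  have lk: "l < m s t" using k l by simp
  show False
  proof (cases "z = (if even j then x else y)")
    case True
    then have "alt x y j @ [z] = alt x y (Suc j)" using alt_snoc[of x y j] by (simp del: alt.simps)
    then have "alt s t l = alt x y (Suc j)"
      using alt_distinct[OF assms(1) _ h(1), of l "Suc j"] e lk h(3) w(3) k by simp
    then have eq: "alt s t l = alt x y j @ [z]" using \<open>alt x y j @ [z] = alt x y (Suc j)\<close> by simp
    then obtain l' where l': "l = Suc l'" by (cases l) auto
    then have "alt s t l = alt s t l' @ [if even l' then s else t]" using alt_snoc[of s t l'] by simp
    then show False using eq l' assms(1) by (auto simp: z_def split: if_splits)
  next
    case False
    show False
    proof (cases j)
      case 0
      then have zy: "z = y" using False zxy by simp
      have yx: "{y, x} = {s, t}" using h(1) by (metis insert_commute)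
      have "alt s t l \<approx> alt y x 1" using e 0 zy by simp
      then have "alt s t l = alt y x 1"
        using alt_distinct[OF assms(1) _ yx, of l 1] lk k(1) w(3) by simp
      then have el: "alt s t l = [z]" using zy by simp
      then have "l = 1" by (metis length_alt length_Cons list.size(3) One_nat_def)
      then show ?thesis using el assms(1) by (simp add: z_def)
    next
      case (Suc i)
      have "z = (if even i then x else y)" using False zxy Suc by (simp, metis)
      then have "alt x y j = alt x y i @ [z]" using alt_snoc[of x y i] Suc by (simp del: alt.simps)
      have "alt x y i \<approx> alt x y j @ [z]" using weq_insert(1)[of "alt x y i" "[]" "[z]"] \<open>alt x y j = alt x y i @ [z]\<close> by simp
      then have "alt s t l \<approx> alt x y i" using e weq_sym weq_trans by blast
      then have "alt s t l = alt x y i"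
        using alt_distinct[OF assms(1) _ h(1), of l i] lk h(3) w(3) k Suc by simp
      then have "l = i" using length_alt by metis
      then show False using h(3) w(3) l Suc by simp
    qed
  qed
qed

lemma ln_alt: "s \<noteq> t \<Longrightarrow> m s t = 0 \<or> k \<le> m s t \<Longrightarrow> ln (alt s t k) = k"
  using alt_red[of s t k] by (simp add: red_def)

lemma red_cong: "u \<approx> v \<Longrightarrow> length u = length v \<Longrightarrow> red u \<longleftrightarrow> red v"
  using ln_cong by (simp add: red_def)

text \<open>The alternating tail grows at its right end, whose next letter is a descent. Exchange
  deletes a letter of \<open>x\<close>, which yields the longer tail, or one of the tail, which
  cannot happen because the lengthened tail is reduced.\<close>

lemma two_descents_step:
  assumes u: "red u" and d: "ln (u @ [s]) < ln u" "ln (u @ [t]) < ln u" and st: "s \<noteq> t"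
    and k: "m s t = 0 \<or> k \<le> m s t"
  shows "\<exists>x a b. {a, b} = {s, t} \<and> u \<approx> x @ alt a b k \<and> length x + k = length u"
  using k
proof (induction k)
  case 0
  show ?case by (intro exI[of _ u] exI[of _ s] exI[of _ t]) auto
next
  case (Suc k)
  then obtain x a b where h: "{a, b} = {s, t}" "u \<approx> x @ alt a b k" "length x + k = length u" by auto
  define z where "z = (if even k then a else b)"
  have ab: "a \<noteq> b" "m a b = m s t" using h(1) st m_sym[of s t] by (auto simp: doubleton_eq_iff)
  have zs: "z = s \<or> z = t" using h(1) by (auto simp: z_def)
  have rx: "red (x @ alt a b k)" using red_cong[OF h(2)] u h(3) by simp
  have yz: "alt a b k @ [z] = alt a b (Suc k)" using alt_snoc[of a b k] by (simp add: z_def del: alt.simps)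
  have "ln ((x @ alt a b k) @ [z]) < ln (x @ alt a b k)"
    using d zs ln_cong[OF h(2)] ln_cong[OF weq_append[OF h(2) weq_refl], of "[z]"] by auto
  then obtain p c q where pq: "x @ alt a b k = p @ [c] @ q" "(x @ alt a b k) @ [z] \<approx> p @ q" using exchange by blast
  from pq(1) consider x2 where "x = p @ [c] @ x2" "q = x2 @ alt a b k" | y1 where "p = x @ y1" "alt a b k = y1 @ [c] @ q"
    by (auto simp: append_eq_append_conv2 append_eq_Cons_conv Cons_eq_append_conv)
  then show ?case
  proof cases
    case 1
    have "x @ alt a b k \<approx> (p @ x2 @ alt a b k) @ [z]" using pq(2) 1 unfolding weq_moveR by simp
    then have "u \<approx> (p @ x2) @ alt a b (Suc k)" using h(2) weq_trans yz by (metis append.assoc)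
    moreover have "length (p @ x2) + Suc k = length u" using 1 h(3) by simp
    ultimately show ?thesis using h(1) by blast
  next
    case 2
    have "x @ alt a b (Suc k) \<approx> x @ y1 @ q" using pq(2) 2 yz by (simp del: alt.simps)
    then have "alt a b (Suc k) \<approx> y1 @ q" using weq_cancelL by blast
    then have "ln (alt a b (Suc k)) \<le> length (y1 @ q)" using ln_le by blast
    moreover have "length (y1 @ q) < k" using arg_cong[OF 2(2), of length] by simp
    moreover have "ln (alt a b (Suc k)) = Suc k" using ln_alt[OF ab(1)] Suc.prems ab(2) by metis
    ultimately show ?thesis by simp
  qed
qed

lemma two_descents:
  assumes u: "red u" and d: "ln (u @ [s]) < ln u" "ln (u @ [t]) < ln u" and st: "s \<noteq> t"
  shows "m s t \<noteq> 0" and "\<exists>x. u \<approx> x @ alt s t (m s t) \<and> length x + m s t = length u"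
proof -
  show 0: "m s t \<noteq> 0"
  proof
    assume "m s t = 0"
    \<comment> \<open>If the order were infinite, the tail could be made longer than
      \<open>u\<close>.\<close>
    then show False using two_descents_step[OF u d st, of "Suc (length u)"] by auto
  qed
  obtain x a b where h: "{a, b} = {s, t}" "u \<approx> x @ alt a b (m s t)" "length x + m s t = length u"
    using two_descents_step[OF u d st, of "m s t"] by auto
  have "alt a b (m s t) \<approx> alt s t (m s t)"
  proof (cases "a = s \<and> b = t")
    case False
    then have "a = t \<and> b = s" using h(1) by (auto simp: doubleton_eq_iff)
    then show ?thesis using weq_braid[OF 0] weq_sym by simp
  qed auto
  then have "u \<approx> x @ alt s t (m s t)" using h(2) weq_cancelL weq_trans by blast
  then show "\<exists>x. u \<approx> x @ alt s t (m s t) \<and> length x + m s t = length u" using h(3) by blast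
qed

text \<open>If the last letters \<open>s\<close> and \<open>t\<close> differ, both are descents and
  the element also has reduced words ending in the two alternating words of length
  \<open>m s t\<close>. These differ by one braid move and end in \<open>s\<close> and
  \<open>t\<close>, so the induction hypothesis links each to one of the given words. Letting
  \<open>F\<close> vary allows a fixed last letter to be absorbed into it.\<close>

lemma matsumoto:
  assumes "\<And>p s t q. m s t \<noteq> 0 \<Longrightarrow> F (p @ alt s t (m s t) @ q) = F (p @ alt t s (m s t) @ q)"
    and "red u" "red v" "u \<approx> v"
  shows "F u = F v"
  using assms
proof (induction "length u" arbitrary: u v F)
  case 0
  then show ?case using ln_cong[of u v] by (simp add: red_def)
next
  case (Suc n)
  have lv: "length v = Suc n" using Suc.hyps(2) Suc.prems ln_cong[of u v] by (simp add: red_def)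
  obtain u' s where u: "u = u' @ [s]" using Suc.hyps(2) by (cases u rule: rev_cases) auto
  obtain v' t where v: "v = v' @ [t]" using lv by (cases v rule: rev_cases) auto
  have ru: "red u'" "red v'" using Suc.prems(2,3) red_append(1)[of u' "[s]"] red_append(1)[of v' "[t]"] u v by simp_all
  have F': "F ((p @ alt s t (m s t) @ q) @ [a]) = F ((p @ alt t s (m s t) @ q) @ [a])" if "m s t \<noteq> 0" for p s t q a
    using Suc.prems(1)[OF that, of p "q @ [a]"] by simp
  have IH: "F (x @ [a]) = F (y @ [a])" if "red x" "red y" "x \<approx> y" "length x = n" for x y a
    using Suc.hyps(1)[of x "\<lambda>w. F (w @ [a])" y] that F' by metis
  show ?case
  proof (cases "s = t")
    case True
    then have "u' \<approx> v'" using Suc.prems(4) u v weq_cancelR by simp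
    then show ?thesis using IH[of u' v' s] ru u v True Suc.hyps(2) by simp
  next
    case False
    have desc: "ln (u @ [a]) < ln u" if "u \<approx> w @ [a]" "red w" "length w = n" for w a
    proof -
      have "u @ [a] \<approx> w" using that(1) weq_moveR by blast
      then have "ln (u @ [a]) \<le> n" using ln_le that(3) by blast
      then show ?thesis using Suc.hyps(2) Suc.prems(2) by (simp add: red_def)
    qed
    have ds: "ln (u @ [s]) < ln u" using desc[of u' s] u ru Suc.hyps(2) by simp
    have dt: "ln (u @ [t]) < ln u" using desc[of v' t] Suc.prems(4) v ru lv by simp
    from two_descents[OF Suc.prems(2) ds dt False] obtain x where m0: "m s t \<noteq> 0"
      and x: "u \<approx> x @ alt s t (m s t)" "length x + m s t = length u" by blast
    obtain l where l: "m s t = Suc l" using m0 by (cases "m s t") auto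
    define z z' where "z = (if even l then s else t)" and "z' = (if even l then t else s)"
    have 1: "alt s t (m s t) = alt s t l @ [z]" "alt t s (m s t) = alt t s l @ [z']"
      unfolding l alt_snoc z_def z'_def by auto
    have x': "u \<approx> x @ alt t s (m s t)" using x(1) weq_cancelL weq_braid[OF m0] weq_trans by blast
    have R: "red (x @ alt s t l @ [z])" "red (x @ alt t s l @ [z'])"
    proof -
      have "red (x @ alt s t (m s t))" "red (x @ alt t s (m s t))"
        using red_cong[OF x(1)] red_cong[OF x'] x(2) Suc.prems(2) by simp_all
      then show "red (x @ alt s t l @ [z])" "red (x @ alt t s l @ [z'])" unfolding 1 .
    qed
    have R': "red (x @ alt s t l)" "red (x @ alt t s l)" using red_append(1)[of "x @ alt s t l"] red_append(1)[of "x @ alt t s l"] R by auto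
    have L: "length (x @ alt s t l) = n" "length (x @ alt t s l) = n" using x(2) l Suc.hyps(2) by auto
    have B: "F (x @ alt s t l @ [z]) = F (x @ alt t s l @ [z'])"
      using Suc.prems(1)[OF m0, of x "[]"] 1 by simp
    have eu: "F (w @ [a]) = F (y @ [a])" if "u \<approx> w @ [a]" "u \<approx> y @ [a]" "red w" "red y" "length w = n" for w y a
    proof -
      have "w \<approx> y" using that(1,2) weq_sym weq_trans weq_cancelR by blast
      then show ?thesis using IH that by blast
    qed
    have X: "u \<approx> (x @ alt s t l) @ [z]" "u \<approx> (x @ alt t s l) @ [z']" using x(1) x' 1 by simp_all
    have U: "u \<approx> u' @ [s]" "u \<approx> v' @ [t]" using u v Suc.prems(4) by simp_all
    have ln': "length u' = n" using u Suc.hyps(2) by simp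
    show ?thesis
    proof (cases "even l")
      case True
      then have "z = s" "z' = t" by (auto simp: z_def z'_def)
      then show ?thesis using eu[OF U(1) _ ru(1) R'(1) ln'] eu[OF X(2) _ R'(2) ru(2) L(2)] X U B u v by simp
    next
      case False
      then have "z = t" "z' = s" by (auto simp: z_def z'_def)
      then show ?thesis using eu[OF U(1) _ ru(1) R'(2) ln'] eu[OF X(1) _ R'(1) ru(2) L(1)] X U B u v by simp
    qed
  qed
qed

section \<open>From words to elements of W, and the Bruhat order\<close>

lemma wrep_weq: "wrep (welt m u) \<approx> u"
proof -
  have "wrep (welt m u) \<in> welt m u" unfolding wrep_def by (rule someI[of _ u]) (simp add: welt_def)
  then show ?thesis using weq_sym by (simp add: welt_def)
qed

lemma wmul_welt: "wmul m (welt m u) (welt m v) = welt m (u @ v)"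
  unfolding wmul_def welt_eq_iff by (intro weq_append wrep_weq)

lemma winv_welt: "winv m (welt m u) = welt m (rev u)"
  unfolding winv_def welt_eq_iff by (intro weq_rev_cong wrep_weq)

lemma welt_in [simp]: "welt m u \<in> Wgrp m" by (simp add: Wgrp_def)

lemma Wgrp_cases: assumes "y \<in> Wgrp m" obtains u where "y = welt m u" "red u"
  using assms red_ex unfolding Wgrp_def by (metis imageE welt_eq_iff)

lemma reduced_words_welt: "reduced_words (welt m u) = {v. u \<approx> v \<and> red v}"
  unfolding reduced_words_def red_def using ln_cong by (auto simp: welt_def)

definition bstep :: "'i list set \<Rightarrow> 'i list set \<Rightarrow> bool" where
  "bstep y z \<longleftrightarrow> y \<in> Wgrp m \<and> (\<exists>t\<in>reflections m. z = wmul m y t \<and> wlen y < wlen z)"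

lemma bruhat_le_iff: "bruhat_le m x w \<longleftrightarrow> x \<in> Wgrp m \<and> w \<in> Wgrp m \<and> bstep\<^sup>*\<^sup>* x w"
  unfolding bruhat_le_def bstep_def ..

lemma bstep_welt: "bstep (welt m u) z \<longleftrightarrow> (\<exists>r. isrefl r \<and> z = welt m (u @ r) \<and> ln u < wlen z)"
proof
  assume "bstep (welt m u) z"
  then obtain x s where "z = wmul m (welt m u) (welt m (x @ [s] @ rev x))" "ln u < wlen z"
    by (auto simp: bstep_def reflections_def)
  then show "\<exists>r. isrefl r \<and> z = welt m (u @ r) \<and> ln u < wlen z"
    unfolding wmul_welt isrefl_def using weq_refl by blast
next
  assume "\<exists>r. isrefl r \<and> z = welt m (u @ r) \<and> ln u < wlen z"
  then obtain r x s where r: "r \<approx> x @ [s] @ rev x" "z = welt m (u @ r)" "ln u < wlen z" by (auto simp: isrefl_def)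
  have "z = wmul m (welt m u) (welt m (x @ [s] @ rev x))"
    unfolding wmul_welt r(2) welt_eq_iff using r(1) weq_cancelL by blast
  moreover have "welt m (x @ [s] @ rev x) \<in> reflections m" unfolding reflections_def by blast
  ultimately show "bstep (welt m u) z" unfolding bstep_def using r(3) welt_in by blast
qed

lemma bstep_in: "bstep y z \<Longrightarrow> y \<in> Wgrp m" "bstep y z \<Longrightarrow> z \<in> Wgrp m"
  by (auto simp: bstep_def wmul_def)

lemma bstep_len: "bstep y z \<Longrightarrow> wlen y < wlen z" by (auto simp: bstep_def)

lemma bsteps_len: "bstep\<^sup>*\<^sup>* y z \<Longrightarrow> y = z \<or> wlen y < wlen z"
  by (induction rule: rtranclp_induct) (auto dest: bstep_len)

lemma bruhat_refl: "x \<in> Wgrp m \<Longrightarrow> bruhat_le m x x"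
  by (simp add: bruhat_le_iff)

lemma bruhat_trans: "bruhat_le m x y \<Longrightarrow> bruhat_le m y z \<Longrightarrow> bruhat_le m x z"
  by (auto simp: bruhat_le_iff)

lemma bruhat_in: "bruhat_le m x y \<Longrightarrow> x \<in> Wgrp m" "bruhat_le m x y \<Longrightarrow> y \<in> Wgrp m"
  by (auto simp: bruhat_le_iff)

lemma bruhat_len: "bruhat_le m x y \<Longrightarrow> x = y \<or> wlen x < wlen y"
  using bsteps_len by (auto simp: bruhat_le_iff)

lemma bruhat_lt_len: "bruhat_lt m x y \<Longrightarrow> wlen x < wlen y"
  using bruhat_len by (auto simp: bruhat_lt_def)

lemma bruhat_lt_le_trans: "bruhat_lt m x y \<Longrightarrow> bruhat_le m y z \<Longrightarrow> bruhat_lt m x z"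
  unfolding bruhat_lt_def using bruhat_trans bruhat_len by (metis less_asym less_irrefl)

text \<open>By strong exchange every predecessor arises by deleting a single letter from one fixed
  word for \<open>w\<close>.\<close>

lemma finite_pred: "finite {y. bstep y w}"
proof (cases "w \<in> Wgrp m")
  case True
  then obtain u where u: "w = welt m u" by (auto simp: Wgrp_def)
  have "{y. bstep y w} \<subseteq> (\<lambda>i. welt m (take i u @ drop (Suc i) u)) ` {..<length u}"
  proof
    fix y assume "y \<in> {y. bstep y w}"
    then have b: "bstep y w" by simp
    then obtain x where x: "y = welt m x" using bstep_in by (auto simp: Wgrp_def)
    then obtain r where r: "isrefl r" "welt m u = welt m (x @ r)" "ln x < ln u" using b u bstep_welt by auto
    have "u @ r \<approx> (x @ r) @ r" using r(2) welt_eq_iff weq_append weq_refl by blast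
    also have "(x @ r) @ r \<approx> x" using weq_append[OF weq_refl isrefl_sq(1)[OF r(1)], of x] by simp
    finally have ux: "u @ r \<approx> x" .
    then have "ln (u @ r) < ln u" using r(3) ln_cong by simp
    then obtain a s b where ab: "u = a @ [s] @ b" "u @ r \<approx> a @ b" using strong_exchange[OF r(1)] by blast
    have "y = welt m (a @ b)" unfolding x welt_eq_iff using ux ab(2) weq_sym weq_trans by blast
    then show "y \<in> (\<lambda>i. welt m (take i u @ drop (Suc i) u)) ` {..<length u}"
      by (intro image_eqI[of _ _ "length a"]) (use ab in auto)
  qed
  then show ?thesis using finite_subset by blast
next
  case False
  then have "{y. bstep y w} = {}" using bstep_in by blast
  then show ?thesis by simp
qed

lemma finite_lower: "finite {x. bruhat_le m x w}"
proof (induction "wlen w" arbitrary: w rule: less_induct)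
  case less
  have "{x. bruhat_le m x w} \<subseteq> {w} \<union> (\<Union>y\<in>{y. bstep y w}. {x. bruhat_le m x y})"
  proof
    fix x assume "x \<in> {x. bruhat_le m x w}"
    then have h: "x \<in> Wgrp m" "bstep\<^sup>*\<^sup>* x w" by (auto simp: bruhat_le_iff)
    from h(2) show "x \<in> {w} \<union> (\<Union>y\<in>{y. bstep y w}. {x. bruhat_le m x y})"
    proof (cases rule: rtranclp.cases)
      case (rtrancl_into_rtrancl b)
      then show ?thesis using h(1) bstep_in by (auto simp: bruhat_le_iff)
    qed auto
  qed
  moreover have "finite (\<Union>y\<in>{y. bstep y w}. {x. bruhat_le m x y})"
    using finite_pred less bstep_len by blast
  ultimately show ?case using finite_subset by blast
qed

lemma bstep_snoc: assumes "ln u < ln (u @ [s])" shows "bstep (welt m u) (welt m (u @ [s]))"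
  unfolding bstep_welt using assms isrefl_single by blast

text \<open>The lifting property. The case to settle is \<open>y s\<close> longer than both
  \<open>y\<close> and \<open>z s\<close>: strong exchange deletes a letter from a reduced word of
  \<open>y s\<close>. If it is the last one, then \<open>y s = z\<close>; otherwise \<open>z\<close>
  would be shorter than \<open>y\<close>.\<close>

lemma bstep_lift:
  assumes "bstep (welt m y) (welt m z)"
  shows "bruhat_le m (welt m (y @ [s])) (welt m z) \<or> bruhat_le m (welt m (y @ [s])) (welt m (z @ [s]))"
proof -
  obtain r where r: "isrefl r" "z \<approx> y @ r" "ln y < ln z" using assms bstep_welt welt_eq_iff by auto
  show ?thesis
  proof (cases "ln (y @ [s]) < ln y")
    case True
    have "ln (y @ [s]) < ln ((y @ [s]) @ [s])"
      using True ln_cong[OF weq_insert(1)[of y "[]" "[s]"]] by simp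
    then have "bstep (welt m (y @ [s])) (welt m ((y @ [s]) @ [s]))" by (rule bstep_snoc)
    moreover have "welt m ((y @ [s]) @ [s]) = welt m y"
      unfolding welt_eq_iff using weq_insert(1)[of y "[]" "[s]"] weq_sym by simp
    ultimately have "bstep\<^sup>*\<^sup>* (welt m (y @ [s])) (welt m z)" using assms by (metis converse_rtranclp_into_rtranclp r_into_rtranclp)
    then show ?thesis by (simp add: bruhat_le_iff)
  next
    case False
    then have l: "ln (y @ [s]) = Suc (ln y)" using ln_snoc[of y s] by auto
    define r' where "r' = [s] @ r @ rev [s]"
    have r': "isrefl r'" unfolding r'_def by (rule isrefl_conj[OF r(1)])
    have "y @ r @ [s] \<approx> y @ [s] @ [s] @ r @ [s]" using weq_insert(1)[of y "r @ [s]" "[s]"] by simp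
    then have zs: "z @ [s] \<approx> (y @ [s]) @ r'"
      using weq_append[OF r(2) weq_refl, of "[s]"] weq_trans by (auto simp: r'_def)
    show ?thesis
    proof (cases "ln (y @ [s]) < ln (z @ [s])")
      case True
      then have "bstep (welt m (y @ [s])) (welt m (z @ [s]))"
        unfolding bstep_welt using r' zs welt_eq_iff by blast
      then show ?thesis by (auto simp: bruhat_le_iff)
    next
      case False
      obtain v where v: "y \<approx> v" "red v" using red_ex by blast
      have vs: "y @ [s] \<approx> v @ [s]" using v(1) weq_cancelR by blast
      have e: "(v @ [s]) @ r' \<approx> z @ [s]" using zs weq_append[OF vs weq_refl, of r'] weq_sym weq_trans by blast
      have "even (ln (z @ [s])) \<noteq> even (ln (y @ [s]))"
      proof -
        obtain x c where "r' \<approx> x @ [c] @ rev x" using r' by (auto simp: isrefl_def)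
        then have "odd (length r')" using weq_parity by fastforce
        then show ?thesis using weq_parity[OF zs] unfolding ln_parity by simp
      qed
      then have "ln (z @ [s]) < ln (y @ [s])" using False by (cases "ln (z @ [s]) = ln (y @ [s])") auto
      then have "ln ((v @ [s]) @ r') < ln (v @ [s])" using ln_cong[OF e] ln_cong[OF vs] by simp
      then obtain a c b where ab: "v @ [s] = a @ [c] @ b" "(v @ [s]) @ r' \<approx> a @ b" using strong_exchange[OF r'] by blast
      have zab: "z @ [s] \<approx> a @ b" using e ab(2) weq_sym weq_trans by blast
      show ?thesis
      proof (cases b rule: rev_cases)
        case Nil
        then have "z @ [s] \<approx> v" using zab ab(1) by simp
        then have "z @ [s] \<approx> y" using v(1) weq_sym weq_trans by blast
        then have "welt m (y @ [s]) = welt m z" unfolding welt_eq_iff weq_moveR[of z] by (rule weq_sym)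
        then show ?thesis using bruhat_refl by simp
      next
        case (snoc b' d)
        then have "v = a @ [c] @ b'" "z @ [s] \<approx> (a @ b') @ [s]" using ab(1) zab by auto
        then have "z \<approx> a @ b'" "length (a @ b') < length v" using weq_cancelR[of z "[s]" "a @ b'"] by auto
        then have "ln z < ln y" using ln_le[of z "a @ b'"] ln_cong[OF v(1)] v(2) by (simp add: red_def)
        then show ?thesis using r(3) by simp
      qed
    qed
  qed
qed

lemma bruhat_lift:
  assumes "bruhat_le m (welt m x) (welt m w)"
  shows "bruhat_le m (welt m (x @ [s])) (welt m w) \<or> bruhat_le m (welt m (x @ [s])) (welt m (w @ [s]))"
proof -
  have "bruhat_le m (welt m (x @ [s])) z \<or> bruhat_le m (welt m (x @ [s])) (wmul m z (gen m s))"
    if "bstep\<^sup>*\<^sup>* (welt m x) z" for z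
    using that
  proof (induction rule: rtranclp_induct)
    case base
    then show ?case by (simp add: gen_def wmul_welt bruhat_refl)
  next
    case (step y z)
    obtain y' where y': "y = welt m y'" using bstep_in(1)[OF step(2)] by (auto simp: Wgrp_def)
    obtain z' where z': "z = welt m z'" using bstep_in(2)[OF step(2)] by (auto simp: Wgrp_def)
    have yz: "bruhat_le m y z" using step(2) y' z' by (auto simp: bruhat_le_iff)
    from step.IH show ?case
    proof
      assume "bruhat_le m (welt m (x @ [s])) y"
      then show ?thesis using yz bruhat_trans by blast
    next
      assume h: "bruhat_le m (welt m (x @ [s])) (wmul m y (gen m s))"
      then show ?thesis using bstep_lift[of y' z' s] step(2) bruhat_trans
        unfolding y' z' gen_def wmul_welt by blast
    qed
  qed
  from this[of "welt m w"] show ?thesis using assms by (simp add: gen_def wmul_welt bruhat_le_iff)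
qed

lemma bruhat_lift_up:
  assumes "bruhat_le m (welt m x) (welt m w)" "ln w < ln (w @ [s])"
  shows "bruhat_le m (welt m (x @ [s])) (welt m (w @ [s]))"
proof -
  have "bruhat_le m (welt m w) (welt m (w @ [s]))" using bstep_snoc[OF assms(2)] by (auto simp: bruhat_le_iff)
  then show ?thesis using bruhat_lift[OF assms(1)] bruhat_trans by blast
qed

end

section \<open>Hecke modules\<close>

context coxeter begin

abbreviation HS :: "('i list set \<Rightarrow> int fls) set" where "HS \<equiv> hecke_space m"

lemma HS_zero: "(\<lambda>_. 0) \<in> HS" by (simp add: hecke_space_def)

lemma HS_comb: assumes "f \<in> HS" "g \<in> HS" shows "(\<lambda>y. c * f y + d * g y) \<in> HS"
proof -
  have "{w. c * f w + d * g w \<noteq> 0} \<subseteq> {w. f w \<noteq> 0} \<union> {w. g w \<noteq> 0}" by auto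
  moreover have "finite ({w. f w \<noteq> 0} \<union> {w. g w \<noteq> 0})" using assms by (simp add: hecke_space_def)
  ultimately have "finite {w. c * f w + d * g w \<noteq> 0}" by (rule finite_subset)
  moreover have "f w = 0 \<and> g w = 0" if "w \<notin> Wgrp m" for w using assms that unfolding hecke_space_def by blast
  then have "\<forall>w. c * f w + d * g w \<noteq> 0 \<longrightarrow> w \<in> Wgrp m" by (metis add_0 mult_zero_right)
  ultimately show ?thesis unfolding hecke_space_def by simp
qed

lemma HS_add: "f \<in> HS \<Longrightarrow> g \<in> HS \<Longrightarrow> (\<lambda>y. f y + c * g y) \<in> HS"
  using HS_comb[of f g 1 c] by simp

lemma HS_hT: "w \<in> Wgrp m \<Longrightarrow> hT w \<in> HS"
  by (auto simp: hecke_space_def hT_def)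

lemma HS_finite: "h \<in> HS \<Longrightarrow> finite {w. h w \<noteq> 0}"
  and HS_out: "h \<in> HS \<Longrightarrow> w \<notin> Wgrp m \<Longrightarrow> h w = 0"
  by (auto simp: hecke_space_def)

lemma HS_I: "finite A \<Longrightarrow> A \<subseteq> Wgrp m \<Longrightarrow> (\<And>w. w \<notin> A \<Longrightarrow> h w = 0) \<Longrightarrow> h \<in> HS"
  unfolding hecke_space_def by (smt (verit) finite_subset mem_Collect_eq subset_iff)

text \<open>The predicate \<open>Q\<close> on coefficients lets the same induction stay among
  elements whose coefficients are Laurent polynomials.\<close>

lemma HS_induct_coeffs [consumes 2, case_names zero add]:
  assumes "h \<in> HS" "\<And>w. Q (h w)" and Q0: "Q 0" and 0: "P (\<lambda>_. 0)"
    and 1: "\<And>h c w. h \<in> HS \<Longrightarrow> (\<And>w. Q (h w)) \<Longrightarrow> Q c \<Longrightarrow> w \<in> Wgrp m \<Longrightarrow> P h \<Longrightarrow> P (\<lambda>y. h y + c * hT w y)"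
  shows "P h"
proof -
  have "finite A \<Longrightarrow> A \<subseteq> Wgrp m \<Longrightarrow> (\<And>w. w \<notin> A \<Longrightarrow> h w = 0) \<Longrightarrow> (\<And>w. Q (h w)) \<Longrightarrow> P h" for A h
  proof (induction A arbitrary: h rule: finite_induct)
    case empty
    then have "h = (\<lambda>_. 0)" by auto
    then show ?case using 0 by simp
  next
    case (insert w A)
    let ?h = "\<lambda>y. if y = w then 0 else h y"
    have p: "P ?h" by (rule insert.IH) (use insert.prems Q0 in auto)
    have "?h \<in> HS" by (rule HS_I[of A]) (use insert in auto)
    then have "P (\<lambda>y. ?h y + h w * hT w y)"
      using 1[OF _ _ insert.prems(3) _ p] insert.prems Q0 by simp
    moreover have "(\<lambda>y. ?h y + h w * hT w y) = h" by (auto simp: hT_def)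
    ultimately show ?case by simp
  qed
  then show ?thesis
    using assms(1,2) unfolding hecke_space_def by blast
qed

lemmas HS_induct [consumes 1, case_names zero add] =
  HS_induct_coeffs[where Q = "\<lambda>_. True", OF _ TrueI TrueI, simplified]

lemma hTs_welt: "hTs m h s (welt m u) =
   (if ln (u @ [s]) < ln u then h (welt m (u @ [s])) + (fls_X ^ 2 - 1) * h (welt m u) else fls_X ^ 2 * h (welt m (u @ [s])))"
  by (simp add: hTs_def gen_def wmul_welt)

lemma hTs_out: "y \<notin> Wgrp m \<Longrightarrow> hTs m h s y = 0"
  by (simp add: hTs_def)

lemma welt_snoc2: "welt m (u @ [s, s]) = welt m u"
  unfolding welt_eq_iff using weq_insert(1)[of u "[]" "[s]"] weq_sym by simp

lemma welt_Cons2: "welt m (s # s # u) = welt m u"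
  unfolding welt_eq_iff using weq_insert(1)[of "[]" u "[s]"] weq_sym by simp

lemma welt_fun_eqI: assumes "\<And>u. f (welt m u) = g (welt m u)" "\<And>y. y \<notin> Wgrp m \<Longrightarrow> f y = g y" shows "f = g"
proof
  fix y show "f y = g y" using assms by (cases "y \<in> Wgrp m") (auto simp: Wgrp_def)
qed

lemma hTs_lin: "hTs m (\<lambda>y. c * f y + d * g y) s = (\<lambda>y. c * hTs m f s y + d * hTs m g s y)"
  by (rule welt_fun_eqI) (simp_all add: hTs_welt hTs_out algebra_simps)

lemma hTs_HS: assumes "h \<in> HS" shows "hTs m h s \<in> HS"
proof (rule HS_I)
  let ?A = "{w. h w \<noteq> 0}"
  let ?B = "?A \<union> (\<lambda>w. wmul m w (gen m s)) ` ?A"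
  show "finite ?B" using HS_finite[OF assms] by simp
  show "?B \<subseteq> Wgrp m" using HS_out[OF assms] by (auto simp: wmul_def)
  fix w assume w: "w \<notin> ?B"
  show "hTs m h s w = 0"
  proof (cases "w \<in> Wgrp m")
    case True
    then obtain u where u: "w = welt m u" by (auto simp: Wgrp_def)
    have "w = wmul m (welt m (u @ [s])) (gen m s)" by (simp add: u gen_def wmul_welt welt_snoc2)
    then have "h (welt m (u @ [s])) = 0" "h w = 0" using w by auto
    then show ?thesis unfolding u hTs_welt by simp
  qed (simp add: hTs_out)
qed

lemma foldl_hTs_HS: "h \<in> HS \<Longrightarrow> foldl (hTs m) h u \<in> HS"
  by (induction u arbitrary: h) (auto intro: hTs_HS)

lemma hTs_quad: assumes "h \<in> HS"
  shows "hTs m (hTs m h s) s = (\<lambda>y. fls_X ^ 2 * h y + (fls_X ^ 2 - 1) * hTs m h s y)"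
proof (rule welt_fun_eqI)
  fix u
  have "ln (u @ [s]) < ln u \<longleftrightarrow> \<not> ln u < ln (u @ [s])" using ln_snoc[of u s] by auto
  then show "hTs m (hTs m h s) s (welt m u) = fls_X ^ 2 * h (welt m u) + (fls_X ^ 2 - 1) * hTs m h s (welt m u)"
    by (simp add: hTs_welt welt_snoc2 algebra_simps)
qed (simp add: hTs_out HS_out[OF assms])

lemma hTs_hT_up: "ln u < ln (u @ [s]) \<Longrightarrow> hTs m (hT (welt m u)) s = hT (welt m (u @ [s]))"
proof (rule welt_fun_eqI)
  fix w assume l: "ln u < ln (u @ [s])"
  have 1: "w @ [s] \<approx> u \<longleftrightarrow> w \<approx> u @ [s]" by (rule weq_moveR)
  have 2: "ln (w @ [s]) = ln u" "ln w = ln (u @ [s])" if "w \<approx> u @ [s]" using that 1 ln_cong by auto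
  have 3: "ln w = ln u" "ln (w @ [s]) = ln (u @ [s])" if "w \<approx> u"
    using that ln_cong weq_append[OF that weq_refl, of "[s]"] by auto
  show "hTs m (hT (welt m u)) s (welt m w) = hT (welt m (u @ [s])) (welt m w)"
    using 1 2 3 l by (auto simp: hTs_welt hT_def welt_eq_iff) 
next
  fix y assume "y \<notin> Wgrp m"
  then show "hTs m (hT (welt m u)) s y = hT (welt m (u @ [s])) y" by (auto simp: hTs_out hT_def)
qed

lemma foldl_hTs_hT: "red (u @ w) \<Longrightarrow> foldl (hTs m) (hT (welt m u)) w = hT (welt m (u @ w))"
proof (induction w arbitrary: u)
  case (Cons s w)
  have r: "red (u @ [s])" "red u" using Cons.prems red_append(1)[of "u @ [s]" w] red_append(1)[of u "s # w"] by auto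
  then have "ln u < ln (u @ [s])" by (simp add: red_def)
  then show ?case using Cons.IH[of "u @ [s]"] Cons.prems by (simp add: hTs_hT_up)
qed simp

text \<open>Left and right multiplications commute, and every \<open>T_w\<close> is a left translate of \<open>T_1\<close>; this
  reduces the braid relations for right multiplication to their value at \<open>T_1\<close>.\<close>

definition lTs :: "('i list set \<Rightarrow> int fls) \<Rightarrow> 'i \<Rightarrow> 'i list set \<Rightarrow> int fls" where
  "lTs h s = (\<lambda>y. if y \<in> Wgrp m then
      (let sy = wmul m (gen m s) y in
        if wlen sy < wlen y then h sy + (fls_X ^ 2 - 1) * h y else fls_X ^ 2 * h sy)
     else 0)"

lemma lTs_welt: "lTs h s (welt m u) =
   (if ln (s # u) < ln u then h (welt m (s # u)) + (fls_X ^ 2 - 1) * h (welt m u) else fls_X ^ 2 * h (welt m (s # u)))"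
  by (simp add: lTs_def gen_def wmul_welt)

lemma Cons_moveL: "s # w \<approx> u \<longleftrightarrow> w \<approx> s # u"
proof -
  have "s # w \<approx> u \<longleftrightarrow> s # s # w \<approx> s # u" using weq_cancelL[of "[s]" "s # w" u] by simp
  moreover have "s # s # w \<approx> w" using welt_Cons2 welt_eq_iff by blast
  ultimately show ?thesis using weq_iffL by blast
qed

lemma lTs_hT_up: "ln u < ln (s # u) \<Longrightarrow> lTs (hT (welt m u)) s = hT (welt m (s # u))"
proof (rule welt_fun_eqI)
  fix w assume l: "ln u < ln (s # u)"
  have 1: "s # w \<approx> u \<longleftrightarrow> w \<approx> s # u" by (rule Cons_moveL)
  have 2: "ln (s # w) = ln u" "ln w = ln (s # u)" if "w \<approx> s # u" using that 1 ln_cong by auto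
  have 3: "ln w = ln u" "ln (s # w) = ln (s # u)" if "w \<approx> u"
    using that ln_cong weq_append[OF weq_refl that, of "[s]"] by auto
  show "lTs (hT (welt m u)) s (welt m w) = hT (welt m (s # u)) (welt m w)"
    using 1 2 3 l by (auto simp: lTs_welt hT_def welt_eq_iff)
next
  fix y assume "y \<notin> Wgrp m"
  then show "lTs (hT (welt m u)) s y = hT (welt m (s # u)) y" by (auto simp: lTs_def hT_def)
qed

lemma foldl_lTs_hT: "red (rev w @ u) \<Longrightarrow> foldl lTs (hT (welt m u)) w = hT (welt m (rev w @ u))"
proof (induction w arbitrary: u)
  case (Cons s w)
  have r: "red (s # u)" "red u" using Cons.prems red_append(2)[of "rev w" "s # u"] red_append(2)[of "rev w @ [s]" u] by auto
  then have "ln u < ln (s # u)" by (simp add: red_def)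
  then show ?case using Cons.IH[of "s # u"] Cons.prems by (simp add: lTs_hT_up)
qed simp

text \<open>If \<open>s u\<close> and \<open>u t\<close> are both longer than \<open>u\<close>,
  exchange for \<open>s u\<close> and \<open>t\<close> must delete the front letter
  \<open>s\<close>, since a deletion further inside would make \<open>u t\<close> shorter than
  \<open>u\<close>.\<close>

lemma left_right_key:
  assumes "ln (s # u) = ln (u @ [t])" "ln (s # u @ [t]) = ln u"
  shows "s # u \<approx> u @ [t]"
proof -
  have up: "s # u \<approx> u @ [t]" if h: "ln (s # u) = Suc (ln u)" "ln (u @ [t]) = Suc (ln u)" "ln (s # u @ [t]) = ln u" for u
  proof -
    obtain v where v: "u \<approx> v" "red v" using red_ex by blast
    have e: "s # u \<approx> s # v" "u @ [t] \<approx> v @ [t]" "s # u @ [t] \<approx> s # v @ [t]"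
      using v(1) weq_append[OF weq_refl v(1), of "[s]"] weq_append[OF v(1) weq_refl, of "[t]"] weq_ctxt[OF v(1), of "[s]" "[t]"]
      by auto
    have "ln ((s # v) @ [t]) < ln (s # v)" using h ln_cong[OF e(1)] ln_cong[OF e(3)] by simp
    then obtain p c q where pq: "s # v = p @ [c] @ q" "(s # v) @ [t] \<approx> p @ q" using exchange by blast
    show ?thesis
    proof (cases p)
      case Nil
      then have "s # v @ [t] \<approx> v" using pq by simp
      then have "v @ [t] \<approx> s # v" unfolding Cons_moveL .
      then show ?thesis using e weq_sym weq_trans by blast
    next
      case (Cons a p')
      then have "v = p' @ [c] @ q" "s # v @ [t] \<approx> s # p' @ q" using pq by auto
      then have "v @ [t] \<approx> p' @ q" "length (p' @ q) < length v" using weq_cancelL[of "[s]" "v @ [t]" "p' @ q"] by auto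
      then have "ln (u @ [t]) < ln u" using ln_le[of "v @ [t]" "p' @ q"] ln_cong[OF e(2)] ln_cong[OF v(1)] v(2)
        by (simp add: red_def)
      then show ?thesis using h by simp
    qed
  qed
  show ?thesis
  proof (cases "ln u < ln (s # u)")
    case True
    then show ?thesis using up[of u] assms ln_Cons[of s u] by auto
  next
    case False
    \<comment> \<open>When \<open>s u\<close> is shorter than \<open>u\<close>, the argument applies
      with \<open>u @ [t]\<close> in place of \<open>u\<close>.\<close>
    have c: "ln (u @ [t, t]) = ln u" "ln (s # u @ [t, t]) = ln (s # u)" using welt_snoc2[of u t] welt_snoc2[of "s # u" t] by simp_all
    have "s # u @ [t] \<approx> (u @ [t]) @ [t]"
      using up[of "u @ [t]"] assms c False ln_Cons[of s u] by auto
    then have "(s # u) @ [t] \<approx> (u @ [t]) @ [t]" by simp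
    then show ?thesis using weq_cancelR by blast
  qed
qed

text \<open>Unless the lengths force \<open>s u = u t\<close>, multiplying by \<open>s\<close> on
  the left does not change whether \<open>t\<close> is a right descent, nor conversely, and the two
  case distinctions do not interact.\<close>

lemma hTs_lTs: "hTs m (lTs h s) t = lTs (hTs m h t) s"
proof (rule welt_fun_eqI)
  fix u
  have d: "ln (s # u) = Suc (ln u) \<or> Suc (ln (s # u)) = ln u" "ln (u @ [t]) = Suc (ln u) \<or> Suc (ln (u @ [t])) = ln u"
    "ln (s # u @ [t]) = Suc (ln (u @ [t])) \<or> Suc (ln (s # u @ [t])) = ln (u @ [t])"
    "ln (s # u @ [t]) = Suc (ln (s # u)) \<or> Suc (ln (s # u @ [t])) = ln (s # u)"
    using ln_Cons[of s u] ln_snoc[of u t] ln_Cons[of s "u @ [t]"] ln_snoc[of "s # u" t] by auto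
  show "hTs m (lTs h s) t (welt m u) = lTs (hTs m h t) s (welt m u)"
  proof (cases "ln (s # u) = ln (u @ [t]) \<and> ln (s # u @ [t]) = ln u")
    case True
    then have e: "s # u \<approx> u @ [t]" using left_right_key by blast
    have e2: "s # u @ [t] \<approx> u" unfolding Cons_moveL by (rule weq_sym[OF e])
    have w: "welt m (s # u) = welt m (u @ [t])" "welt m (s # u @ [t]) = welt m u" by (simp_all only: welt_eq_iff e e2)
    show ?thesis unfolding lTs_welt hTs_welt append_Cons unfolding w
      using d(1,2)[unfolded w] by (auto simp: algebra_simps)
  next
    case False
    then have "(ln (s # u @ [t]) < ln (u @ [t])) = (ln (s # u) < ln u)" "(ln (s # u @ [t]) < ln (s # u)) = (ln (u @ [t]) < ln u)"
      using d by auto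
    then show ?thesis by (simp add: hTs_welt lTs_welt algebra_simps)
  qed
qed (simp add: hTs_def lTs_def)

lemma hTs_foldl_lTs: "hTs m (foldl lTs h w) t = foldl lTs (hTs m h t) w"
  by (induction w arbitrary: h) (auto simp: hTs_lTs)

lemma foldl_hTs_foldl_lTs: "foldl (hTs m) (foldl lTs h w) u = foldl lTs (foldl (hTs m) h u) w"
  by (induction u arbitrary: h) (auto simp: hTs_foldl_lTs)

lemma foldl_hTs_lin: "foldl (hTs m) (\<lambda>y. c * f y + d * g y) u = (\<lambda>y. c * foldl (hTs m) f u y + d * foldl (hTs m) g u y)"
  by (induction u arbitrary: f g) (auto simp: hTs_lin)

lemma foldl_hTs_zero: "foldl (hTs m) (\<lambda>_. 0) u = (\<lambda>_. 0)"
  using foldl_hTs_lin[of 0 "\<lambda>_. 0" 0 "\<lambda>_. 0" u] by simp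

lemma hTs_braid:
  assumes "m s t \<noteq> 0" "h \<in> HS"
  shows "foldl (hTs m) h (alt s t (m s t)) = foldl (hTs m) h (alt t s (m s t))"
  using assms(2)
proof (induction rule: HS_induct)
  case zero
  show ?case by (simp only: foldl_hTs_zero)
next
  case (add h c w)
  show ?case
  proof (cases "s = t")
    case False
    obtain u where u: "w = welt m u" "red u" using add(2) Wgrp_cases by blast
    have hT: "hT w = foldl lTs (hT (welt m [])) (rev u)" using foldl_lTs_hT[of "rev u" "[]"] u by simp
    have r: "red (alt s t (m s t))" "red (alt t s (m s t))"
      using alt_red[of s t "m s t"] alt_red[of t s "m s t"] False m_sym[of s t] by auto
    \<comment> \<open>Applied to \<open>T_1\<close>, both sides are \<open>T\<close> of the longest
      dihedral element, because the two alternating words are reduced and equal in W.\<close>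
    have "foldl (hTs m) (hT (welt m [])) (alt s t (m s t)) = foldl (hTs m) (hT (welt m [])) (alt t s (m s t))"
      using foldl_hTs_hT[of "[]" "alt s t (m s t)"] foldl_hTs_hT[of "[]" "alt t s (m s t)"] r
        iffD2[OF welt_eq_iff weq_braid[OF assms(1)]] by simp
    then have "foldl (hTs m) (hT w) (alt s t (m s t)) = foldl (hTs m) (hT w) (alt t s (m s t))"
      unfolding hT foldl_hTs_foldl_lTs by simp
    then show ?thesis using foldl_hTs_lin[of 1 h c "hT w"] add(3) by simp
  qed simp
qed

end

text \<open>\<open>\<rho> f s\<close> is the action of \<open>T_s\<close> on \<open>f\<close> from the right; \<open>V\<close> is the subspace on which the
  Hecke relations hold.\<close>

locale hecke_module = coxeter m for m :: "'i \<Rightarrow> 'i \<Rightarrow> nat" +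
  fixes \<rho> :: "('b \<Rightarrow> int fls) \<Rightarrow> 'i \<Rightarrow> 'b \<Rightarrow> int fls" and V :: "('b \<Rightarrow> int fls) \<Rightarrow> bool"
  assumes V_rho: "V f \<Longrightarrow> V (\<rho> f s)"
    and V_zero: "V (\<lambda>_. 0)"
    and V_comb: "V f \<Longrightarrow> V g \<Longrightarrow> V (\<lambda>b. c * f b + d * g b)"
    and rho_lin: "\<rho> (\<lambda>b. c * f b + d * g b) s = (\<lambda>b. c * \<rho> f s b + d * \<rho> g s b)"
    and rho_quad: "V f \<Longrightarrow> \<rho> (\<rho> f s) s = (\<lambda>b. fls_X ^ 2 * f b + (fls_X ^ 2 - 1) * \<rho> f s b)"
    and rho_braid: "V f \<Longrightarrow> m s t \<noteq> 0 \<Longrightarrow> foldl \<rho> f (alt s t (m s t)) = foldl \<rho> f (alt t s (m s t))"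
begin

definition run :: "('b \<Rightarrow> int fls) \<Rightarrow> 'i list set \<Rightarrow> 'b \<Rightarrow> int fls" where
  "run f w = foldl \<rho> f (SOME u. u \<in> reduced_words w)"

definition act :: "('b \<Rightarrow> int fls) \<Rightarrow> ('i list set \<Rightarrow> int fls) \<Rightarrow> 'b \<Rightarrow> int fls" where
  "act f h = (\<lambda>b. \<Sum>w\<in>{w. h w \<noteq> 0}. h w * run f w b)"

lemma V_foldl: "V f \<Longrightarrow> V (foldl \<rho> f u)"
  by (induction u arbitrary: f) (auto intro: V_rho)

lemma V_run: "V f \<Longrightarrow> V (run f w)" by (simp add: run_def V_foldl)

text \<open>Matsumoto's theorem for the map sending a word to its action on \<open>f\<close>. This
  makes the arbitrary choice of a reduced word in \<open>run\<close>, and so in \<open>hTw\<close>,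
  harmless.\<close>

lemma run_welt: assumes "V f" "red u" shows "run f (welt m u) = foldl \<rho> f u"
proof -
  have "(SOME v. v \<in> reduced_words (welt m u)) \<in> reduced_words (welt m u)"
    by (rule someI[of _ u]) (simp add: reduced_words_welt assms)
  then have "red (SOME v. v \<in> reduced_words (welt m u))" "u \<approx> (SOME v. v \<in> reduced_words (welt m u))"
    by (auto simp: reduced_words_welt)
  moreover have "foldl \<rho> f (p @ alt s t (m s t) @ q) = foldl \<rho> f (p @ alt t s (m s t) @ q)" if "m s t \<noteq> 0" for p s t q
    using rho_braid[OF V_foldl[OF assms(1)] that, of p] by simp
  ultimately show ?thesis unfolding run_def using matsumoto[of "foldl \<rho> f" _ u] assms(2) weq_sym by metis
qed

lemma act_zero: "act f (\<lambda>_. 0) = (\<lambda>_. 0)" by (simp add: act_def)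

lemma act_sup: "finite A \<Longrightarrow> (\<And>w. w \<notin> A \<Longrightarrow> h w = 0) \<Longrightarrow> act f h b = (\<Sum>w\<in>A. h w * run f w b)"
  unfolding act_def by (rule sum.mono_neutral_left) auto

lemma act_add: assumes "h \<in> HS" "g \<in> HS"
  shows "act f (\<lambda>y. h y + c * g y) = (\<lambda>b. act f h b + c * act f g b)"
proof
  fix b
  let ?A = "{w. h w \<noteq> 0} \<union> {w. g w \<noteq> 0}"
  have A: "finite ?A" using assms HS_finite by blast
  have "act f (\<lambda>y. h y + c * g y) b = (\<Sum>w\<in>?A. (h w + c * g w) * run f w b)" by (rule act_sup[OF A]) auto
  also have "\<dots> = (\<Sum>w\<in>?A. h w * run f w b) + c * (\<Sum>w\<in>?A. g w * run f w b)"
    by (simp add: sum.distrib sum_distrib_left algebra_simps)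
  also have "(\<Sum>w\<in>?A. h w * run f w b) = act f h b" by (rule act_sup[OF A, symmetric]) auto
  also have "(\<Sum>w\<in>?A. g w * run f w b) = act f g b" by (rule act_sup[OF A, symmetric]) auto
  finally show "act f (\<lambda>y. h y + c * g y) b = act f h b + c * act f g b" .
qed

lemma act_comb: assumes "h \<in> HS" "g \<in> HS"
  shows "act f (\<lambda>y. d * h y + c * g y) = (\<lambda>b. d * act f h b + c * act f g b)"
  using act_add[OF HS_comb[OF assms(1) HS_zero, of d 0] assms(2), of f c] act_add[OF HS_zero assms(1), of f d]
  by (simp add: act_zero)

lemma act_hT: "act f (hT w) = run f w"
proof
  fix b show "act f (hT w) b = run f w b" using act_sup[of "{w}" "hT w" f b] by (simp add: hT_def)
qed

lemma V_act: assumes "V f" "h \<in> HS" shows "V (act f h)"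
  using assms(2)
proof (induction rule: HS_induct)
  case (add h c w)
  then show ?case using V_comb[of "act f h" "run f w" 1 c] V_run[OF assms(1)]
    by (simp add: act_add HS_hT act_hT)
qed (simp add: act_zero V_zero)

lemma rho_zero: "\<rho> (\<lambda>_. 0) s = (\<lambda>_. 0)" using rho_lin[of 0 "\<lambda>_. 0" 0 "\<lambda>_. 0"] by simp

lemma act_hTs_hT:
  assumes "V f" shows "act f (hTs m (hT (welt m u)) s) = \<rho> (run f (welt m u)) s"
proof -
  obtain v where v: "u \<approx> v" "red v" using red_ex by blast
  then have uv: "welt m u = welt m v" by (simp add: welt_eq_iff)
  show ?thesis
  proof (cases "ln v < ln (v @ [s])")
    case True
    then have "red (v @ [s])" using v(2) ln_snoc[of v s] by (auto simp: red_def)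
    then show ?thesis using run_welt[OF assms] v(2) unfolding uv hTs_hT_up[OF True] act_hT by simp
  next
    case False
    then have l: "ln (v @ [s]) < ln v" using ln_snoc[of v s] by auto
    obtain x where x: "v @ [s] \<approx> x" "red x" using red_ex by blast
    have vx: "v \<approx> x @ [s]" using x(1) weq_moveR by blast
    have rx: "red (x @ [s])" using l v(2) ln_cong[OF vx] ln_cong[OF x(1)] x(2) ln_snoc[of v s] by (simp add: red_def)
    have ux: "welt m u = welt m (x @ [s])" unfolding welt_eq_iff by (rule weq_trans[OF v(1) vx])
    have up: "ln x < ln (x @ [s])" using rx x(2) by (simp add: red_def)
    have "hT (welt m u) = hTs m (hT (welt m x)) s" unfolding ux hTs_hT_up[OF up] ..
    then have "hTs m (hT (welt m u)) s = (\<lambda>y. fls_X ^ 2 * hT (welt m x) y + (fls_X ^ 2 - 1) * hT (welt m (x @ [s])) y)"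
      using hTs_quad[OF HS_hT, of "welt m x" s] hTs_hT_up[OF up] by simp
    then have "act f (hTs m (hT (welt m u)) s) = (\<lambda>b. fls_X ^ 2 * run f (welt m x) b + (fls_X ^ 2 - 1) * run f (welt m (x @ [s])) b)"
      by (simp add: act_comb HS_hT act_hT)
    also have "\<dots> = \<rho> (run f (welt m (x @ [s]))) s"
      using rho_quad[OF V_foldl[OF assms], of x s] run_welt[OF assms rx] run_welt[OF assms x(2)] by simp
    finally show ?thesis unfolding ux .
  qed
qed

lemma act_hTs: "h \<in> HS \<Longrightarrow> V f \<Longrightarrow> act f (hTs m h s) = \<rho> (act f h) s"
proof (induction rule: HS_induct)
  case zero
  have "hTs m (\<lambda>_. 0) s = (\<lambda>_. 0)" using hTs_lin[of 0 "\<lambda>_. 0" 0 "\<lambda>_. 0"] by simp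
  then show ?case by (simp add: act_zero rho_zero)
next
  case (add h c w)
  obtain u where u: "w = welt m u" using add(2) by (auto simp: Wgrp_def)
  have "act f (hTs m (\<lambda>y. h y + c * hT w y) s) = act f (\<lambda>y. hTs m h s y + c * hTs m (hT w) s y)"
    using hTs_lin[of 1 h c "hT w" s] by simp
  also have "\<dots> = (\<lambda>b. \<rho> (act f h) s b + c * \<rho> (run f w) s b)"
    using act_add[OF hTs_HS[OF add(1)] hTs_HS[OF HS_hT[OF add(2)]]] add(3)[OF add(4)] act_hTs_hT[OF add(4)] u by simp
  also have "\<dots> = \<rho> (act f (\<lambda>y. h y + c * hT w y)) s"
    using rho_lin[of 1 "act f h" c "run f w" s] act_add[OF add(1) HS_hT[OF add(2)]] by (simp add: act_hT)
  finally show ?case .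
qed

lemma act_foldl_hTs: "h \<in> HS \<Longrightarrow> V f \<Longrightarrow> act f (foldl (hTs m) h u) = foldl \<rho> (act f h) u"
  by (induction u arbitrary: h) (auto simp: act_hTs hTs_HS)

end

sublocale coxeter \<subseteq> H: hecke_module m "hTs m" "\<lambda>h. h \<in> hecke_space m"
  by unfold_locales (auto intro: hTs_HS HS_zero HS_comb hTs_lin hTs_quad hTs_braid)

context coxeter begin

lemma hmul_act: "hmul m = H.act"
  by (simp add: hmul_def H.act_def H.run_def hTw_def fun_eq_iff)

end

text \<open>In the regular representation \<open>H\<close> this is associativity of
  \<open>hmul\<close>. For functionals it shows that the elements acting by zero are closed under
  multiplication from both sides.\<close>

lemma (in hecke_module) act_hmul:
  assumes "h \<in> HS" "V f" "g \<in> HS" shows "act f (hmul m h g) = act (act f h) g"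
  using assms(3)
proof (induction rule: HS_induct)
  case zero
  then show ?case by (simp add: hmul_act H.act_zero act_zero)
next
  case (add g c w)
  obtain u where u: "w = welt m u" "red u" using add(2) Wgrp_cases by blast
  have "act f (hmul m h (hT w)) = act (act f h) (hT w)"
    using act_foldl_hTs[OF assms(1,2), of u] run_welt[OF V_act[OF assms(2,1)] u(2)] H.run_welt[OF assms(1) u(2)] u
    by (simp add: hmul_act H.act_hT act_hT)
  moreover have "hmul m h g \<in> HS" "hmul m h (hT w) \<in> HS"
    unfolding hmul_act using H.V_act[OF assms(1)] add HS_hT by auto
  ultimately show ?case using add act_add[of g "hT w" "act f h" c] act_add[of "hmul m h g" "hmul m h (hT w)" f c]
     HS_hT H.act_add[of g "hT w" h c] by (simp add: hmul_act)
qed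

section \<open>Linear independence in the Temperley--Lieb algebra\<close>

sublocale coxeter \<subseteq> TL: tlv m "fls_X + fls_X_inv :: int fls" fls_X fls_X_inv
  by unfold_locales (auto simp: fls_X_times_conv_shift)

sublocale coxeter \<subseteq> TLM: hecke_module m TL.tau TL.tlfun
proof
  fix f g c d s t
  show "TL.tau (\<lambda>b. c * f b + d * g b) s = (\<lambda>b. c * TL.tau f s b + d * TL.tau g s b)"
    unfolding TL.tau_add TL.tau_scale ..
qed (auto intro: TL.tlfun_tau TL.tlfun_zero TL.tlfun_comb TL.tau_quad TL.tau_braid)

context coxeter begin

lemma red_sub: "\<exists>v. u \<approx> v \<and> red v \<and> set v \<subseteq> set u"
proof (induction "length u" arbitrary: u rule: less_induct)
  case less
  show ?case
  proof (cases "red u")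
    case False
    then obtain v where v: "u \<approx> v" "set v \<subseteq> set u" "length v + 2 = length u" using deletion by blast
    then obtain w where "v \<approx> w" "red w" "set w \<subseteq> set v" using less[of v] by auto
    then show ?thesis using v weq_trans by blast
  qed (use weq_refl in blast)
qed

lemma dihedral_alt:
  assumes m3: "3 \<le> m s t" and u: "set u \<subseteq> {s, t}"
  shows "(\<exists>j\<le>m s t. u \<approx> alt s t j) \<or> (\<exists>j\<in>{1..<m s t}. u \<approx> alt t s j)"
proof -
  have st: "s \<noteq> t" using m3 by auto
  obtain v where v: "u \<approx> v" "red v" "set v \<subseteq> set u" using red_sub by blast
  obtain j x y where h: "{x, y} = {s, t}" "v \<approx> alt x y j" "j \<le> length v"
    using alt_reduce[OF order_trans[OF v(3) u]] by blast
  have ux: "u \<approx> alt x y j" using v(1) h(2) weq_trans by blast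
  have "length v \<le> j" using ln_le[OF h(2)] v(2) by (simp add: red_def)
  then have r: "red (alt x y j)" using red_cong[OF h(2)] v(2) h(3) by simp
  have xy: "(x = s \<and> y = t) \<or> (x = t \<and> y = s)" using h(1) by (auto simp: doubleton_eq_iff)
  have mxy: "m x y = m s t" using xy m_sym[of s t] by auto
  have jm: "j \<le> m s t"
  proof (rule ccontr)
    assume "\<not> j \<le> m s t"
    then obtain k where k: "j = Suc (m x y) + k" using mxy by (metis add_Suc less_natE not_le_imp_less)
    have "red (alt x y (Suc (m x y)))" using r red_append(1) unfolding k alt_append by blast
    \<comment> \<open>Replacing the last \<open>m x y\<close> letters by the other side of the braid
      relation puts a second \<open>x\<close> next to the first, and the two cancel.\<close>
    moreover have "alt x y (Suc (m x y)) \<approx> alt y x (m x y - 1)"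
    proof -
      have "alt y x (m x y) \<approx> alt x y (m x y)" using weq_braid[of y x] m_sym[of y x] mxy m3 by simp
      then have 1: "alt x y (Suc (m x y)) \<approx> [x] @ alt x y (m x y)" using weq_append[OF weq_refl, of _ _ "[x]"] by simp
      have "[x] @ alt x y (m x y) = [x] @ [x] @ alt y x (m x y - 1)" using m3 mxy alt.simps(2)[of x y "m x y - 1"] by simp
      moreover have "[x] @ [x] @ alt y x (m x y - 1) \<approx> alt y x (m x y - 1)"
        using weq_insert(1)[of "[]" "alt y x (m x y - 1)" "[x]"] weq_sym by simp
      ultimately show ?thesis using 1 weq_trans by metis
    qed
    ultimately show False using ln_le[of "alt x y (Suc (m x y))" "alt y x (m x y - 1)"] by (simp add: red_def del: alt.simps)
  qed
  show ?thesis
  proof (cases "x = s \<and> y = t")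
    case True
    then show ?thesis using ux jm by blast
  next
    case False
    then have x: "x = t" "y = s" using xy by auto
    consider "j = 0" | "j = m s t" | "j \<in> {1..<m s t}" using jm by fastforce
    then show ?thesis
    proof cases
      case 1
      then show ?thesis using ux by (intro disjI1 exI[of _ 0]) simp
    next
      case 2
      have "u \<approx> alt s t (m s t)" using ux x 2 weq_trans[OF _ weq_sym[OF weq_braid[of s t]]] m3 by simp
      then show ?thesis by blast
    next
      case 3
      then show ?thesis using ux x by blast
    qed
  qed
qed

lemma dihedral_eq:
  assumes "3 \<le> m s t"
  shows "dihedral m s t = (\<lambda>j. welt m (alt s t j)) ` {..m s t} \<union> (\<lambda>j. welt m (alt t s j)) ` {1..<m s t}"
proof
  show "dihedral m s t \<subseteq> (\<lambda>j. welt m (alt s t j)) ` {..m s t} \<union> (\<lambda>j. welt m (alt t s j)) ` {1..<m s t}"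
  proof
    fix w assume "w \<in> dihedral m s t"
    then obtain u where u: "w = welt m u" "set u \<subseteq> {s, t}" by (auto simp: dihedral_def)
    show "w \<in> (\<lambda>j. welt m (alt s t j)) ` {..m s t} \<union> (\<lambda>j. welt m (alt t s j)) ` {1..<m s t}"
      using dihedral_alt[OF assms u(2)] unfolding u(1) welt_eq_iff[symmetric] by auto
  qed
  show "(\<lambda>j. welt m (alt s t j)) ` {..m s t} \<union> (\<lambda>j. welt m (alt t s j)) ` {1..<m s t} \<subseteq> dihedral m s t"
  proof -
    have "set (alt t s j) \<subseteq> {s, t}" for j using set_alt_subset[of t s j] by auto
    then show ?thesis using set_alt_subset[of s t] unfolding dihedral_def by blast
  qed
qed

text \<open>Alternating words of different lengths are told apart by \<open>wlen\<close>, and those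
  of equal length below \<open>m s t\<close> by \<open>alt_distinct\<close>. The identity and the
  longest element belong to both families and are counted in the first sum.\<close>

lemma dihedral_sum:
  assumes m3: "3 \<le> m s t"
  shows "(\<Sum>w\<in>dihedral m s t. g w) = (\<Sum>j\<le>m s t. g (welt m (alt s t j))) + (\<Sum>j=1..<m s t. g (welt m (alt t s j)) :: int fls)"
proof -
  have st: "s \<noteq> t" using m3 by auto
  have l: "ln (alt s t j) = j" "ln (alt t s j) = j" if "j \<le> m s t" for j
    using ln_alt[of s t j] ln_alt[of t s j] st that m_sym[of s t] by auto
  have i: "inj_on (\<lambda>j. welt m (alt s t j)) {..m s t}" "inj_on (\<lambda>j. welt m (alt t s j)) {1..<m s t}"
    by (rule inj_on_inverseI[of _ wlen], simp add: l)+
  have d: "(\<lambda>j. welt m (alt s t j)) ` {..m s t} \<inter> (\<lambda>j. welt m (alt t s j)) ` {1..<m s t} = {}"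
  proof (rule ccontr)
    assume "\<not> ?thesis"
    then obtain j k where jk: "j \<le> m s t" "1 \<le> k" "k < m s t" "welt m (alt s t j) = welt m (alt t s k)" by auto
    then have "j = k" using l(1)[of j] l(2)[of k] by simp
    then have "alt s t j = alt t s j"
      using alt_distinct[of s t j t s j] jk st welt_eq_iff by (metis insert_commute)
    then show False using st jk \<open>j = k\<close> by (cases j) auto
  qed
  show ?thesis unfolding dihedral_eq[OF m3]
    by (subst sum.union_disjoint[OF _ _ d]) (simp_all add: sum.reindex[OF i(1)] sum.reindex[OF i(2)] del: One_nat_def)
qed

text \<open>The generators act by zero by \<open>alt_sum_zero\<close>. Left multiples do because
  \<open>act f h\<close> again respects the relations, right multiples because zero is mapped to
  zero. Membership in \<open>HS\<close> is carried along for \<open>act_hmul\<close>.\<close>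

lemma hJ_kill: "a \<in> hJ m \<Longrightarrow> a \<in> HS \<and> (\<forall>f. TL.tlfun f \<longrightarrow> TLM.act f a = (\<lambda>_. 0))"
proof (induction rule: hJ.induct)
  case (J_gen s t)
  have fin: "finite (dihedral m s t)" unfolding dihedral_eq[OF J_gen] by simp
  have HS: "Defs.J_gen m s t \<in> HS"
  proof (rule HS_I[OF fin])
    show "dihedral m s t \<subseteq> Wgrp m" by (auto simp: dihedral_def)
  qed (simp add: J_gen_def)
  have "TLM.act f (Defs.J_gen m s t) b = 0" if f: "TL.tlfun f" for f b
  proof -
    have st: "s \<noteq> t" using J_gen by auto
    have r: "red (alt s t j)" "red (alt t s j)" if "j \<le> m s t" for j
      using alt_red[of s t j] alt_red[of t s j] st that m_sym[of s t] by auto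
    have "TLM.act f (Defs.J_gen m s t) b = (\<Sum>w\<in>dihedral m s t. Defs.J_gen m s t w * TLM.run f w b)"
      by (rule TLM.act_sup[OF fin]) (simp add: J_gen_def)
    also have "\<dots> = (\<Sum>w\<in>dihedral m s t. TLM.run f w b)" by (rule sum.cong) (simp_all add: J_gen_def)
    also have "\<dots> = (\<Sum>j\<le>m s t. foldl TL.tau f (alt s t j) b) + (\<Sum>j=1..<m s t. foldl TL.tau f (alt t s j) b)"
      unfolding dihedral_sum[OF J_gen] using r by (simp add: TLM.run_welt[OF f])
    also have "\<dots> = 0" by (rule TL.alt_sum_zero[OF f J_gen])
    finally show ?thesis .
  qed
  then show ?case using HS by blast
next
  case J_zero
  then show ?case by (simp add: HS_zero TLM.act_zero)
next
  case (J_add a b)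
  then show ?case using HS_add[of a b 1] TLM.act_add[of a b _ 1] by simp
next
  case (J_lmul a h)
  have "hmul m h a \<in> HS" unfolding hmul_act using H.V_act J_lmul by blast
  then show ?case using J_lmul TLM.act_hmul TLM.V_act by simp
next
  case (J_rmul a h)
  have "hmul m a h \<in> HS" unfolding hmul_act using H.V_act J_rmul by blast
  moreover have "TLM.act (\<lambda>_. 0) h = (\<lambda>_. 0)"
  proof -
    have "foldl TL.tau (\<lambda>_. 0) u = (\<lambda>_. 0)" for u by (induction u) (auto simp: TLM.rho_zero)
    then show ?thesis by (simp add: TLM.act_def TLM.run_def)
  qed
  ultimately show ?case using J_rmul TLM.act_hmul by simp
qed

lemma ceq_weq: "u \<simeq> v \<Longrightarrow> u \<approx> v"
  unfolding ceq_def
proof (induction rule: rtranclp_induct)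
  case (step y z)
  then obtain p s t q where h: "m s t = 2" "y = p @ [s, t] @ q" "z = p @ [t, s] @ q" by (auto simp: comm_move_def)
  have "[s, t] \<approx> [t, s]" using weq_braid[of s t] h(1) by (simp add: numeral_2_eq_2)
  then have "y \<approx> z" using h weq_ctxt by blast
  then show ?case using step weq_trans by blast
qed simp

text \<open>A swap never exchanges two of the retained letters, as these do not commute. The
  projection therefore distinguishes the two sides of a braid relation.\<close>

lemma ceq_filter:
  assumes "m a b \<noteq> 2" "u \<simeq> v"
  shows "filter (\<lambda>x. x = a \<or> x = b) u = filter (\<lambda>x. x = a \<or> x = b) v"
  using assms(2) unfolding ceq_def
proof (induction rule: rtranclp_induct)
  case (step y z)
  then obtain p s t q where h: "m s t = 2" "y = p @ [s, t] @ q" "z = p @ [t, s] @ q" by (auto simp: comm_move_def)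
  have "\<not> ((s = a \<or> s = b) \<and> (t = a \<or> t = b))" using h(1) assms(1) m_sym[of a b] by auto
  then have "filter (\<lambda>x. x = a \<or> x = b) y = filter (\<lambda>x. x = a \<or> x = b) z" using h by auto
  then show ?case using step by simp
qed simp

text \<open>A redex \<open>a a\<close> would contradict reducedness. A braid redex would give two
  reduced words of the same element that no sequence of commutations connects.\<close>

lemma Wc_irr:
  assumes "welt m u \<in> Wc m" "red u" shows "TL.irr u"
  unfolding TL.irr_def
proof (intro allI impI notI)
  fix p a b q assume r: "isr a b" and e: "u \<simeq> p @ rdx a b @ q"
  have w: "u \<approx> p @ rdx a b @ q" using ceq_weq[OF e] .
  have rw: "red (p @ rdx a b @ q)" using red_cong[OF w] ceq_mset[OF e] assms(2) by simp
  show False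
  proof (cases "a = b")
    case True
    have "red (rdx a b)" using rw red_append by metis
    then show False using True ln_le[OF weq_ss[of a]] by (simp add: lng_def red_def numeral_2_eq_2)
  next
    case False
    then have m3: "3 \<le> m a b" and l: "lng a b = m a b" using r by (auto simp: isr_def lng_def)
    let ?w = "p @ alt a b (m a b) @ q" and ?w' = "p @ alt b a (m a b) @ q"
    have ww: "?w \<approx> ?w'" using weq_ctxt[OF weq_braid] m3 by simp
    have "?w \<in> reduced_words (welt m u)" using w rw l by (simp add: reduced_words_welt)
    moreover have "?w' \<in> reduced_words (welt m u)"
      using weq_trans[OF w[unfolded l] ww] red_cong[OF ww] rw l by (simp add: reduced_words_welt)
    ultimately have "?w \<simeq> ?w'" using assms(1) unfolding Wc_def ceq_def by blast
    moreover have "m a b \<noteq> 2" using m3 by simp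
    ultimately have "filter (\<lambda>x. x = a \<or> x = b) ?w = filter (\<lambda>x. x = a \<or> x = b) ?w'" using ceq_filter by blast
    moreover have "filter (\<lambda>x. x = a \<or> x = b) (alt a b k) = alt a b k" "filter (\<lambda>x. x = a \<or> x = b) (alt b a k) = alt b a k" for k
      using set_alt_subset[of a b k] set_alt_subset[of b a k] by (auto simp: filter_id_conv)
    ultimately have "alt a b (m a b) = alt b a (m a b)" by simp
    then show False using False m3 alt_inject[of "m a b" a b b a] by auto
  qed
qed

text \<open>Take \<open>w\<close> of maximal length in the support and a reduced word
  \<open>u\<close> of it. The functional \<open>N u\<close>, acted on by \<open>d\<close> and
  evaluated at the empty word, isolates the coefficient of \<open>w\<close> times a power of
  \<open>v\<close>; by \<open>hJ_kill\<close> this is zero.\<close>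

lemma hJ_Wc_independent:
  assumes d: "d \<in> hJ m" and s: "\<And>w. d w \<noteq> 0 \<Longrightarrow> w \<in> Wc m" shows "d = (\<lambda>_. 0)"
proof (rule ccontr)
  assume "d \<noteq> (\<lambda>_. 0)"
  have HS: "d \<in> HS" and kill: "\<And>f. TL.tlfun f \<Longrightarrow> TLM.act f d = (\<lambda>_. 0)" using hJ_kill[OF d] by auto
  let ?A = "{w. d w \<noteq> 0}"
  have fin: "finite ?A" using HS_finite[OF HS] .
  have ne: "?A \<noteq> {}" using \<open>d \<noteq> (\<lambda>_. 0)\<close> by auto
  have "Max (wlen ` ?A) \<in> wlen ` ?A" using fin ne by simp
  then obtain w where w: "w \<in> ?A" and "Max (wlen ` ?A) = wlen w" by (rule imageE)
  then have wmax: "wlen x \<le> wlen w" if "x \<in> ?A" for x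
    using Max_ge[of "wlen ` ?A" "wlen x"] fin that by simp
  have "w \<in> Wgrp m" using w HS_out[OF HS] by blast
  then obtain u where u: "w = welt m u" "red u" using Wgrp_cases by blast
  have "d x * TLM.run (TL.N u) x [] = (if x = w then d w * fls_X ^ length u else 0)" if x: "x \<in> ?A" for x
  proof -
    have "x \<in> Wgrp m" using x HS_out[OF HS] by blast
    then obtain y where y: "x = welt m y" "red y" using Wgrp_cases by blast
    have iry: "TL.irr y" using Wc_irr s x y by blast
    have l: "length y \<le> length u" using wmax[OF x] u y by (simp add: red_def)
    have "TLM.run (TL.N u) x [] = (if y \<simeq> u then fls_X ^ length y else 0)"
      unfolding y(1) TLM.run_welt[OF TL.tlfun_N y(2)] by (rule TL.foldl_tau_N[OF iry l])
    moreover have "y \<simeq> u \<longleftrightarrow> x = w"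
    proof
      assume "y \<simeq> u"
      then show "x = w" using ceq_weq welt_eq_iff u y by blast
    next
      assume xw: "x = w"
      then have "y \<in> reduced_words w" "u \<in> reduced_words w"
        using u y welt_eq_iff weq_refl by (metis (mono_tags, lifting) mem_Collect_eq reduced_words_welt)+
      then show "y \<simeq> u" using s[of w] w unfolding Wc_def ceq_def by blast
    qed
    moreover have "x = w \<Longrightarrow> length y = length u" using u y by (simp add: red_def)
    ultimately show ?thesis by auto
  qed
  then have "TLM.act (TL.N u) d [] = (\<Sum>x\<in>?A. if x = w then d w * fls_X ^ length u else 0)"
    unfolding TLM.act_def by simp
  also have "\<dots> = d w * fls_X ^ length u" using fin w by (simp add: sum.delta')
  finally have "d w * fls_X ^ length u = 0" using kill[OF TL.tlfun_N] by simp
  then show False using w by simp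
qed

end

section \<open>The involution\<close>

text \<open>\<open>lbar\<close> reverses coefficients through \<open>Abs_fls\<close>. The reversed
  sequence is a Laurent series only when the support is bounded above, so the computations with
  \<open>lbar\<close> are confined to Laurent polynomials.\<close>

definition lpoly :: "int fls \<Rightarrow> bool" where "lpoly f \<longleftrightarrow> finite {n. fls_nth f n \<noteq> 0}"

lemma lbar_nth: assumes "lpoly f" shows "fls_nth (lbar f) n = fls_nth f (- n)"
proof -
  obtain N where N: "\<And>k. fls_nth f k \<noteq> 0 \<Longrightarrow> k \<le> N"
    using assms unfolding lpoly_def by (metis (mono_tags, lifting) Max_ge mem_Collect_eq)
  show ?thesis unfolding lbar_def
    by (rule nth_Abs_fls_lower_bound[of "- N"]) (use N in force)
qed

lemma lpoly_zero [simp]: "lpoly 0" by (simp add: lpoly_def)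

lemma lpoly_add: "lpoly f \<Longrightarrow> lpoly g \<Longrightarrow> lpoly (f + g)"
  unfolding lpoly_def by (rule finite_subset[of _ "{n. fls_nth f n \<noteq> 0} \<union> {n. fls_nth g n \<noteq> 0}"]) auto

lemma lpoly_shift: "lpoly f \<Longrightarrow> lpoly (fls_shift k f)"
proof -
  assume "lpoly f"
  then have "finite ((\<lambda>n. n - k) ` {n. fls_nth f n \<noteq> 0})" by (simp add: lpoly_def)
  moreover have "{n. fls_nth (fls_shift k f) n \<noteq> 0} \<subseteq> (\<lambda>n. n - k) ` {n. fls_nth f n \<noteq> 0}"
    by (auto intro: image_eqI[of _ _ "_ + k"])
  ultimately show ?thesis unfolding lpoly_def by (rule finite_subset[rotated])
qed

lemma lpoly_const: "lpoly f \<Longrightarrow> lpoly (fls_const k * f)"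
  unfolding lpoly_def by (rule finite_subset[of _ "{n. fls_nth f n \<noteq> 0}"]) auto

lemma lpoly_one: "lpoly 1" 
  unfolding lpoly_def by (rule finite_subset[of _ "{0}"]) auto

lemma lbar_zero [simp]: "lbar 0 = 0" by (simp add: fls_eq_iff lbar_nth)
lemma lbar_add: "lpoly f \<Longrightarrow> lpoly g \<Longrightarrow> lbar (f + g) = lbar f + lbar g"
  by (simp add: fls_eq_iff lbar_nth lpoly_add)
lemma lbar_shift: "lpoly f \<Longrightarrow> lbar (fls_shift k f) = fls_shift (- k) (lbar f)"
  by (simp add: fls_eq_iff lbar_nth lpoly_shift)
lemma lbar_const: "lpoly f \<Longrightarrow> lbar (fls_const k * f) = fls_const k * lbar f"
  by (simp add: fls_eq_iff lbar_nth lpoly_const)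
lemma lbar_one: "lbar 1 = 1" by (simp add: fls_eq_iff lbar_nth lpoly_one)

lemma fls_X2: "fls_X ^ 2 * (f :: int fls) = fls_shift (- 2) f"
  using fls_X_power_times_conv_shift(1)[of 2 f] by simp

lemma X_inv_X: "fls_X_inv * (fls_X * f) = (f :: int fls)" "fls_X * (fls_X_inv * f) = (f :: int fls)"
  "fls_X_inv * fls_X = (1 :: int fls)" "fls_X * fls_X_inv = (1 :: int fls)"
  by (simp_all add: fls_X_times_conv_shift fls_X_inv_times_conv_shift)

lemma X2_inv: "(fls_X_inv :: int fls)\<^sup>2 * fls_X\<^sup>2 = 1" "(fls_X :: int fls)\<^sup>2 * fls_X_inv\<^sup>2 = 1" "fls_X_inv\<^sup>2 * (fls_X\<^sup>2 * f) = (f :: int fls)"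
    "fls_X_inv * (fls_X\<^sup>2 * f) = fls_X * (f :: int fls)" "fls_X * (fls_X_inv\<^sup>2 * f) = fls_X_inv * (f :: int fls)"
  by (simp_all add: power2_eq_square mult.assoc X_inv_X)

section \<open>Inverses of the basis elements\<close>

context coxeter begin

text \<open>Right multiplication by the inverse of \<open>T_s\<close>, obtained by solving the
  quadratic relation.\<close>

definition Ti :: "('i list set \<Rightarrow> int fls) \<Rightarrow> 'i \<Rightarrow> 'i list set \<Rightarrow> int fls" where
  "Ti h s = (\<lambda>y. fls_X_inv\<^sup>2 * hTs m h s y + (fls_X_inv\<^sup>2 - 1) * h y)"

lemma Ti_HS: "h \<in> HS \<Longrightarrow> Ti h s \<in> HS"
  unfolding Ti_def by (intro HS_comb hTs_HS)

lemma Ti_foldl_HS: "h \<in> HS \<Longrightarrow> foldl Ti h u \<in> HS"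
  by (induction u arbitrary: h) (auto intro: Ti_HS)

lemma hTs_Ti: "h \<in> HS \<Longrightarrow> hTs m (Ti h s) s = h"
  unfolding Ti_def hTs_lin hTs_quad
  by (auto simp: fun_eq_iff algebra_simps X2_inv)

lemma Ti_hTs: "h \<in> HS \<Longrightarrow> Ti (hTs m h s) s = h"
  unfolding Ti_def by (auto simp: hTs_quad fun_eq_iff algebra_simps X2_inv)

lemma foldl_Ti_hTs: "h \<in> HS \<Longrightarrow> foldl Ti (foldl (hTs m) h (rev u)) u = h"
proof (induction u arbitrary: h)
  case (Cons s u)
  then show ?case using Ti_hTs[OF foldl_hTs_HS[OF Cons.prems]] by simp
qed simp

lemma foldl_hTs_Ti: "h \<in> HS \<Longrightarrow> foldl (hTs m) (foldl Ti h u) (rev u) = h"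
proof (induction u arbitrary: h)
  case (Cons s u)
  then show ?case using hTs_Ti Ti_HS by simp
qed simp

lemma act_foldl_Ti: "f \<in> HS \<Longrightarrow> h \<in> HS \<Longrightarrow> hmul m f (foldl Ti h u) = foldl Ti (hmul m f h) u"
proof (induction u arbitrary: h)
  case (Cons s u)
  have "hmul m f (Ti h s) = Ti (hmul m f h) s"
    unfolding hmul_act Ti_def using H.act_comb[OF hTs_HS Cons.prems(2)] Cons.prems
    by (simp add: H.act_hTs)
  then show ?case using Cons Ti_HS by simp
qed simp

definition Tinv :: "'i list set \<Rightarrow> 'i list set \<Rightarrow> int fls" where
  "Tinv w = hinv m (hT (winv m w))"

lemma red_rev: "red u \<Longrightarrow> red (rev u)"
  by (simp add: red_def ln_rev)

text \<open>The product of the inverses of the letters is exhibited as a two-sided inverse. It is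
  the only one, since right multiplication by \<open>T\<close> of the inverse element is undone by
  applying \<open>Ti\<close> letter by letter.\<close>

lemma Tinv_welt: assumes "red u" shows "Tinv (welt m u) = foldl Ti (hT (wone m)) u"
proof -
  have o: "hT (wone m) \<in> HS" unfolding wone_def by (simp add: HS_hT)
  note r = red_rev[OF assms]
  have hr: "hmul m g (hT (welt m (rev u))) = foldl (hTs m) g (rev u)" if "g \<in> HS" for g
    unfolding hmul_act H.act_hT H.run_welt[OF that r] ..
  show ?thesis unfolding Tinv_def winv_welt hinv_def
  proof (rule the_equality)
    let ?g = "foldl Ti (hT (wone m)) u"
    have g: "?g \<in> HS" by (rule Ti_foldl_HS[OF o])
    have 1: "hmul m (hT (welt m (rev u))) ?g = foldl Ti (hmul m (hT (welt m (rev u))) (hT (wone m))) u"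
      by (rule act_foldl_Ti) (simp_all add: o HS_hT)
    have 2: "hmul m (hT (welt m (rev u))) (hT (wone m)) = hT (welt m (rev u))"
      unfolding hmul_act H.act_hT wone_def using H.run_welt[of "hT (welt m (rev u))" "[]"] by (simp add: HS_hT red_def)
    have 3: "hT (welt m (rev u)) = foldl (hTs m) (hT (wone m)) (rev u)"
      unfolding wone_def using foldl_hTs_hT[of "[]" "rev u"] r by simp
    have "hmul m (hT (welt m (rev u))) ?g = hT (wone m)"
      unfolding 1 2 unfolding 3 by (rule foldl_Ti_hTs[OF o])
    then show "?g \<in> HS \<and> hmul m (hT (welt m (rev u))) ?g = hT (wone m) \<and> hmul m ?g (hT (welt m (rev u))) = hT (wone m)"
      using g hr[OF g] foldl_hTs_Ti[OF o] by simp
  next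
    fix g assume g: "g \<in> HS \<and> hmul m (hT (welt m (rev u))) g = hT (wone m) \<and> hmul m g (hT (welt m (rev u))) = hT (wone m)"
    then have "foldl (hTs m) g (rev u) = hT (wone m)" using hr[of g] by metis
    then show "g = foldl Ti (hT (wone m)) u" using foldl_Ti_hTs[of g u] g by simp
  qed
qed

lemma Ti_welt: "Ti h s (welt m u) =
  (if ln (u @ [s]) < ln u then fls_X_inv\<^sup>2 * h (welt m (u @ [s])) else h (welt m (u @ [s])) + (fls_X_inv\<^sup>2 - 1) * h (welt m u))"
  unfolding Ti_def by (simp add: hTs_welt algebra_simps X2_inv)

text \<open>Each inverse letter contributes \<open>q^-1 T_s\<close> plus a scalar, so only the
  product of the first summands reaches the full length. Triangularity by length is the form in
  which leading terms are compared below.\<close>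

lemma Tinv_tri:
  assumes "red u"
  shows "foldl Ti (hT (wone m)) u (welt m u) = fls_X_inv ^ (2 * length u) \<and>
    (\<forall>z. length u \<le> ln z \<longrightarrow> \<not> z \<approx> u \<longrightarrow> foldl Ti (hT (wone m)) u (welt m z) = 0)"
  using assms
proof (induction u rule: rev_induct)
  case Nil
  then show ?case by (auto simp: hT_def wone_def welt_eq_iff)
next
  case (snoc s u)
  let ?h = "foldl Ti (hT (wone m)) u"
  have ru: "red u" using snoc.prems red_append(1) by blast
  have IH1: "?h (welt m u) = fls_X_inv ^ (2 * length u)"
    and IH2: "\<And>z. length u \<le> ln z \<Longrightarrow> \<not> z \<approx> u \<Longrightarrow> ?h (welt m z) = 0" using snoc.IH[OF ru] by auto
  have l: "ln (u @ [s]) = Suc (ln u)" using snoc.prems ru by (simp add: red_def)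
  have lu: "length u = ln u" using ru by (simp add: red_def)
  have 1: "Ti ?h s (welt m (u @ [s])) = fls_X_inv\<^sup>2 * fls_X_inv ^ (2 * length u)"
    unfolding Ti_welt using l IH1 welt_snoc2[of u s] by simp
  have 2: "Ti ?h s (welt m z) = 0" if z: "Suc (length u) \<le> ln z" "\<not> z \<approx> u @ [s]" for z
  proof -
    have "\<not> z \<approx> u" using z(1) lu ln_cong by fastforce
    moreover have "\<not> z @ [s] \<approx> u" using z(2) weq_moveR by blast
    moreover have "length u \<le> ln (z @ [s])" using z(1) ln_snoc[of z s] by auto
    ultimately show ?thesis unfolding Ti_welt using IH2[of z] IH2[of "z @ [s]"] z(1) by simp
  qed
  show ?case using 1 2 by (simp add: power_add power2_eq_square mult.assoc)
qed

section \<open>The involution and multiplication by C'_s\<close>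

definition LH :: "('i list set \<Rightarrow> int fls) set" where
  "LH = {h \<in> HS. \<forall>w. lpoly (h w)}"

lemma iota_sup: "finite A \<Longrightarrow> (\<And>w. w \<notin> A \<Longrightarrow> h w = 0) \<Longrightarrow> iota m h y = (\<Sum>w\<in>A. lbar (h w) * Tinv w y)"
  unfolding iota_def Tinv_def[symmetric] by (rule sum.mono_neutral_left) auto

lemma iota_zero: "iota m (\<lambda>_. 0) = (\<lambda>_. 0)" by (simp add: iota_def)

lemma iota_add: assumes "f \<in> LH" "g \<in> LH" shows "iota m (\<lambda>y. f y + g y) = (\<lambda>y. iota m f y + iota m g y)"
proof
  fix y
  let ?A = "{w. f w \<noteq> 0} \<union> {w. g w \<noteq> 0}"
  have A: "finite ?A" using assms HS_finite unfolding LH_def by blast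
  have "iota m (\<lambda>y. f y + g y) y = (\<Sum>w\<in>?A. lbar (f w + g w) * Tinv w y)" by (rule iota_sup[OF A]) auto
  also have "\<dots> = (\<Sum>w\<in>?A. lbar (f w) * Tinv w y) + (\<Sum>w\<in>?A. lbar (g w) * Tinv w y)"
    unfolding sum.distrib[symmetric] using assms by (intro sum.cong) (auto simp: LH_def lbar_add algebra_simps)
  also have "(\<Sum>w\<in>?A. lbar (f w) * Tinv w y) = iota m f y" by (rule iota_sup[OF A, symmetric]) auto
  also have "(\<Sum>w\<in>?A. lbar (g w) * Tinv w y) = iota m g y" by (rule iota_sup[OF A, symmetric]) auto
  finally show "iota m (\<lambda>y. f y + g y) y = iota m f y + iota m g y" .
qed

lemma iota_const: assumes "f \<in> LH" shows "iota m (\<lambda>y. fls_const k * f y) = (\<lambda>y. fls_const k * iota m f y)"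
proof
  fix y
  let ?A = "{w. f w \<noteq> 0}"
  have A: "finite ?A" using assms HS_finite unfolding LH_def by blast
  have "iota m (\<lambda>y. fls_const k * f y) y = (\<Sum>w\<in>?A. lbar (fls_const k * f w) * Tinv w y)" by (rule iota_sup[OF A]) auto
  also have "\<dots> = fls_const k * (\<Sum>w\<in>?A. lbar (f w) * Tinv w y)"
    unfolding sum_distrib_left using assms by (intro sum.cong) (auto simp: LH_def lbar_const algebra_simps)
  also have "(\<Sum>w\<in>?A. lbar (f w) * Tinv w y) = iota m f y" by (rule iota_sup[OF A, symmetric]) auto
  finally show "iota m (\<lambda>y. fls_const k * f y) y = fls_const k * iota m f y" .
qed

lemma iota_hT: "iota m (\<lambda>y. c * hT w y) y = lbar c * Tinv w y"
  using iota_sup[of "{w}" "\<lambda>y. c * hT w y" y] by (simp add: hT_def)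

lemma LH_hT: "lpoly c \<Longrightarrow> w \<in> Wgrp m \<Longrightarrow> (\<lambda>y. c * hT w y) \<in> LH"
  using HS_comb[OF HS_hT HS_zero, of w c 0] by (auto simp: LH_def hT_def)

lemma LH_add: "f \<in> LH \<Longrightarrow> g \<in> LH \<Longrightarrow> (\<lambda>y. f y + g y) \<in> LH"
  using HS_comb[of f g 1 1] by (auto simp: LH_def lpoly_add)

lemma LH_const: "f \<in> LH \<Longrightarrow> (\<lambda>y. fls_const k * f y) \<in> LH"
  using HS_comb[OF _ HS_zero, of f "fls_const k" 0] by (auto simp: LH_def lpoly_const)

lemma LH_zero: "(\<lambda>_. 0) \<in> LH" by (simp add: LH_def HS_zero)

lemma LH_induct [consumes 1, case_names zero add]:
  assumes "h \<in> LH" and "P (\<lambda>_. 0)"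
    and "\<And>h c w. h \<in> LH \<Longrightarrow> lpoly c \<Longrightarrow> w \<in> Wgrp m \<Longrightarrow> P h \<Longrightarrow> P (\<lambda>y. h y + c * hT w y)"
  shows "P h"
  using HS_induct_coeffs[of h lpoly P] assms by (simp add: LH_def)

text \<open>Right multiplication by \<open>C'_s = q\<^sup>-\<^sup>1\<^sup>/\<^sup>2 (T_s + 1)\<close>.\<close>

definition mulC :: "('i list set \<Rightarrow> int fls) \<Rightarrow> 'i \<Rightarrow> 'i list set \<Rightarrow> int fls" where
  "mulC h s = (\<lambda>y. fls_X_inv * (hTs m h s y + h y))"

lemma mulC_lin: "mulC (\<lambda>y. c * f y + d * g y) s = (\<lambda>y. c * mulC f s y + d * mulC g s y)"
  unfolding mulC_def hTs_lin by (auto simp: algebra_simps)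

lemma mulC_HS: "h \<in> HS \<Longrightarrow> mulC h s \<in> HS"
  using HS_comb[OF hTs_HS, of h h fls_X_inv s fls_X_inv] by (simp add: mulC_def algebra_simps)

lemma mulC_welt: "mulC h s (welt m u) = (if ln (u @ [s]) < ln u
    then fls_X_inv * (h (welt m (u @ [s])) + fls_X\<^sup>2 * h (welt m u)) else fls_X_inv * (fls_X\<^sup>2 * h (welt m (u @ [s])) + h (welt m u)))"
  by (simp add: mulC_def hTs_welt algebra_simps)

lemma mulC_LH: assumes "h \<in> LH" shows "mulC h s \<in> LH"
proof -
  have H: "h \<in> HS" and l: "\<And>w. lpoly (h w)" using assms by (auto simp: LH_def)
  have "lpoly (mulC h s y)" for y
  proof (cases "y \<in> Wgrp m")
    case True
    then show ?thesis using l
      by (auto simp: Wgrp_def mulC_welt fls_X2 fls_X_inv_times_conv_shift intro!: lpoly_shift lpoly_add)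
  next
    case False
    then show ?thesis by (simp add: mulC_def hTs_out HS_out[OF H])
  qed
  then show ?thesis using mulC_HS[OF H] by (simp add: LH_def)
qed

lemma Tinv_HS: "w \<in> Wgrp m \<Longrightarrow> Tinv w \<in> HS"
  by (erule Wgrp_cases) (simp add: Tinv_welt Ti_foldl_HS HS_hT wone_def)

text \<open>Here \<open>T_w C'_s\<close> is \<open>v^-1 (T_ws + T_w)\<close> if \<open>ws\<close> is
  longer and \<open>v (T_ws + T_w)\<close> if it is shorter. The scalars are powers of
  \<open>v\<close>, which \<open>lbar\<close> inverts as shifts. The factor \<open>c\<close> is
  carried because \<open>iota\<close> is only semilinear.\<close>

lemma iota_mulC_hT:
  assumes c: "lpoly c" and w: "w \<in> Wgrp m"
  shows "iota m (\<lambda>y. c * mulC (hT w) s y) = (\<lambda>y. lbar c * mulC (Tinv w) s y)"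
proof -
  obtain u where u: "w = welt m u" "red u" using Wgrp_cases w by blast
  have two: "iota m (\<lambda>y. a * hT x y + b * hT z y) = (\<lambda>y. lbar a * Tinv x y + lbar b * Tinv z y)"
    if "lpoly a" "lpoly b" "x \<in> Wgrp m" "z \<in> Wgrp m" for a b x z
    using iota_add[OF LH_hT[OF that(1,3)] LH_hT[OF that(2,4)]] iota_hT by simp
  show ?thesis
  proof (cases "ln u < ln (u @ [s])")
    case True
    then have r: "red (u @ [s])" using u(2) ln_snoc[of u s] by (auto simp: red_def)
    have I: "Tinv (welt m (u @ [s])) = Ti (Tinv w) s" using Tinv_welt[OF r] Tinv_welt[OF u(2)] u by simp
    have sh: "c * fls_X_inv = fls_shift 1 c" by (simp add: fls_X_inv_times_conv_shift)
    have lb: "lbar (fls_shift 1 c) = fls_X * lbar c" "lpoly (fls_shift 1 c)"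
      using c by (simp_all add: lbar_shift lpoly_shift fls_X_times_conv_shift)
    have "(\<lambda>y. c * mulC (hT w) s y) = (\<lambda>y. fls_shift 1 c * hT (welt m (u @ [s])) y + fls_shift 1 c * hT w y)"
      unfolding mulC_def u(1) hTs_hT_up[OF True] sh[symmetric] by (simp add: algebra_simps)
    then have "iota m (\<lambda>y. c * mulC (hT w) s y) = (\<lambda>y. fls_X * lbar c * Ti (Tinv w) s y + fls_X * lbar c * Tinv w y)"
      using two[OF lb(2) lb(2), of "welt m (u @ [s])" w] w I lb(1) by simp
    also have "\<dots> = (\<lambda>y. lbar c * mulC (Tinv w) s y)"
    proof
      fix y
      have "fls_X * lbar c * Ti (Tinv w) s y + fls_X * lbar c * Tinv w y
        = lbar c * (fls_X * (fls_X_inv\<^sup>2 * hTs m (Tinv w) s y) + fls_X * (fls_X_inv\<^sup>2 * Tinv w y))"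
        unfolding Ti_def by (simp add: algebra_simps)
      then show "fls_X * lbar c * Ti (Tinv w) s y + fls_X * lbar c * Tinv w y = lbar c * mulC (Tinv w) s y"
        unfolding X2_inv mulC_def by (simp add: algebra_simps)
    qed
    finally show ?thesis .
  next
    case False
    then have l: "ln (u @ [s]) < ln u" using ln_snoc[of u s] by auto
    obtain x where x: "u @ [s] \<approx> x" "red x" using red_ex by blast
    have ux: "u \<approx> x @ [s]" using x(1) weq_moveR by blast
    have r: "red (x @ [s])" using l u(2) ln_cong[OF ux] ln_cong[OF x(1)] x(2) ln_snoc[of x s] by (simp add: red_def)
    have up: "ln x < ln (x @ [s])" using r x(2) by (simp add: red_def)
    have w': "w = welt m (x @ [s])" using u(1) ux welt_eq_iff by simp
    have hw: "hT w = hTs m (hT (welt m x)) s" unfolding w' hTs_hT_up[OF up] ..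
    have I: "Tinv w = Ti (Tinv (welt m x)) s" using Tinv_welt[OF r] Tinv_welt[OF x(2)] w' by simp
    have I': "hTs m (Tinv w) s = Tinv (welt m x)" unfolding I by (rule hTs_Ti) (simp add: Tinv_HS)
    have sh: "c * fls_X = fls_shift (- 1) c" by (simp add: fls_X_times_conv_shift)
    have lb: "lbar (fls_shift (- 1) c) = fls_X_inv * lbar c" "lpoly (fls_shift (- 1) c)"
      using c by (simp_all add: lbar_shift lpoly_shift fls_X_inv_times_conv_shift)
    have q: "hTs m (hT w) s = (\<lambda>y. fls_X ^ 2 * hT (welt m x) y + (fls_X ^ 2 - 1) * hT w y)"
      using hTs_quad[OF HS_hT, of "welt m x" s] hw by simp
    have "(\<lambda>y. c * mulC (hT w) s y) = (\<lambda>y. fls_shift (- 1) c * hT (welt m x) y + fls_shift (- 1) c * hT w y)"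
    proof
      fix y
      have "c * mulC (hT w) s y = c * (fls_X_inv * (fls_X\<^sup>2 * (hT (welt m x) y + hT w y)))"
        unfolding mulC_def q by (simp add: algebra_simps)
      then show "c * mulC (hT w) s y = fls_shift (- 1) c * hT (welt m x) y + fls_shift (- 1) c * hT w y"
        unfolding X2_inv sh[symmetric] by (simp add: algebra_simps)
    qed
    then have "iota m (\<lambda>y. c * mulC (hT w) s y) = (\<lambda>y. fls_X_inv * lbar c * Tinv (welt m x) y + fls_X_inv * lbar c * Tinv w y)"
      using two[OF lb(2) lb(2), of "welt m x" w] w lb(1) by simp
    also have "\<dots> = (\<lambda>y. lbar c * mulC (Tinv w) s y)"
      unfolding mulC_def I' by (simp add: algebra_simps)
    finally show ?thesis .
  qed
qed

text \<open>\<open>C'_s\<close> is fixed by \<open>iota\<close>. This instance of multiplicativity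
  keeps the recursion for \<open>C'_w\<close> among the invariant elements.\<close>

lemma iota_mulC: "h \<in> LH \<Longrightarrow> iota m (mulC h s) = mulC (iota m h) s"
proof (induction rule: LH_induct)
  case zero
  have z: "mulC (\<lambda>_. 0) s = (\<lambda>_. 0)" using mulC_lin[of 0 "\<lambda>_. 0" 0 "\<lambda>_. 0" s] by simp
  show ?case unfolding z iota_zero ..
next
  case (add h c w)
  have 1: "(\<lambda>y. c * mulC (hT w) s y) \<in> LH"
  proof -
    have "(\<lambda>y. c * mulC (hT w) s y) = mulC (\<lambda>y. c * hT w y) s" using mulC_lin[of c "hT w" 0 "\<lambda>_. 0" s] by simp
    then show ?thesis using mulC_LH[OF LH_hT[OF add(2,3)]] by simp
  qed
  have "iota m (mulC (\<lambda>y. h y + c * hT w y) s) = iota m (\<lambda>y. mulC h s y + c * mulC (hT w) s y)"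
    using mulC_lin[of 1 h c "hT w" s] by simp
  also have "\<dots> = (\<lambda>y. mulC (iota m h) s y + lbar c * mulC (Tinv w) s y)"
    using iota_add[OF mulC_LH[OF add(1)] 1] add(4) iota_mulC_hT[OF add(2,3)] by simp
  also have "\<dots> = mulC (\<lambda>y. iota m h y + lbar c * Tinv w y) s"
    using mulC_lin[of 1 "iota m h" "lbar c" "Tinv w" s] by simp
  also have "(\<lambda>y. iota m h y + lbar c * Tinv w y) = iota m (\<lambda>y. h y + c * hT w y)"
    using iota_add[OF add(1) LH_hT[OF add(2,3)]] iota_hT by simp
  finally show ?case .
qed

end

section \<open>Kazhdan--Lusztig polynomials\<close>

lemma intpow_shift: "fls_shift k 1 * f = fls_shift k (f :: int fls)"
  using fls_X_intpow_times_conv_shift(1)[of "- k" f] by simp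

section \<open>Uniqueness of the Kazhdan--Lusztig family\<close>

context coxeter begin

lemma iota_leading:
  assumes h: "h \<in> HS" and x: "x \<in> Wgrp m" and mx: "\<And>w. h w \<noteq> 0 \<Longrightarrow> wlen w \<le> wlen x"
  shows "iota m h x = lbar (h x) * fls_X_inv ^ (2 * wlen x)"
proof -
  obtain z where z: "x = welt m z" "red z" using Wgrp_cases[OF x] by blast
  have z0: "Tinv w x = 0" if w: "h w \<noteq> 0" "w \<noteq> x" for w
  proof -
    have "w \<in> Wgrp m" using w HS_out[OF h] by blast
    then obtain u where u: "w = welt m u" "red u" using Wgrp_cases by blast
    have "length u \<le> ln z" using mx[OF w(1)] u z by (simp add: red_def)
    moreover have "\<not> z \<approx> u" using w(2) u z welt_eq_iff by metis
    ultimately show ?thesis unfolding u(1) Tinv_welt[OF u(2)] z(1) using Tinv_tri[OF u(2)] by blast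
  qed
  let ?A = "insert x {w. h w \<noteq> 0}"
  have "iota m h x = (\<Sum>w\<in>?A. lbar (h w) * Tinv w x)"
    by (rule iota_sup) (use HS_finite[OF h] in auto)
  also have "\<dots> = (\<Sum>w\<in>{x}. lbar (h w) * Tinv w x)"
    by (rule sum.mono_neutral_right) (use HS_finite[OF h] z0 in auto)
  also have "\<dots> = lbar (h x) * fls_X_inv ^ (2 * wlen x)"
    using Tinv_tri[OF z(2)] z by (simp add: Tinv_welt red_def)
  finally show ?thesis .
qed

abbreviation cvec :: "'i list set \<Rightarrow> ('i list set \<Rightarrow> int fls) \<Rightarrow> 'i list set \<Rightarrow> int fls" where
  "cvec w P \<equiv> (\<lambda>x. fls_X_intpow (- int (wlen w)) * P x)"

lemma kl_family_coef:
  assumes K: "kl_family m w P" and nz: "fls_nth (P x) k \<noteq> 0"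
  shows "bruhat_le m x w" "0 \<le> k" "even k" "x = w \<and> k = 0 \<or> x \<noteq> w \<and> k \<le> int (wlen w) - int (wlen x) - 1"
proof -
  have "P x \<noteq> 0" using nz by auto
  then show b: "bruhat_le m x w" using K by (auto simp: kl_family_def)
  have "(x = w \<longrightarrow> k = 0) \<and> (x \<noteq> w \<longrightarrow> 0 \<le> k \<and> even k \<and> k \<le> int (wlen w) - int (wlen x) - 1)"
  proof (intro conjI impI)
    assume "x = w"
    then show "k = 0" using K nz by (auto simp: kl_family_def split: if_splits)
  next
    assume "x \<noteq> w"
    then have "bruhat_lt m x w" using b by (simp add: bruhat_lt_def)
    then have "0 \<le> k \<and> even k \<and> k \<le> int (wlen w) - int (wlen x) - 1" using K nz unfolding kl_family_def by blast
    then show "0 \<le> k" "even k" "k \<le> int (wlen w) - int (wlen x) - 1" by auto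
  qed
  then show "0 \<le> k" "even k" "x = w \<and> k = 0 \<or> x \<noteq> w \<and> k \<le> int (wlen w) - int (wlen x) - 1" by auto
qed

lemma kl_family_lpoly: assumes "kl_family m w P" shows "lpoly (P x)"
  unfolding lpoly_def
proof (rule finite_subset)
  show "{n. fls_nth (P x) n \<noteq> 0} \<subseteq> {0..int (wlen w)}"
    using kl_family_coef[OF assms, of x] by fastforce
qed simp

lemma kl_family_LH: assumes "kl_family m w P" shows "cvec w P \<in> LH"
proof -
  have "P x = 0" if "x \<notin> {x. bruhat_le m x w}" for x using assms that by (auto simp: kl_family_def)
  then have "cvec w P \<in> HS" by (intro HS_I[OF finite_lower[of w]]) (auto simp: bruhat_in)
  then show ?thesis using kl_family_lpoly[OF assms]
    by (auto simp: LH_def intpow_shift intro: lpoly_shift)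
qed

text \<open>At an element \<open>x\<close> of maximal length where the families differ, invariance
  makes the exponents of the difference symmetric about \<open>- wlen x\<close>, by
  \<open>iota_leading\<close>. The degree bound, shifted by \<open>- wlen w\<close>, puts all of
  them strictly below that point.\<close>

lemma kl_family_unique:
  assumes P: "kl_family m w P" and Q: "kl_family m w Q" shows "P = Q"
proof (rule ccontr)
  assume "P \<noteq> Q"
  let ?d = "\<lambda>x. cvec w P x + fls_const (- 1) * cvec w Q x"
  have d: "?d x = fls_shift (int (wlen w)) (P x - Q x)" for x
    by (simp add: intpow_shift fls_eq_iff)
  have dLH: "?d \<in> LH" by (intro LH_add LH_const kl_family_LH P Q)
  have io: "iota m ?d = ?d"
    unfolding iota_add[OF kl_family_LH[OF P] LH_const[OF kl_family_LH[OF Q]]] iota_const[OF kl_family_LH[OF Q]]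
    using P Q by (auto simp: kl_family_def)
  let ?A = "{x. P x \<noteq> Q x}"
  have dA: "?d x \<noteq> 0 \<longleftrightarrow> x \<in> ?A" for x unfolding d fls_shift_eq0_iff by simp
  have "finite {x. ?d x \<noteq> 0}" using dLH HS_finite unfolding LH_def by blast
  then have fin: "finite ?A" unfolding dA by simp
  have ne: "?A \<noteq> {}" using \<open>P \<noteq> Q\<close> by auto
  have "Max (wlen ` ?A) \<in> wlen ` ?A" using fin ne by simp
  then obtain x where x: "x \<in> ?A" and "Max (wlen ` ?A) = wlen x" by (rule imageE)
  then have xmax: "wlen z \<le> wlen x" if "z \<in> ?A" for z
    using Max_ge[of "wlen ` ?A" "wlen z"] fin that by simp
  have dHS: "?d \<in> HS" using dLH by (simp add: LH_def)
  have xW: "x \<in> Wgrp m" using HS_out[OF dHS, of x] dA x by blast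
  have xw: "x \<noteq> w" using x P Q by (auto simp: kl_family_def)
  have lead: "?d x = lbar (?d x) * fls_X_inv ^ (2 * wlen x)"
  proof (rule trans[OF fun_cong[OF io, of x, symmetric]], rule iota_leading[OF dHS xW])
    fix z assume "?d z \<noteq> 0"
    then show "wlen z \<le> wlen x" using xmax dA by blast
  qed
  have sym: "fls_nth (?d x) k = fls_nth (?d x) (- k - 2 * int (wlen x))" for k
  proof -
    have lp: "lpoly (?d x)" using dLH by (simp add: LH_def)
    have "fls_nth (?d x) k = fls_nth (lbar (?d x) * fls_X_inv ^ (2 * wlen x)) k" using lead by simp
    also have "\<dots> = fls_nth (lbar (?d x)) (k + 2 * int (wlen x))"
      by (simp add: fls_X_inv_power_times_conv_shift)
    also have "\<dots> = fls_nth (?d x) (- k - 2 * int (wlen x))" unfolding lbar_nth[OF lp] by (simp add: algebra_simps)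
    finally show ?thesis .
  qed
  have bnd: "k \<le> - int (wlen x) - 1" if "fls_nth (?d x) k \<noteq> 0" for k
  proof -
    have "fls_nth (P x) (k + int (wlen w)) \<noteq> 0 \<or> fls_nth (Q x) (k + int (wlen w)) \<noteq> 0"
      using that unfolding d by auto
    then show ?thesis using kl_family_coef(4)[OF P, of x] kl_family_coef(4)[OF Q, of x] xw by fastforce
  qed
  have "fls_nth (?d x) k = 0" for k
  proof (rule ccontr)
    assume "fls_nth (?d x) k \<noteq> 0"
    then have "k \<le> - int (wlen x) - 1" "- k - 2 * int (wlen x) \<le> - int (wlen x) - 1"
      using bnd[of k] bnd[of "- k - 2 * int (wlen x)"] sym[of k] by auto
    then show False by simp
  qed
  then have "?d x = 0" by (simp add: fls_eq_iff)
  then show False using dA x by blast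
qed

lemma kl_family_one: "kl_family m (wone m) (hT (wone m))"
proof -
  have "\<not> bruhat_lt m x (wone m)" for x
    using bruhat_lt_len[of x "wone m"] by (auto simp: wone_def)
  moreover have "iota m (hT (wone m)) y = hT (wone m) y" for y
    using iota_hT[of 1 "wone m" y] Tinv_welt[of "[]"] by (simp add: lbar_one wone_def red_def)
  ultimately show ?thesis
    by (auto simp: kl_family_def wone_def hT_def bruhat_refl fun_eq_iff)
qed

section \<open>The recursion from \<open>u\<close> to \<open>u s\<close>, with \<open>K\<close> the
  families at smaller length\<close>

context
  fixes u s P K
  assumes r: "red (u @ [s])" and P: "kl_family m (welt m u) P"
    and K: "\<And>z. z \<in> Wgrp m \<Longrightarrow> wlen z < length u \<Longrightarrow> kl_family m z (K z)"
begin

definition kZ where "kZ = {z. bruhat_lt m z (welt m u) \<and> wlen (wmul m z (gen m s)) < wlen z}"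

text \<open>The number mu(z,u): the coefficient at the largest exponent that the degree bound
  allows, which in powers of \<open>v\<close> is the difference of lengths minus one.\<close>

definition kmu :: "'i list set \<Rightarrow> int" where
  "kmu z = fls_nth (P z) (int (length u) - int (wlen z) - 1)"

text \<open>What \<open>mu(z,u) C'_z\<close> contributes to the coefficient of v^k at
  \<open>x\<close>; the shift of the exponent is the difference of the normalising powers for
  \<open>u s\<close> and \<open>z\<close>.\<close>

definition kterm :: "'i list set \<Rightarrow> int \<Rightarrow> 'i list set \<Rightarrow> int" where
  "kterm x k z = kmu z * fls_nth (K z x) (k - (int (Suc (length u)) - int (wlen z)))"

definition kC :: "'i list set \<Rightarrow> int fls" where
  "kC = (\<lambda>x. mulC (cvec (welt m u) P) s x + fls_const (- 1) * (\<Sum>z\<in>kZ. fls_const (kmu z) * cvec z (K z) x))"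

definition kP :: "'i list set \<Rightarrow> int fls" where
  "kP = (\<lambda>x. fls_X_intpow (int (Suc (length u))) * kC x)"

lemma lu: "ln u = length u" "ln (u @ [s]) = Suc (length u)"
  using r red_append(1)[OF r] by (auto simp: red_def)

lemma kZ_fin: "finite kZ"
  by (rule finite_subset[OF _ finite_lower[of "welt m u"]]) (auto simp: kZ_def bruhat_lt_def)

lemma kZ_D: assumes "z \<in> kZ" shows "bruhat_le m z (welt m u)" "z \<in> Wgrp m" "wlen z < length u" "kl_family m z (K z)"
proof -
  show 1: "bruhat_le m z (welt m u)" using assms by (auto simp: kZ_def bruhat_lt_def)
  then show 2: "z \<in> Wgrp m" by (rule bruhat_in)
  have "wlen z < ln u" using assms bruhat_lt_len by (auto simp: kZ_def)
  then show 3: "wlen z < length u" using lu by simp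
  show "kl_family m z (K z)" using K 2 3 .
qed

lemma kC_inv: "kC \<in> LH \<and> iota m kC = kC"
proof -
  have 1: "(\<lambda>x. \<Sum>z\<in>Z. fls_const (kmu z) * cvec z (K z) x) \<in> LH \<and>
     iota m (\<lambda>x. \<Sum>z\<in>Z. fls_const (kmu z) * cvec z (K z) x) = (\<lambda>x. \<Sum>z\<in>Z. fls_const (kmu z) * cvec z (K z) x)"
    if "finite Z" "Z \<subseteq> kZ" for Z using that
  proof (induction Z rule: finite_induct)
    case empty
    then show ?case by (simp add: LH_zero iota_zero)
  next
    case (insert z Z)
    have Kz: "kl_family m z (K z)" using kZ_D insert by blast
    have L: "cvec z (K z) \<in> LH" "iota m (cvec z (K z)) = cvec z (K z)"
      using kl_family_LH[OF Kz] Kz by (auto simp: kl_family_def)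
    have "(\<lambda>x. \<Sum>z\<in>insert z Z. fls_const (kmu z) * cvec z (K z) x)
       = (\<lambda>x. fls_const (kmu z) * cvec z (K z) x + (\<Sum>z\<in>Z. fls_const (kmu z) * cvec z (K z) x))"
      using insert by simp
    then show ?case using insert LH_add[OF LH_const[OF L(1)]] iota_add[OF LH_const[OF L(1)]] iota_const[OF L(1)] L(2)
      by simp
  qed
  have L: "cvec (welt m u) P \<in> LH" "iota m (cvec (welt m u) P) = cvec (welt m u) P"
    using kl_family_LH[OF P] P by (auto simp: kl_family_def)
  define b where "b = (\<lambda>x. \<Sum>z\<in>kZ. fls_const (kmu z) * cvec z (K z) x)"
  have b: "b \<in> LH" "iota m b = b" using 1[OF kZ_fin order_refl] unfolding b_def by auto
  have a: "mulC (cvec (welt m u) P) s \<in> LH" "iota m (mulC (cvec (welt m u) P) s) = mulC (cvec (welt m u) P) s"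
    using mulC_LH[OF L(1)] iota_mulC[OF L(1)] L(2) by auto
  have kC: "kC = (\<lambda>x. mulC (cvec (welt m u) P) s x + fls_const (- 1) * b x)"
    unfolding kC_def b_def ..
  show ?thesis unfolding kC iota_add[OF a(1) LH_const[OF b(1)]] iota_const[OF b(1)] a(2) b(2)
    by (intro conjI LH_add LH_const a b refl)
qed

lemma kP_nth: "fls_nth (kP (welt m y)) k =
   (if ln (y @ [s]) < ln y then fls_nth (P (welt m (y @ [s]))) k + fls_nth (P (welt m y)) (k - 2)
    else fls_nth (P (welt m (y @ [s]))) (k - 2) + fls_nth (P (welt m y)) k)
   - (\<Sum>z\<in>kZ. kterm (welt m y) k z)"
proof -
  have cz: "fls_nth (cvec z (K z) (welt m y)) (k - int (Suc (length u))) = fls_nth (K z (welt m y)) (k - (int (Suc (length u)) - int (wlen z)))" for z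
    by (simp add: intpow_shift algebra_simps)
  have "fls_nth (kP (welt m y)) k = fls_nth (kC (welt m y)) (k - int (Suc (length u)))"
    unfolding kP_def by (simp add: intpow_shift algebra_simps)
  also have "\<dots> = fls_nth (mulC (cvec (welt m u) P) s (welt m y)) (k - int (Suc (length u)))
     - (\<Sum>z\<in>kZ. kmu z * fls_nth (cvec z (K z) (welt m y)) (k - int (Suc (length u))))"
    unfolding kC_def by (simp add: fls_nth_sum)
  also have "fls_nth (mulC (cvec (welt m u) P) s (welt m y)) (k - int (Suc (length u))) =
     (if ln (y @ [s]) < ln y then fls_nth (P (welt m (y @ [s]))) k + fls_nth (P (welt m y)) (k - 2)
    else fls_nth (P (welt m (y @ [s]))) (k - 2) + fls_nth (P (welt m y)) k)"
    unfolding mulC_welt by (simp add: intpow_shift fls_X2 fls_X_inv_times_conv_shift lu)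
  finally show ?thesis unfolding cz kterm_def .
qed

text \<open>The translate by \<open>s\<close> of an element below \<open>u\<close> is below
  \<open>u s\<close> by the lifting property. The remaining terms are supported below
  \<open>u\<close> itself.\<close>

lemma kP_support: assumes "fls_nth (kP x) k \<noteq> 0" shows "bruhat_le m x (welt m (u @ [s]))"
proof -
  have up: "bruhat_le m (welt m u) (welt m (u @ [s]))"
    using bstep_snoc[of u s] lu by (auto simp: bruhat_le_iff)
  have "kC x \<noteq> 0" using assms unfolding kP_def by auto
  then have "x \<in> Wgrp m" using kC_inv HS_out unfolding LH_def by blast
  then obtain y where y: "x = welt m y" by (auto simp: Wgrp_def)
  consider j where "fls_nth (P (welt m (y @ [s]))) j \<noteq> 0" | j where "fls_nth (P x) j \<noteq> 0"
    | z j where "z \<in> kZ" "fls_nth (K z x) j \<noteq> 0"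
  proof (cases "\<exists>z\<in>kZ. \<exists>j. fls_nth (K z x) j \<noteq> 0")
    case False
    then have "(\<Sum>z\<in>kZ. kterm x k z) = 0" by (simp add: kterm_def)
    then have "fls_nth (P (welt m (y @ [s]))) k \<noteq> 0 \<or> fls_nth (P (welt m (y @ [s]))) (k - 2) \<noteq> 0 \<or>
        fls_nth (P x) k \<noteq> 0 \<or> fls_nth (P x) (k - 2) \<noteq> 0"
      using assms unfolding y kP_nth by (auto split: if_splits)
    then show ?thesis using that(1,2) by blast
  qed (use that in blast)
  then show ?thesis
  proof cases
    case 1
    have "bruhat_le m (welt m ((y @ [s]) @ [s])) (welt m (u @ [s]))"
      by (rule bruhat_lift_up[OF kl_family_coef(1)[OF P 1]]) (simp add: lu)
    then show ?thesis unfolding y by (simp add: welt_snoc2)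
  next
    case 2
    then show ?thesis using kl_family_coef(1)[OF P 2] up bruhat_trans by blast
  next
    case 3
    then show ?thesis using kl_family_coef(1)[OF kZ_D(4)[OF 3(1)] 3(2)] kZ_D(1)[OF 3(1)] up bruhat_trans by blast
  qed
qed

lemma kP_top: "kP (welt m (u @ [s])) = 1"
proof -
  have z: "P (welt m (u @ [s])) = 0"
  proof (rule ccontr)
    assume "P (welt m (u @ [s])) \<noteq> 0"
    then have "bruhat_le m (welt m (u @ [s])) (welt m u)" using P by (auto simp: kl_family_def)
    then show False using bruhat_len lu by fastforce
  qed
  have zz: "K z (welt m (u @ [s])) = 0" if z: "z \<in> kZ" for z
  proof (rule ccontr)
    assume "K z (welt m (u @ [s])) \<noteq> 0"
    then have "bruhat_le m (welt m (u @ [s])) z" using kZ_D(4)[OF z] by (auto simp: kl_family_def)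
    then show False using bruhat_len[of "welt m (u @ [s])" z] kZ_D(3)[OF z] lu by fastforce
  qed
  have "P (welt m u) = 1" using P by (simp add: kl_family_def)
  then show ?thesis
    by (simp add: fls_eq_iff kP_nth kterm_def welt_snoc2 z zz lu)
qed

text \<open>Only \<open>q P_{x,u}\<close> in the case \<open>xs < x\<close> can exceed the bound,
  and only by its top coefficient. That coefficient is \<open>kmu x\<close>, cancelled by the
  summand \<open>z = x\<close> because \<open>P_{x,x} = 1\<close>.\<close>

lemma kP_coef:
  assumes lt: "bruhat_lt m x (welt m (u @ [s]))" and nz: "fls_nth (kP x) k \<noteq> 0"
  shows "0 \<le> k \<and> even k \<and> k \<le> int (length u) - int (wlen x)"
proof -
  obtain y where y: "x = welt m y" using lt bruhat_in by (auto simp: bruhat_lt_def Wgrp_def)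
  have xw: "x \<noteq> welt m (u @ [s])" using lt by (simp add: bruhat_lt_def)
  let ?ys = "welt m (y @ [s])" and ?n = "int (length u)"
  have ysu: "?ys \<noteq> welt m u"
  proof
    assume "?ys = welt m u"
    then have "y @ [s] \<approx> u" by (simp add: welt_eq_iff)
    then show False using xw unfolding y welt_eq_iff weq_moveR by blast
  qed
  have mu_even: "even (?n - int (wlen z) - 1)" if "kmu z \<noteq> 0" for z
    using kl_family_coef(3)[OF P] that unfolding kmu_def by blast
  \<comment> \<open>A summand with \<open>z\<close> different from \<open>x\<close> obeys the bound
    already. Evenness follows from that of the exponents in \<open>P\<close> at \<open>z\<close> and
    in \<open>K z\<close> at \<open>x\<close>.\<close>
  have trm: "0 \<le> k \<and> even k \<and> (k \<le> ?n - int (wlen x) \<or> z = x)"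
    if z: "z \<in> kZ" and t: "kterm x k z \<noteq> 0" for z k
  proof -
    have 1: "kmu z \<noteq> 0" "fls_nth (K z x) (k - (int (Suc (length u)) - int (wlen z))) \<noteq> 0"
      using t by (auto simp: kterm_def)
    note c = kl_family_coef[OF kZ_D(4)[OF z] 1(2)]
    have "0 \<le> k" using c(2) kZ_D(3)[OF z] by simp
    moreover have "even k"
    proof -
      have "k = (k - (int (Suc (length u)) - int (wlen z))) + (?n - int (wlen z) - 1) + 2" by simp
      then show ?thesis using c(3) mu_even[OF 1(1)] by (metis even_add even_numeral)
    qed
    moreover have "k \<le> ?n - int (wlen x) \<or> z = x" using c(4) by auto
    ultimately show ?thesis by blast
  qed
  show ?thesis
  proof (cases "ln (y @ [s]) < ln y")
    case True
    then have l: "ln y = Suc (ln (y @ [s]))" using ln_snoc[of y s] by auto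
    have xu: "x \<noteq> welt m u"
    proof
      assume "x = welt m u"
      then have "y \<approx> u" using y welt_eq_iff by simp
      then have "ln y = ln u" "ln (y @ [s]) = ln (u @ [s])" using ln_cong weq_append[OF _ weq_refl, of y u "[s]"] by auto
      then show False using l lu by simp
    qed
    \<comment> \<open>The summand \<open>z = x\<close> is isolated: it lives in the single exponent
      that lies one above the bound.\<close>
    have sm: "(\<Sum>z\<in>kZ. kterm x k z) =
       (if x \<in> kZ \<and> k = ?n - int (wlen x) + 1 then kmu x else 0)
       + (\<Sum>z\<in>kZ - {x}. kterm x k z)" (is "?L = _")
    proof (cases "x \<in> kZ")
      case xZ: True
      have "K x x = 1" using kZ_D(4)[OF xZ] by (simp add: kl_family_def)
      then have "kterm x k x
          = (if x \<in> kZ \<and> k = ?n - int (wlen x) + 1 then kmu x else 0)" using xZ by (auto simp: kterm_def)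
      then show ?thesis unfolding sum.remove[OF kZ_fin xZ] by simp
    qed simp
    have nth: "fls_nth (kP x) k = fls_nth (P ?ys) k + (fls_nth (P x) (k - 2) - (if x \<in> kZ \<and> k = ?n - int (wlen x) + 1 then kmu x else 0))
       - (\<Sum>z\<in>kZ - {x}. kterm x k z)"
      using kP_nth[of y k] True sm unfolding y by simp
    consider "fls_nth (P ?ys) k \<noteq> 0" | "fls_nth (P x) (k - 2) \<noteq> (if x \<in> kZ \<and> k = ?n - int (wlen x) + 1 then kmu x else 0)"
      | z where "z \<in> kZ" "z \<noteq> x" "kterm x k z \<noteq> 0"
    proof (cases "\<exists>z\<in>kZ - {x}. kterm x k z \<noteq> 0")
      case False
      then have "(\<Sum>z\<in>kZ - {x}. kterm x k z) = 0"
        by (intro sum.neutral) blast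
      then show ?thesis using nz nth that(1,2) by fastforce
    qed (use that in blast)
    then show ?thesis
    proof cases
      case 1
      show ?thesis using kl_family_coef[OF P 1] ysu l lu unfolding y by auto
    next
      case 2
      have nzP: "fls_nth (P x) (k - 2) \<noteq> 0"
      proof
        assume 0: "fls_nth (P x) (k - 2) = 0"
        then have "x \<in> kZ" "k = ?n - int (wlen x) + 1" "kmu x \<noteq> 0" using 2 by (auto split: if_splits)
        then have "k - 2 = ?n - int (wlen x) - 1" by simp
        then have "kmu x = fls_nth (P x) (k - 2)" by (simp add: kmu_def)
        then show False using 0 \<open>kmu x \<noteq> 0\<close> by simp
      qed
      note c = kl_family_coef[OF P nzP]
      have xlt: "bruhat_lt m x (welt m u)" using c(1) xu by (simp add: bruhat_lt_def)
      have xZ: "x \<in> kZ" unfolding kZ_def using xlt True y by (simp add: gen_def wmul_welt)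
      have "k \<noteq> ?n - int (wlen x) + 1"
      proof
        assume k: "k = ?n - int (wlen x) + 1"
        then have "k - 2 = ?n - int (wlen x) - 1" by simp
        then have "kmu x = fls_nth (P x) (k - 2)" by (simp add: kmu_def)
        then show False using 2 k xZ by simp
      qed
      moreover have "k - 2 \<le> ?n - int (wlen x) - 1" using c(4) xu lu by simp
      ultimately show ?thesis using c(2,3) by auto
    next
      case 3
      then show ?thesis using trm by blast
    qed
  next
    case False
    then have l: "ln (y @ [s]) = Suc (ln y)" using ln_snoc[of y s] by auto
    have xZ: "x \<notin> kZ" using False y by (simp add: kZ_def gen_def wmul_welt)
    have nth: "fls_nth (kP x) k = fls_nth (P ?ys) (k - 2) + fls_nth (P x) k
       - (\<Sum>z\<in>kZ. kterm x k z)"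
      using kP_nth[of y k] False unfolding y by simp
    consider "fls_nth (P ?ys) (k - 2) \<noteq> 0" | "fls_nth (P x) k \<noteq> 0"
      | z where "z \<in> kZ" "kterm x k z \<noteq> 0"
    proof (cases "\<exists>z\<in>kZ. kterm x k z \<noteq> 0")
      case False
      then have "(\<Sum>z\<in>kZ. kterm x k z) = 0"
        by (intro sum.neutral) blast
      then show ?thesis using nz nth that(1,2) by fastforce
    qed (use that in blast)
    then show ?thesis
    proof cases
      case 1
      show ?thesis using kl_family_coef[OF P 1] ysu l lu unfolding y by auto
    next
      case 2
      show ?thesis using kl_family_coef[OF P 2] lu by auto
    next
      case 3
      then show ?thesis using trm xZ by blast
    qed
  qed
qed

lemma kl_family_step: "kl_family m (welt m (u @ [s])) kP"
  unfolding kl_family_def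
proof (intro conjI allI impI)
  show "kP (welt m (u @ [s])) = 1" by (rule kP_top)
next
  fix x assume "kP x \<noteq> 0"
  then obtain k where "fls_nth (kP x) k \<noteq> 0" by (auto simp: fls_eq_iff)
  then show "bruhat_le m x (welt m (u @ [s]))" by (rule kP_support)
next
  fix x k assume h: "bruhat_lt m x (welt m (u @ [s]))" "fls_nth (kP x) k \<noteq> 0"
  then show "0 \<le> k" "even k" "k \<le> int (ln (u @ [s])) - int (wlen x) - 1" using kP_coef[OF h] lu by auto
next
  have "cvec (welt m (u @ [s])) kP = kC"
    unfolding kP_def lu by (simp add: intpow_shift fun_eq_iff)
  then show "iota m (cvec (welt m (u @ [s])) kP) = cvec (welt m (u @ [s])) kP" using kC_inv by simp
qed

end

lemma kl_family_ex: "w \<in> Wgrp m \<Longrightarrow> \<exists>P. kl_family m w P"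
proof (induction "wlen w" arbitrary: w rule: less_induct)
  case less
  obtain v where v: "w = welt m v" "red v" using Wgrp_cases[OF less.prems] by blast
  show ?case
  proof (cases v rule: rev_cases)
    case Nil
    then show ?thesis using kl_family_one v by (auto simp: wone_def)
  next
    case (snoc u s)
    have ru: "red u" "red (u @ [s])" using v(2) snoc red_append(1)[of u "[s]"] by auto
    have l: "length u < wlen w" "ln u = length u" using v snoc ru by (auto simp: red_def)
    define K where "K z = (SOME P. kl_family m z P)" for z
    have K: "kl_family m z (K z)" if "z \<in> Wgrp m" "wlen z < length u" for z
      unfolding K_def using less.hyps[of z] that l someI_ex[of "kl_family m z"] by simp
    obtain P where P: "kl_family m (welt m u) P" using less.hyps[of "welt m u"] l by auto
    show ?thesis using kl_family_step[OF ru(2) P K] v(1) snoc by blast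
  qed
qed

lemma kl_family_kl: "w \<in> Wgrp m \<Longrightarrow> kl_family m w (\<lambda>x. kl m x w)"
  unfolding kl_def using theI'[of "kl_family m w"] kl_family_ex kl_family_unique by blast

end

section \<open>Chains\<close>

context coxeter begin

lemma kl_self: "w \<in> Wgrp m \<Longrightarrow> kl m w w = 1"
  and kl_nz: "w \<in> Wgrp m \<Longrightarrow> kl m x w \<noteq> 0 \<Longrightarrow> bruhat_le m x w"
  using kl_family_kl[of w] by (auto simp: kl_family_def)

text \<open>A scalar acts as right multiplication by \<open>c T_1\<close>.\<close>

lemma hJ_scale: assumes "a \<in> hJ m" shows "(\<lambda>y. c * a y) \<in> hJ m"
proof -
  have a: "a \<in> HS" using hJ_kill[OF assms] by blast
  have o: "hT (wone m) \<in> HS" unfolding wone_def by (simp add: HS_hT)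
  have "hmul m a (\<lambda>y. c * hT (wone m) y) = (\<lambda>y. c * a y)"
    using H.act_add[OF HS_zero o, of a c] H.run_welt[OF a, of "[]"]
    by (simp add: hmul_act H.act_zero H.act_hT wone_def red_def)
  moreover have "(\<lambda>y. c * hT (wone m) y) \<in> HS" using HS_add[OF HS_zero o, of c] by simp
  ultimately show ?thesis using hJ.J_rmul[OF assms] by metis
qed

lemma hJ_lincomb: "a \<in> hJ m \<Longrightarrow> b \<in> hJ m \<Longrightarrow> (\<lambda>y. a y + c * b y) \<in> hJ m"
  using hJ.J_add[OF _ hJ_scale] by blast

lemma hJ_sum: "finite Z \<Longrightarrow> (\<And>z. z \<in> Z \<Longrightarrow> f z \<in> hJ m) \<Longrightarrow> (\<lambda>y. \<Sum>z\<in>Z. c z * f z y) \<in> hJ m"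
proof (induction Z rule: finite_induct)
  case empty
  then show ?case by (simp add: hJ.J_zero)
next
  case (insert z Z)
  then show ?case using hJ.J_add[OF hJ_scale[of "f z" "c z"]] by simp
qed

definition ischain :: "'i list set \<Rightarrow> 'i list set list \<Rightarrow> bool" where
  "ischain x cs \<longleftrightarrow> (\<forall>i<length cs. bruhat_lt m ((x # cs) ! i) ((x # cs) ! Suc i))"

lemma ischain_snoc: "ischain x (cs @ [w]) \<longleftrightarrow> ischain x cs \<and> bruhat_lt m (last (x # cs)) w"
proof -
  have 1: "(x # cs @ [w]) ! i = (x # cs) ! i" "(x # cs @ [w]) ! Suc i = (x # cs) ! Suc i" if "i < length cs" for i
    using that by (auto simp: nth_append nth_Cons split: nat.splits)
  have 2: "(x # cs @ [w]) ! length cs = last (x # cs)" "(x # cs @ [w]) ! Suc (length cs) = w"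
    by (auto simp: last_conv_nth nth_append nth_Cons split: nat.splits)
  show ?thesis unfolding ischain_def using 1 2 by (auto simp: less_Suc_eq)
qed

lemma ischain_len: "ischain x cs \<Longrightarrow> wlen x + length cs \<le> wlen (last (x # cs))"
proof (induction cs rule: rev_induct)
  case (snoc w cs)
  then show ?case using bruhat_lt_len[of "last (x # cs)" w] by (auto simp: ischain_snoc split: if_splits)
qed simp

lemma ischain_lt: "ischain x cs \<Longrightarrow> cs \<noteq> [] \<Longrightarrow> bruhat_lt m x (last cs)"
proof (induction cs rule: rev_induct)
  case (snoc w cs)
  then show ?case using bruhat_lt_le_trans[of x "last cs" w] ischain_snoc[of x cs w]
    by (cases "cs = []") (simp_all add: bruhat_lt_def)
qed simp

text \<open>Every strict Bruhat step raises \<open>wlen\<close>, which bounds the number of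
  steps.\<close>

lemma nfc_chains_iff:
  "cs \<in> nfc_chains m x w \<longleftrightarrow> cs \<noteq> [] \<and> last cs = w \<and> ischain x cs \<and> (\<forall>y\<in>set cs. y \<notin> Wc m)"
  unfolding nfc_chains_def mem_Collect_eq ischain_def[symmetric]
  using ischain_len[of x cs] by (cases cs) auto

definition between :: "'i list set \<Rightarrow> 'i list set \<Rightarrow> 'i list set set" where
  "between x w = {z. z \<notin> Wc m \<and> bruhat_lt m x z \<and> bruhat_lt m z w}"

lemma finite_between: "finite (between x w)"
  by (rule finite_subset[OF _ finite_lower[of w]]) (auto simp: between_def bruhat_lt_def)

text \<open>Chains are cut at their last step, because the expansion of \<open>T_w\<close> modulo J
  involves the polynomials \<open>P_{z,w}\<close> with \<open>w\<close> on top.\<close>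

lemma nfc_chains_rec:
  assumes "bruhat_lt m x w" "w \<notin> Wc m"
  shows "nfc_chains m x w = insert [w] (\<Union>z\<in>between x w. (\<lambda>cs. cs @ [w]) ` nfc_chains m x z)"
proof (rule set_eqI)
  fix cs
  show "cs \<in> nfc_chains m x w \<longleftrightarrow> cs \<in> insert [w] (\<Union>z\<in>between x w. (\<lambda>cs. cs @ [w]) ` nfc_chains m x z)"
  proof (cases cs rule: rev_cases)
    case Nil
    then show ?thesis by (auto simp: nfc_chains_iff)
  next
    case (snoc ds v)
    show ?thesis
    proof (cases "ds = []")
      case True
      then show ?thesis using assms snoc ischain_snoc[of x "[]" v]
        by (auto simp: nfc_chains_iff ischain_def)
    next
      case False
      have "cs \<in> nfc_chains m x w \<longleftrightarrow> v = w \<and> ischain x ds \<and> bruhat_lt m (last ds) w \<and> (\<forall>y\<in>set ds. y \<notin> Wc m)"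
        using False snoc assms(2) by (auto simp: nfc_chains_iff ischain_snoc)
      also have "\<dots> \<longleftrightarrow> v = w \<and> last ds \<in> between x w \<and> ds \<in> nfc_chains m x (last ds)"
        using False ischain_lt[of x ds] by (auto simp: nfc_chains_iff between_def)
      also have "\<dots> \<longleftrightarrow> cs \<in> insert [w] (\<Union>z\<in>between x w. (\<lambda>cs. cs @ [w]) ` nfc_chains m x z)"
        using False snoc by (auto simp: nfc_chains_iff intro!: bexI[of _ "last ds"] image_eqI[of _ _ ds])
      finally show ?thesis .
    qed
  qed
qed

lemma finite_nfc_chains: "bruhat_lt m x w \<Longrightarrow> w \<notin> Wc m \<Longrightarrow> finite (nfc_chains m x w)"
proof (induction "wlen w" arbitrary: w rule: less_induct)
  case less
  have "finite (nfc_chains m x z)" if "z \<in> between x w" for z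
    using less.hyps[of z] that bruhat_lt_len by (auto simp: between_def)
  then show ?case unfolding nfc_chains_rec[OF less.prems] using finite_between by blast
qed

definition chsum :: "'i list set \<Rightarrow> 'i list set \<Rightarrow> int fls" where
  "chsum x w = (\<Sum>cs\<in>nfc_chains m x w. (-1) ^ length cs *
        (\<Prod>i<length cs. kl m ((x # cs) ! i) ((x # cs) ! Suc i)))"

lemma chsum_rec:
  assumes "bruhat_lt m x w" "w \<notin> Wc m"
  shows "chsum x w = - kl m x w - (\<Sum>z\<in>between x w. kl m z w * chsum x z)"
proof -
  let ?g = "\<lambda>cs. (-1) ^ length cs * (\<Prod>i<length cs. kl m ((x # cs) ! i) ((x # cs) ! Suc i))"
  let ?S = "\<lambda>z. (\<lambda>cs. cs @ [w]) ` nfc_chains m x z"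
  have fz: "finite (nfc_chains m x z)" if "z \<in> between x w" for z
    using that finite_nfc_chains by (auto simp: between_def)
  have g: "?g (cs @ [w]) = - kl m z w * ?g cs" if "cs \<in> nfc_chains m x z" for cs z
  proof -
    have z: "last cs = z" "cs \<noteq> []" using that by (auto simp: nfc_chains_iff)
    have 1: "(x # cs @ [w]) ! i = (x # cs) ! i" "(x # cs @ [w]) ! Suc i = (x # cs) ! Suc i" if "i < length cs" for i
      using that by (auto simp: nth_append nth_Cons split: nat.splits)
    have 2: "(x # cs @ [w]) ! length cs = z" "(x # cs @ [w]) ! Suc (length cs) = w"
      using z by (auto simp: last_conv_nth nth_append nth_Cons split: nat.splits)
    have "(\<Prod>i<Suc (length cs). kl m ((x # cs @ [w]) ! i) ((x # cs @ [w]) ! Suc i))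
        = (\<Prod>i<length cs. kl m ((x # cs) ! i) ((x # cs) ! Suc i)) * kl m z w"
      unfolding prod.lessThan_Suc 2 using 1 by simp
    then show ?thesis by simp
  qed
  have "chsum x w = ?g [w] + (\<Sum>cs\<in>(\<Union>z\<in>between x w. ?S z). ?g cs)"
    unfolding chsum_def nfc_chains_rec[OF assms]
  proof (rule sum.insert)
    show "finite (\<Union>z\<in>between x w. ?S z)" using finite_between fz by blast
    show "[w] \<notin> (\<Union>z\<in>between x w. ?S z)" by (auto simp: nfc_chains_iff)
  qed
  also have "(\<Sum>cs\<in>(\<Union>z\<in>between x w. ?S z). ?g cs) = (\<Sum>z\<in>between x w. \<Sum>cs\<in>?S z. ?g cs)"
  proof (rule sum.UNION_disjoint)
    show "\<forall>z\<in>between x w. \<forall>z'\<in>between x w. z \<noteq> z' \<longrightarrow> ?S z \<inter> ?S z' = {}"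
      by (auto simp: nfc_chains_iff)
  qed (use finite_between fz in auto)
  also have "\<dots> = (\<Sum>z\<in>between x w. - (kl m z w * chsum x z))"
  proof (rule sum.cong[OF refl])
    fix z assume "z \<in> between x w"
    have "(\<Sum>cs\<in>?S z. ?g cs) = (\<Sum>cs\<in>nfc_chains m x z. ?g (cs @ [w]))"
      by (subst sum.reindex) (auto simp: inj_on_def)
    also have "\<dots> = (\<Sum>cs\<in>nfc_chains m x z. - kl m z w * ?g cs)" using g by (rule sum.cong[OF refl])
    also have "\<dots> = - (kl m z w * chsum x z)" unfolding chsum_def by (simp add: sum_distrib_left sum_negf)
    finally show "(\<Sum>cs\<in>?S z. ?g cs) = - (kl m z w * chsum x z)" .
  qed
  finally show ?thesis by (simp add: sum_negf)
qed

definition dvec :: "'i list set \<Rightarrow> 'i list set \<Rightarrow> int fls" where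
  "dvec w = (\<lambda>x. if x \<in> Wc m \<and> bruhat_lt m x w then chsum x w else 0)"

text \<open>Start from \<open>v^l(w) C'_w\<close>, which lies in J, and subtract
  \<open>P_{z,w} (T_z - dvec z)\<close> for every \<open>z < w\<close> outside W_c, in J by
  induction. All these \<open>T_z\<close> cancel, and by \<open>chsum_rec\<close> the coefficient
  left at \<open>y\<close> in W_c is minus the chain sum.\<close>

lemma dvec_congruence:
  assumes P: "condition_P m" shows "w \<in> Wgrp m \<Longrightarrow> w \<notin> Wc m \<Longrightarrow> (\<lambda>y. hT w y - dvec w y) \<in> hJ m"
proof (induction "wlen w" arbitrary: w rule: less_induct)
  case less
  define Z where "Z = {z. z \<notin> Wc m \<and> bruhat_lt m z w}"
  have fin: "finite Z" by (rule finite_subset[OF _ finite_lower[of w]]) (auto simp: Z_def bruhat_lt_def)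
  have "Cprime m w \<in> hJ m" using P less.prems by (simp add: condition_P_def)
  then have "(\<lambda>y. fls_X_intpow (int (wlen w)) * Cprime m w y) \<in> hJ m" by (rule hJ_scale)
  moreover have "(\<lambda>y. fls_X_intpow (int (wlen w)) * Cprime m w y) = (\<lambda>y. kl m y w)"
    by (auto simp: Cprime_def intpow_shift)
  ultimately have Q: "(\<lambda>y. kl m y w) \<in> hJ m" by simp
  have S: "(\<lambda>y. \<Sum>z\<in>Z. kl m z w * (hT z y - dvec z y)) \<in> hJ m"
  proof (rule hJ_sum[OF fin])
    fix z assume z: "z \<in> Z"
    then have "z \<in> Wgrp m" using bruhat_in by (auto simp: Z_def bruhat_lt_def)
    then show "(\<lambda>y. hT z y - dvec z y) \<in> hJ m" using z less.hyps[of z] bruhat_lt_len by (auto simp: Z_def)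
  qed
  have "hT w y - dvec w y = kl m y w + (- 1) * (\<Sum>z\<in>Z. kl m z w * (hT z y - dvec z y))" for y
  proof -
    have hs: "(\<Sum>z\<in>Z. kl m z w * hT z y) = (if y \<in> Z then kl m y w else 0)"
    proof -
      have "(\<Sum>z\<in>Z. kl m z w * hT z y) = (\<Sum>z\<in>Z. if z = y then kl m z w else 0)"
        by (rule sum.cong) (auto simp: hT_def)
      then show ?thesis using fin by (simp add: sum.delta)
    qed
    have ds: "(\<Sum>z\<in>Z. kl m z w * dvec z y) = (if y \<in> Wc m then \<Sum>z\<in>between y w. kl m z w * chsum y z else 0)"
    proof (cases "y \<in> Wc m")
      case True
      have "(\<Sum>z\<in>Z. kl m z w * dvec z y) = (\<Sum>z\<in>between y w. kl m z w * dvec z y)"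
        by (rule sum.mono_neutral_right[OF fin]) (auto simp: Z_def between_def dvec_def)
      also have "\<dots> = (\<Sum>z\<in>between y w. kl m z w * chsum y z)"
        by (rule sum.cong) (auto simp: dvec_def between_def True)
      finally show ?thesis using True by simp
    qed (simp add: dvec_def)
    have e: "(\<Sum>z\<in>Z. kl m z w * (hT z y - dvec z y)) = (if y \<in> Z then kl m y w else 0) - (if y \<in> Wc m then \<Sum>z\<in>between y w. kl m z w * chsum y z else 0)"
      unfolding right_diff_distrib sum_subtractf hs ds ..
    consider "y = w" | "y \<in> Z" | "y \<in> Wc m" "bruhat_lt m y w" | "\<not> bruhat_le m y w" "y \<noteq> w"
      using less.prems by (auto simp: Z_def bruhat_lt_def)
    then show ?thesis
    proof cases
      case 1
      then show ?thesis unfolding e using less.prems kl_self by (simp add: hT_def dvec_def Z_def bruhat_lt_def)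
    next
      case 2
      then show ?thesis unfolding e by (auto simp: hT_def dvec_def Z_def bruhat_lt_def)
    next
      case 3
      then have "y \<notin> Z" "y \<noteq> w" using less.prems by (auto simp: Z_def)
      then show ?thesis unfolding e using 3 chsum_rec[OF 3(2) less.prems(2)] by (simp add: hT_def dvec_def)
    next
      case 4
      have "kl m y w = 0" using kl_nz less.prems 4 by blast
      moreover have "between y w = {}" "y \<notin> Z" "\<not> bruhat_lt m y w"
        using 4 bruhat_trans unfolding between_def Z_def bruhat_lt_def by blast+
      ultimately show ?thesis unfolding e using 4 by (simp add: hT_def dvec_def)
    qed
  qed
  then show ?case using hJ_lincomb[OF Q S, of "- 1"] by simp
qed

text \<open>Two candidates for the definite description differ by an element of J supported on W_c,
  which is zero by \<open>hJ_Wc_independent\<close>.\<close>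

lemma Dcoef_eq:
  assumes "condition_P m" "w \<in> Wgrp m" "w \<notin> Wc m" "x \<in> Wc m" "bruhat_lt m x w"
  shows "Dcoef m x w = chsum x w"
proof -
  let ?R = "\<lambda>d. (\<forall>y. d y \<noteq> 0 \<longrightarrow> y \<in> Wc m \<and> bruhat_le m y w) \<and> (\<lambda>y. hT w y - d y) \<in> hJ m"
  have R: "?R (dvec w)" using dvec_congruence[OF assms(1-3)] by (auto simp: dvec_def bruhat_lt_def)
  have "d = dvec w" if d: "?R d" for d
  proof -
    have "(\<lambda>y. (hT w y - d y) + (- 1) * (hT w y - dvec w y)) \<in> hJ m" using hJ_lincomb[of _ _ "- 1"] d R by blast
    then have "(\<lambda>y. dvec w y - d y) \<in> hJ m" by (simp add: algebra_simps)
    then have "(\<lambda>y. dvec w y - d y) = (\<lambda>_. 0)"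
    proof (rule hJ_Wc_independent)
      fix y assume "dvec w y - d y \<noteq> 0"
      then have "dvec w y \<noteq> 0 \<or> d y \<noteq> 0" by auto
      then show "y \<in> Wc m" using d R by blast
    qed
    then show ?thesis by (auto simp: fun_eq_iff)
  qed
  then have "(THE d. ?R d) = dvec w" using R by (intro the_equality)
  then show ?thesis using assms(4,5) unfolding Dcoef_def by (simp add: dvec_def)
qed

end

theorem mainTheorem5:
  fixes m :: "'i \<Rightarrow> 'i \<Rightarrow> nat" and x w :: "'i list set"
  assumes "coxeter_matrix m"
    and "condition_P m"
    and "x \<in> Wc m"
    and "w \<in> Wgrp m"
    and "w \<notin> Wc m"
    and "bruhat_lt m x w"
  shows "Dcoef m x w =
    (\<Sum>cs\<in>nfc_chains m x w. (-1) ^ length cs *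
        (\<Prod>i<length cs. kl m ((x # cs) ! i) ((x # cs) ! Suc i)))"
proof -
  interpret coxeter m by unfold_locales (rule assms(1))
  show ?thesis using Dcoef_eq[OF assms(2,4,5,3,6)] unfolding chsum_def .
qed

end
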